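(* Let $\delta>0$ and consider the system $$r_1' = v+2\delta r_1 l^3,\qquad v' = -\frac{r_1-1}{r_1^3}-2\delta v l^3,\qquad l' = -\delta l^4$$ on $\{(r_1,v,l): r_1>0,\ v\in\mathbb R,\ l\ge 0\}$, with the equilibrium $q_1:\ (r_1,v,l)=(1,0,0)$. The local stable set $W^s_{loc}(q_1)$ of $q_1$ is a smooth one-dimensional manifold, taking the graph form $$r_1 = 1+l^3F_1(l^3),\qquad v = l^3 G_1(l^3),\qquad l\in[0,l_0],$$ for $l_0>0$ small enough, where $F_1,G_1:[0,l_0]\to\mathbb R$ are Gevrey-1 smooth functions. Moreover, $$\frac{d^{2n}}{dx^{2n}}F_1(0)=0,\qquad \frac{d^{2n+1}}{dx^{2n+1}}G_1(0)=0$$ for all $n\in\mathbb N_0$.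
   Context: The system is the Kepler problem with linear drag $\ddot u+\delta\dot u+u/|u|^3=0$, $u=re^{i\theta}\in\mathbb C\setminus\{0\}$, written in the variables $l=r^2\dot\theta$ (angular momentum magnitude), $r_1=l^{-2}r$, $v=l\dot r$, after multiplying the vector field by $l^3$; the prime denotes differentiation with respect to the new time. The local stable set $W^s_{loc}(q_1)$ is the set of points in a sufficiently small neighborhood of $q_1$ in the phase space $\{r_1>0,\ l\ge0\}$ whose forward orbits stay in the neighborhood and converge to $q_1$. A formal series $\sum_n h_nx^n$ is Gevrey-1 if there are $a,b>0$ with $|h_n|\le a b^n n!$ for all $n$. Correspondingly, a smooth function $F:[0,c]\to\mathbb R$ is Gevrey-1 if there are $a,b>0$ with $\sup_{x\in[0,c]}|F^{(n)}(x)|\le a b^n (n!)^2$ for all $n$. Derivatives at the endpoint $0$ are one-sided. Here $l_0<1$, so that $l^3\in[0,l_0]$ for $l\in[0,l_0]$. *)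

theory Defs
  imports "HOL-Analysis.Analysis"
begin

text \<open>Phase points are triples \<open>(r1, v, l)\<close>.\<close>

definition phase_space :: "(real \<times> real \<times> real) set" where
  "phase_space = {(r1, v, l). r1 > 0 \<and> l \<ge> 0}"

definition kepler_field :: "real \<Rightarrow> real \<times> real \<times> real \<Rightarrow> real \<times> real \<times> real" where
  "kepler_field \<delta> = (\<lambda>(r1, v, l).
     (v + 2 * \<delta> * r1 * l ^ 3,
      - (r1 - 1) / r1 ^ 3 - 2 * \<delta> * v * l ^ 3,
      - \<delta> * l ^ 4))"

definition q1 :: "real \<times> real \<times> real" where
  "q1 = (1, 0, 0)"

definition forward_solution :: "real \<Rightarrow> (real \<Rightarrow> real \<times> real \<times> real) \<Rightarrow> bool" where
  "forward_solution \<delta> \<gamma> \<longleftrightarrow>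
     (\<forall>t\<ge>0. \<gamma> t \<in> phase_space \<and>
       (\<gamma> has_vector_derivative kepler_field \<delta> (\<gamma> t)) (at t within {0..}))"

text \<open>Neighborhoods are taken relative to the phase space: \<open>q1\<close> lies on its boundary \<open>l = 0\<close>.\<close>

definition phase_nhd :: "real \<times> real \<times> real \<Rightarrow> (real \<times> real \<times> real) set \<Rightarrow> bool" where
  "phase_nhd p U \<longleftrightarrow> U \<subseteq> phase_space \<and>
     (\<exists>W. openin (top_of_set phase_space) W \<and> p \<in> W \<and> W \<subseteq> U)"

definition local_stable_set ::
    "real \<Rightarrow> real \<times> real \<times> real \<Rightarrow> (real \<times> real \<times> real) set \<Rightarrow> (real \<times> real \<times> real) set" where
  "local_stable_set \<delta> q U =
     {p. \<exists>\<gamma>. forward_solution \<delta> \<gamma> \<and> \<gamma> 0 = p \<and> (\<forall>t\<ge>0. \<gamma> t \<in> U) \<and> (\<gamma> \<longlongrightarrow> q) at_top}"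

text \<open>
  Iterated derivative relative to \<open>S\<close>, hence one-sided at the endpoints of an interval.
  It is meaningful only at points of \<open>S\<close>, and there it depends only on the values of \<open>f\<close> on \<open>S\<close>.
\<close>

definition nth_deriv_within ::
    "real set \<Rightarrow> nat \<Rightarrow> (real \<Rightarrow> 'a::real_normed_vector) \<Rightarrow> real \<Rightarrow> 'a" where
  "nth_deriv_within S n f = ((\<lambda>g x. vector_derivative g (at x within S)) ^^ n) f"

definition smooth_within :: "real set \<Rightarrow> (real \<Rightarrow> 'a::real_normed_vector) \<Rightarrow> bool" where
  "smooth_within S f \<longleftrightarrow> (\<forall>n. nth_deriv_within S n f differentiable_on S)"

definition gevrey1 :: "real \<Rightarrow> (real \<Rightarrow> real) \<Rightarrow> bool" where
  "gevrey1 c F \<longleftrightarrow> smooth_within {0..c} F \<and>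
     (\<exists>a>0. \<exists>b>0. \<forall>n. \<forall>x\<in>{0..c}. \<bar>nth_deriv_within {0..c} n F x\<bar> \<le> a * b ^ n * (fact n)\<^sup>2)"

text \<open>
  Embedded one-dimensional smooth manifolds, possibly with boundary (the point \<open>q1\<close> is a
  boundary point of its stable set in \<open>l \<ge> 0\<close>). The parameter domain \<open>J\<close> of a chart may contain
  its endpoints, which then correspond to boundary points.
\<close>

definition smooth_1_manifold :: "(real \<times> real \<times> real) set \<Rightarrow> bool" where
  "smooth_1_manifold M \<longleftrightarrow>
     (\<forall>p\<in>M. \<exists>V J c g. open V \<and> p \<in> V \<and> is_interval J \<and> interior J \<noteq> {} \<and>
        homeomorphism J (M \<inter> V) c g \<and> smooth_within J c \<and>
        (\<forall>s\<in>J. vector_derivative c (at s within J) \<noteq> 0))"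

definition stable_graph :: "real \<Rightarrow> (real \<Rightarrow> real) \<Rightarrow> (real \<Rightarrow> real) \<Rightarrow> (real \<times> real \<times> real) set" where
  "stable_graph l0 F G = {(1 + l ^ 3 * F (l ^ 3), l ^ 3 * G (l ^ 3), l) | l. l \<in> {0..l0}}"

end

theory Submission
  imports Defs "HOL-Complex_Analysis.Cauchy_Integral_Formula" "HOL-Real_Asymp.Real_Asymp"
begin

text \<open>
  With \<open>p = 3 \<delta> l\<^sup>3\<close> one has \<open>p' = - p\<^sup>2\<close> and \<open>\<delta>\<close> disappears: a curve \<open>r1 = 1 + y(p)\<close>, \<open>v = v(p)\<close> is
  invariant iff \<open>p\<^sup>2 y' = - v - (2/3) p (1 + y)\<close> and \<open>p\<^sup>2 v' = y / (1 + y)\<^sup>3 + (2/3) p v\<close>. This system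
  has an irregular singular point at \<open>p = 0\<close> with exponents \<open>\<plusminus>\<i>\<close>, so its formal solution is Borel
  summable along the positive axis. In the Borel plane \<open>p\<^sup>2 d/dp\<close> becomes multiplication by \<open>s\<close>,
  products become convolutions, and the linear part is inverted by division by \<open>1 + s\<^sup>2\<close>. This is
  bounded on the strip \<open>\<bar>Im s\<bar> < 1/2\<close>, where the convolution equation is a contraction in a space of
  holomorphic functions of exponential growth. The strip is symmetric and the equation respects
  parity, which yields the vanishing derivatives. A Laplace integral of the solution gives \<open>y\<close> and \<open>v\<close>;
  Cauchy's estimates in the strip contribute one factor \<open>n!\<close> to the \<open>n\<close>-th derivative and the moments
  of the exponential contribute the other.

  Conversely, the difference of two solutions over the same \<open>p\<close> has an energy that is an adiabatic
  invariant: it changes at relative rate \<open>O(p\<^sup>2)\<close>, which is integrable in time. It therefore tends to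
  zero only if it vanishes, so every orbit that converges to \<open>q1\<close> lies on the curve.
\<close>

subsection \<open>Iterated one-sided derivatives\<close>

text \<open>The linearisation at \<open>q1\<close> has eigenvalues 0 and \<plusminus> i, hence no
  hyperbolic direction: the stable manifold theorem yields neither the curve nor the uniqueness of
  convergent orbits, and the two halves need separate arguments. The variable \<open>p\<close> comes
  from \<open>(l^3)' = - 3 \<delta> l^6\<close>; the factor \<open>3 \<delta>\<close> normalises
  this to \<open>p' = - p^2\<close> and turns \<open>2 \<delta> l^3\<close> into
  \<open>2/3 p\<close>. Parity comes from the symmetry \<open>(p, y, v) -> (- p, y, - v)\<close> of
  the equations. With \<open>y = p * L(Y)(p)\<close> and \<open>L(Y)(p)\<close> the integral of
  \<open>exp (- u) * Y(p u)\<close>, the factor \<open>p\<close> shifts parity, so \<open>Y\<close>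
  is odd and \<open>V\<close> even. The function F1 is \<open>3 \<delta> L(Y)(3 \<delta> x)\<close>,
  whose n-th derivative at 0 is \<open>(3 \<delta>)^(n+1) n!\<close> times that of \<open>Y\<close>.
  Constants are generous, not optimal. The growth rate 4000 makes a convolution cost only 4/4000.
  The Laplace integral converges for \<open>p < 1/4000\<close>, and \<open>p \<le> 1/8000\<close>
  leaves \<open>exp (- u / 2)\<close> to absorb the moments \<open>u^n\<close>. Cauchy discs of
  radius 1/4 produce \<open>exp (4000 / 4) = exp 1000\<close>.\<close>

lemma nth_deriv_within_Suc:
  "nth_deriv_within S (Suc n) f = (\<lambda>x. vector_derivative (nth_deriv_within S n f) (at x within S))"
  by (simp add: nth_deriv_within_def)

lemma nth_deriv_within_Suc_shift:
  "nth_deriv_within S (Suc n) f = nth_deriv_within S n (\<lambda>x. vector_derivative f (at x within S))"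
  unfolding nth_deriv_within_def by (simp only: funpow_Suc_right o_apply)

lemma nth_deriv_within_cong:
  assumes "\<And>x. x \<in> S \<Longrightarrow> f x = g x" "x \<in> S"
  shows "nth_deriv_within S n f x = nth_deriv_within S n g x"
  using assms(2)
proof (induction n arbitrary: x)
  case 0
  then show ?case using assms(1) by (simp add: nth_deriv_within_def)
next
  case (Suc n)
  \<comment> \<open>\<open>vector_derivative\<close> is a choice among the \<open>v\<close> that
    satisfy \<open>has_vector_derivative\<close>. Equivalence for every \<open>v\<close> therefore
    gives equal values even where no derivative exists.\<close>
  have "(nth_deriv_within S n f has_vector_derivative v) (at x within S) \<longleftrightarrow>
        (nth_deriv_within S n g has_vector_derivative v) (at x within S)" for v
    using has_vector_derivative_transform[OF Suc.prems, of "nth_deriv_within S n f" "nth_deriv_within S n g" v]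
      has_vector_derivative_transform[OF Suc.prems, of "nth_deriv_within S n g" "nth_deriv_within S n f" v]
      Suc.IH by auto
  then show ?case
    by (simp add: nth_deriv_within_Suc vector_derivative_def)
qed

lemma nth_deriv_within_eq:
  assumes lim: "\<And>x. x \<in> S \<Longrightarrow> at x within S \<noteq> bot"
    and D0: "\<And>x. x \<in> S \<Longrightarrow> f x = D 0 x"
    and D: "\<And>n x. x \<in> S \<Longrightarrow> (D n has_vector_derivative D (Suc n) x) (at x within S)"
    and "x \<in> S"
  shows "nth_deriv_within S n f x = D n x"
  using \<open>x \<in> S\<close>
proof (induction n arbitrary: x)
  case 0
  then show ?case using D0 by (simp add: nth_deriv_within_def)
next
  case (Suc n)
  have "(nth_deriv_within S n f has_vector_derivative D (Suc n) x) (at x within S)"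
    using has_vector_derivative_transform[OF Suc.prems _ D[OF Suc.prems, of n]] Suc.IH by auto
  then show ?case
    using lim[OF Suc.prems] by (simp add: nth_deriv_within_Suc vector_derivative_within)
qed

text \<open>Derivatives enter as existential witnesses, not through
  \<open>vector_derivative\<close>. Closure under sums, products and composition is then a plain
  induction, with no Leibniz or chain formula for higher orders.\<close>

primrec times_diff :: "nat \<Rightarrow> real set \<Rightarrow> (real \<Rightarrow> 'a::real_normed_vector) \<Rightarrow> bool" where
  "times_diff 0 S f = True"
| "times_diff (Suc n) S f =
     (\<exists>f'. (\<forall>x\<in>S. (f has_vector_derivative f' x) (at x within S)) \<and> times_diff n S f')"

text \<open>\<open>nth_deriv_within\<close> adds derivatives on the outside,
  \<open>times_diff\<close> peels them off on the inside; \<open>nth_deriv_within_Suc_shift\<close>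
  reconciles the two.\<close>

lemma differentiable_on_nth_deriv_within:
  assumes lim: "\<And>x. x \<in> S \<Longrightarrow> at x within S \<noteq> bot" and "times_diff (Suc n) S f"
  shows "nth_deriv_within S n f differentiable_on S"
  using assms(2)
proof (induction n arbitrary: f)
  case 0
  then show ?case
    by (auto simp: nth_deriv_within_def differentiable_on_def differentiable_def has_vector_derivative_def)
next
  case (Suc n)
  then obtain f' where f': "\<And>x. x \<in> S \<Longrightarrow> (f has_vector_derivative f' x) (at x within S)"
    and T: "times_diff (Suc n) S f'" by auto
  have eq: "vector_derivative f (at x within S) = f' x" if "x \<in> S" for x
    using vector_derivative_within[OF lim[OF that] f'[OF that]] .
  have "nth_deriv_within S (Suc n) f x = nth_deriv_within S n f' x" if "x \<in> S" for x
    unfolding nth_deriv_within_Suc_shift by (rule nth_deriv_within_cong[OF eq that])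
  then show ?case
    using Suc.IH[OF T] unfolding differentiable_on_def
    by (auto intro: differentiable_transform_within[OF _ zero_less_one])
qed

lemma times_diff_subset: "times_diff n S f \<Longrightarrow> T \<subseteq> S \<Longrightarrow> times_diff n T f"
proof (induction n arbitrary: f)
  case (Suc n)
  obtain f' where *: "\<forall>x\<in>S. (f has_vector_derivative f' x) (at x within S)" "times_diff n S f'"
    using Suc.prems by auto
  have "\<forall>x\<in>T. (f has_vector_derivative f' x) (at x within T)"
    using * Suc.prems(2) has_vector_derivative_within_subset by (metis subsetD)
  then show ?case
    unfolding times_diff.simps(2) by (intro exI[of _ f'] conjI Suc.IH[OF *(2) Suc.prems(2)])
qed simp

lemma times_diff_SucD: "times_diff (Suc n) S f \<Longrightarrow> times_diff n S f"
proof (induction n arbitrary: f)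
  case (Suc n)
  obtain f' where *: "\<forall>x\<in>S. (f has_vector_derivative f' x) (at x within S)" "times_diff (Suc n) S f'"
    using Suc.prems unfolding times_diff.simps(2)[of "Suc n"] by (elim exE conjE)
  show ?case
    unfolding times_diff.simps(2)[of n] by (intro exI[of _ f'] conjI *(1) Suc.IH[OF *(2)])
qed simp

lemma times_diff_const: "times_diff n S (\<lambda>x. c)"
proof (induction n arbitrary: c)
  case (Suc n)
  then show ?case by (auto intro!: exI[of _ "\<lambda>_. 0"] derivative_eq_intros)
qed simp

lemma times_diff_id: "times_diff n S (\<lambda>x. x)"
proof (cases n)
  case (Suc m)
  then show ?thesis
    by (auto intro!: exI[of _ "\<lambda>_. 1"] times_diff_const derivative_eq_intros)
qed simp

lemma times_diff_add: "times_diff n S f \<Longrightarrow> times_diff n S g \<Longrightarrow> times_diff n S (\<lambda>x. f x + g x)"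
proof (induction n arbitrary: f g)
  case (Suc n)
  then obtain f' g' where "\<forall>x\<in>S. (f has_vector_derivative f' x) (at x within S)" "times_diff n S f'"
     "\<forall>x\<in>S. (g has_vector_derivative g' x) (at x within S)" "times_diff n S g'"
    by auto
  then show ?case
    by (auto intro!: exI[of _ "\<lambda>x. f' x + g' x"] has_vector_derivative_add Suc.IH)
qed simp

lemma times_diff_mult:
  fixes f g :: "real \<Rightarrow> real"
  shows "times_diff n S f \<Longrightarrow> times_diff n S g \<Longrightarrow> times_diff n S (\<lambda>x. f x * g x)"
proof (induction n arbitrary: f g)
  case (Suc n)
  then obtain f' g' where *: "\<forall>x\<in>S. (f has_vector_derivative f' x) (at x within S)" "times_diff n S f'"
     "\<forall>x\<in>S. (g has_vector_derivative g' x) (at x within S)" "times_diff n S g'"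
    by auto
  have "times_diff n S (\<lambda>x. f x * g' x + f' x * g x)"
    using times_diff_SucD[OF Suc.prems(1)] times_diff_SucD[OF Suc.prems(2)] *
    by (intro times_diff_add Suc.IH)
  then show ?case using *
    by (auto intro!: exI[of _ "\<lambda>x. f x * g' x + f' x * g x"] has_vector_derivative_mult)
qed simp

lemma times_diff_power:
  fixes f :: "real \<Rightarrow> real"
  shows "times_diff n S f \<Longrightarrow> times_diff n S (\<lambda>x. f x ^ k)"
  by (induction k) (simp_all add: times_diff_const times_diff_mult del: times_diff.simps)

lemma times_diff_Pair: "times_diff n S f \<Longrightarrow> times_diff n S g \<Longrightarrow> times_diff n S (\<lambda>x. (f x, g x))"
proof (induction n arbitrary: f g)
  case (Suc n)
  then obtain f' g' where "\<forall>x\<in>S. (f has_vector_derivative f' x) (at x within S)" "times_diff n S f'"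
     "\<forall>x\<in>S. (g has_vector_derivative g' x) (at x within S)" "times_diff n S g'"
    by auto
  then show ?case using Suc.IH
    by (auto intro!: exI[of _ "\<lambda>x. (f' x, g' x)"] has_vector_derivative_Pair)
qed simp

lemma times_diff_compose:
  fixes f :: "real \<Rightarrow> real"
  assumes "q ` S \<subseteq> T"
  shows "times_diff n T f \<Longrightarrow> times_diff n S q \<Longrightarrow> times_diff n S (\<lambda>x. f (q x))"
proof (induction n arbitrary: f)
  case (Suc n)
  obtain f' q' where *: "\<forall>x\<in>T. (f has_vector_derivative f' x) (at x within T)" "times_diff n T f'"
     "\<forall>x\<in>S. (q has_vector_derivative q' x) (at x within S)" "times_diff n S q'"
    using Suc.prems by auto
  have "times_diff n S (\<lambda>x. q' x * f' (q x))"
    by (rule times_diff_mult[OF *(4) Suc.IH[OF *(2) times_diff_SucD[OF Suc.prems(2)]]])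
  moreover have "\<forall>x\<in>S. ((\<lambda>x. f (q x)) has_vector_derivative q' x * f' (q x)) (at x within S)"
  proof
    fix x assume that: "x \<in> S"
    have "(f has_vector_derivative f' (q x)) (at (q x) within q ` S)"
      using * assms that by (meson has_vector_derivative_within_subset image_subset_iff)
    then show "((\<lambda>x. f (q x)) has_vector_derivative q' x * f' (q x)) (at x within S)"
      using vector_diff_chain_within[of q "q' x" x S f "f' (q x)"] * that by (simp add: o_def)
  qed
  ultimately show ?case
    unfolding times_diff.simps by (intro exI[of _ "\<lambda>x. q' x * f' (q x)"] conjI)
qed simp

lemma times_diff_seq:
  assumes "\<And>n x. x \<in> S \<Longrightarrow> (D n has_vector_derivative D (Suc n) x) (at x within S)"
  shows "times_diff n S (D k)"
  using assms by (induction n arbitrary: k) auto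

lemma smooth_withinI:
  assumes "\<And>x. x \<in> S \<Longrightarrow> at x within S \<noteq> bot" "\<And>n. times_diff n S f"
  shows "smooth_within S f"
  unfolding smooth_within_def using assms differentiable_on_nth_deriv_within by metis

text \<open>A set with interior is not a singleton, and a connected set that is not a singleton has
  no isolated points.\<close>

lemma at_within_interval_neq_bot:
  fixes S :: "real set"
  assumes "is_interval S" "interior S \<noteq> {}" "x \<in> S"
  shows "at x within S \<noteq> bot"
proof -
  have "S \<noteq> {a}" for a using assms(2) by (metis interior_singleton)
  then show ?thesis
    using connected_imp_perfect[OF _ assms(3)] assms(1) is_interval_connected trivial_limit_within
    by blast
qed

subsection \<open>Convolution on a strip\<close>

text \<open>The half-width 1/2 keeps distance at least 1/2 from the poles \<plusminus> i of
  \<open>1 / (1 + s^2)\<close>, and the set is star-shaped about 0, as convolution along rays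
  requires.\<close>

definition strip :: "complex set" where
  "strip = {s. \<bar>Im s\<bar> < 1/2}"

lemma open_strip: "open strip"
  unfolding strip_def by (intro open_Collect_less continuous_intros)

lemma convex_strip: "convex strip"
proof -
  have "strip = {s. Im s < 1/2} \<inter> {s. Im s > - (1/2)}"
    by (auto simp: strip_def)
  then show ?thesis
    using convex_Int[OF convex_halfspace_Im_lt[of "1/2"] convex_halfspace_Im_gt[of "- (1/2)"]] by simp
qed

lemma strip_scale:
  assumes "s \<in> strip" "0 \<le> u" "u \<le> 1"
  shows "of_real u * s \<in> strip"
proof -
  have "\<bar>u * Im s\<bar> \<le> 1 * \<bar>Im s\<bar>"
    unfolding abs_mult using assms by (intro mult_right_mono) auto
  then show ?thesis using assms by (auto simp: strip_def)
qed

lemma of_real_strip [simp]: "of_real t \<in> strip"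
  by (simp add: strip_def)

lemma uminus_strip [simp]: "- s \<in> strip \<longleftrightarrow> s \<in> strip"
  by (simp add: strip_def)

text \<open>This is the integral of \<open>f \<sigma> * g (s - \<sigma>)\<close> along the segment
  from 0 to \<open>s\<close>, with \<open>\<sigma> = u s\<close>. The fixed interval for
  \<open>u\<close> allows differentiation in \<open>s\<close> under the integral sign.\<close>

definition conv :: "(complex \<Rightarrow> complex) \<Rightarrow> (complex \<Rightarrow> complex) \<Rightarrow> complex \<Rightarrow> complex" where
  "conv f g s = s * integral {0..1} (\<lambda>u. f (of_real u * s) * g (of_real (1 - u) * s))"

lemma continuous_on_strip_scale:
  assumes f: "continuous_on strip f"
  shows "continuous_on (strip \<times> {0..1}) (\<lambda>x. f (of_real (snd x) * fst x))"
    and "continuous_on (strip \<times> {0..1}) (\<lambda>x. f (of_real (1 - snd x) * fst x))"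
proof -
  show "continuous_on (strip \<times> {0..1}) (\<lambda>x. f (of_real (snd x) * fst x))"
  proof (rule continuous_on_compose2[OF f])
    show "continuous_on (strip \<times> {0..1}) (\<lambda>x. of_real (snd x) * fst x :: complex)"
      by (intro continuous_intros)
    show "(\<lambda>x. of_real (snd x) * fst x) ` (strip \<times> {0..1}) \<subseteq> strip"
      using strip_scale by fastforce
  qed
  show "continuous_on (strip \<times> {0..1}) (\<lambda>x. f (of_real (1 - snd x) * fst x))"
  proof (rule continuous_on_compose2[OF f])
    show "continuous_on (strip \<times> {0..1}) (\<lambda>x. of_real (1 - snd x) * fst x :: complex)"
      by (intro continuous_intros)
    show "(\<lambda>x. of_real (1 - snd x) * fst x) ` (strip \<times> {0..1}) \<subseteq> strip"
    proof (clarsimp simp del: of_real_diff)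
      fix s :: complex and u :: real assume "s \<in> strip" "0 \<le> u" "u \<le> 1"
      then show "of_real (1 - u) * s \<in> strip" by (intro strip_scale) auto
    qed
  qed
qed

lemma continuous_on_conv_integrand:
  assumes "f holomorphic_on strip" "g holomorphic_on strip" "s \<in> strip"
  shows "continuous_on {0..1} (\<lambda>u. f (of_real u * s) * g (of_real (1 - u) * s))"
proof -
  note c = holomorphic_on_imp_continuous_on[OF assms(1)] holomorphic_on_imp_continuous_on[OF assms(2)]
  have "continuous_on (strip \<times> {0..1}) (\<lambda>x. f (of_real (snd x) * fst x) * g (of_real (1 - snd x) * fst x))"
    by (intro continuous_on_mult continuous_on_strip_scale c)
  moreover have "continuous_on {0..1} (\<lambda>u. (s, u))" by (intro continuous_intros)
  moreover have "(\<lambda>u. (s, u)) ` {0..1} \<subseteq> strip \<times> {0..1}" using assms(3) by auto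
  ultimately have "continuous_on {0..1} (\<lambda>u. (\<lambda>x. f (of_real (snd x) * fst x) * g (of_real (1 - snd x) * fst x)) (s, u))"
    by (rule continuous_on_compose2)
  then show ?thesis by (simp only: fst_conv snd_conv)
qed

lemma integrable_conv:
  assumes "f holomorphic_on strip" "g holomorphic_on strip" "s \<in> strip"
  shows "(\<lambda>u. f (of_real u * s) * g (of_real (1 - u) * s)) integrable_on {0..1}"
  using continuous_on_conv_integrand[OF assms] by (rule integrable_continuous_real)

lemma holomorphic_conv:
  assumes f: "f holomorphic_on strip" and g: "g holomorphic_on strip"
  shows "conv f g holomorphic_on strip"
proof -
  note cf = holomorphic_on_imp_continuous_on[OF f] and cg = holomorphic_on_imp_continuous_on[OF g]
  note cf' = holomorphic_on_imp_continuous_on[OF holomorphic_deriv[OF f open_strip]]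
   and cg' = holomorphic_on_imp_continuous_on[OF holomorphic_deriv[OF g open_strip]]
  let ?h = "\<lambda>s u. f (of_real u * s) * g (of_real (1 - u) * s)"
  let ?h' = "\<lambda>s u. f (of_real u * s) * (deriv g (of_real (1 - u) * s) * of_real (1 - u))
      + (deriv f (of_real u * s) * of_real u) * g (of_real (1 - u) * s)"
  have "(\<lambda>s. integral (cbox 0 1) (?h s)) holomorphic_on strip"
  proof (rule leibniz_rule_holomorphic[OF _ _ _ convex_strip])
    fix s :: complex and u :: real
    assume s: "s \<in> strip" and u: "u \<in> cbox 0 1"
    have "of_real u * s \<in> strip" "of_real (1 - u) * s \<in> strip"
      using u by (intro strip_scale s; simp)+
    then have df: "(f has_field_derivative deriv f (of_real u * s)) (at (of_real u * s))"
      and dg: "(g has_field_derivative deriv g (of_real (1 - u) * s)) (at (of_real (1 - u) * s))"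
      using f g open_strip holomorphic_derivI by blast+
    have "((\<lambda>s. f (of_real u * s)) has_field_derivative deriv f (of_real u * s) * of_real u) (at s within strip)"
      by (rule DERIV_chain2[of f _ "\<lambda>s. of_real u * s", OF df]) (auto intro!: derivative_eq_intros)
    moreover have "((\<lambda>s. g (of_real (1 - u) * s)) has_field_derivative
        deriv g (of_real (1 - u) * s) * of_real (1 - u)) (at s within strip)"
      by (rule DERIV_chain2[of g _ "\<lambda>s. of_real (1 - u) * s", OF dg]) (auto intro!: derivative_eq_intros)
    ultimately show "((\<lambda>s. ?h s u) has_field_derivative ?h' s u) (at s within strip)"
      by (auto intro: DERIV_mult')
  next
    fix s :: complex assume "s \<in> strip"
    then show "?h s integrable_on cbox 0 1"
      using integrable_conv[OF f g] by simp
  next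
    have "continuous_on (strip \<times> {0..1}) (\<lambda>x. ?h' (fst x) (snd x))"
      by (intro continuous_intros continuous_on_strip_scale cf cg cf' cg')
    then show "continuous_on (strip \<times> cbox 0 1) (\<lambda>(s, u). ?h' s u)"
      by (simp add: case_prod_unfold)
  qed
  then have "(\<lambda>s. s * integral (cbox 0 1) (?h s)) holomorphic_on strip"
    by (intro holomorphic_on_mult holomorphic_on_ident)
  then show ?thesis
    by (simp add: conv_def[abs_def])
qed

lemma conv_diff_left:
  assumes "f holomorphic_on strip" "f' holomorphic_on strip" "g holomorphic_on strip" "s \<in> strip"
  shows "conv f g s - conv f' g s = conv (\<lambda>s. f s - f' s) g s"
proof -
  have "integral {0..1} (\<lambda>u. f (of_real u * s) * g (of_real (1 - u) * s)) -
    integral {0..1} (\<lambda>u. f' (of_real u * s) * g (of_real (1 - u) * s)) =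
    integral {0..1} (\<lambda>u. f (of_real u * s) * g (of_real (1 - u) * s) -
       f' (of_real u * s) * g (of_real (1 - u) * s))"
    by (rule Henstock_Kurzweil_Integration.integral_diff[symmetric]) (auto intro!: integrable_conv assms simp del: of_real_diff)
  then show ?thesis
    unfolding conv_def by (simp only: right_diff_distrib[symmetric] left_diff_distrib)
qed

lemma conv_diff_right:
  assumes "f holomorphic_on strip" "g holomorphic_on strip" "g' holomorphic_on strip" "s \<in> strip"
  shows "conv f g s - conv f g' s = conv f (\<lambda>s. g s - g' s) s"
proof -
  have "integral {0..1} (\<lambda>u. f (of_real u * s) * g (of_real (1 - u) * s)) -
    integral {0..1} (\<lambda>u. f (of_real u * s) * g' (of_real (1 - u) * s)) =
    integral {0..1} (\<lambda>u. f (of_real u * s) * g (of_real (1 - u) * s) -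
       f (of_real u * s) * g' (of_real (1 - u) * s))"
    by (rule Henstock_Kurzweil_Integration.integral_diff[symmetric]) (auto intro!: integrable_conv assms simp del: of_real_diff)
  then show ?thesis
    unfolding conv_def by (simp only: right_diff_distrib[symmetric])
qed

text \<open>The extra minus sign comes from the prefactor \<open>s\<close>: convolution of two odd
  functions is odd, of an odd and an even one even.\<close>

lemma conv_minus:
  assumes "\<And>s. s \<in> strip \<Longrightarrow> f (- s) = a * f s" "\<And>s. s \<in> strip \<Longrightarrow> g (- s) = b * g s" "s \<in> strip"
  shows "conv f g (- s) = - (a * b) * conv f g s"
proof -
  have "integral {0..1} (\<lambda>u. f (of_real u * - s) * g (of_real (1 - u) * - s))
      = integral {0..1} (\<lambda>u. (a * b) * (f (of_real u * s) * g (of_real (1 - u) * s)))"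
  proof (rule Henstock_Kurzweil_Integration.integral_cong)
    fix u :: real assume u: "u \<in> {0..1}"
    then have *: "of_real u * s \<in> strip" "of_real (1 - u) * s \<in> strip"
      using strip_scale[OF assms(3)] by (auto simp del: of_real_diff)
    show "f (of_real u * - s) * g (of_real (1 - u) * - s)
       = (a * b) * (f (of_real u * s) * g (of_real (1 - u) * s))"
      using assms(1)[OF *(1)] assms(2)[OF *(2)] by simp
  qed
  then show ?thesis
    unfolding conv_def by simp
qed

lemma conv_of_real:
  assumes "f holomorphic_on strip" "g holomorphic_on strip"
    and "\<And>t. f (of_real t) = of_real (f' t)" "\<And>t. g (of_real t) = of_real (g' t)"
  shows "conv f g (of_real t) = of_real (t * integral {0..1} (\<lambda>u. f' (u * t) * g' ((1 - u) * t)))"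
proof -
  let ?h = "\<lambda>u. f' (u * t) * g' ((1 - u) * t)"
  have *: "f (of_real u * of_real t) * g (of_real (1 - u) * of_real t) = of_real (?h u)" for u
    by (simp only: of_real_mult[symmetric] assms)
  have "(\<lambda>u. complex_of_real (?h u)) integrable_on {0..1}"
    using integrable_conv[OF assms(1,2) of_real_strip[of t]] unfolding * .
  from integrable_linear[OF this bounded_linear_Re] have "?h integrable_on {0..1}"
    by (simp add: o_def)
  from integral_linear[OF this bounded_linear_of_real]
  have "integral {0..1} (\<lambda>u. complex_of_real (?h u)) = of_real (integral {0..1} ?h)"
    by (simp only: o_def)
  then show ?thesis
    unfolding conv_def * by (simp only: of_real_mult[of t])
qed

text \<open>
  The factor \<open>(1 + K t)\<^sup>-\<^sup>2\<close> makes the convolution of two functions below the weight stay below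
  \<open>4 / K\<close> times the weight, and \<open>4 / K\<close> is small for large \<open>K\<close>.
\<close>

definition weight :: "real \<Rightarrow> real \<Rightarrow> real" where
  "weight K t = exp (K * t) / (1 + K * t)\<^sup>2"

section \<open>Estimates for the exponential weight\<close>

lemma weight_pos: "K \<ge> 0 \<Longrightarrow> t \<ge> 0 \<Longrightarrow> weight K t > 0"
  unfolding weight_def by (intro divide_pos_pos exp_gt_zero zero_less_power add_pos_nonneg mult_nonneg_nonneg) auto

lemma weight_le_exp: "K \<ge> 0 \<Longrightarrow> t \<ge> 0 \<Longrightarrow> weight K t \<le> exp (K * t)"
  using divide_left_mono[of 1 "(1 + K * t)\<^sup>2" "exp (K * t)"] unfolding weight_def
  by (simp add: add_nonneg_eq_0_iff one_le_power)

text \<open>Puts the constant 1, the transform of \<open>p\<close>, into the weighted space with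
  bound 2. It rests on \<open>exp x \<ge> 1 + x + x^2/2 \<ge> (1 + x)^2 / 2\<close>.\<close>

lemma one_le_weight:
  assumes "K \<ge> 0" "t \<ge> 0" shows "1 \<le> 2 * weight K t"
proof -
  have "1 + K * t + (K * t)\<^sup>2 / 2 \<le> exp (K * t)"
    using assms by (intro exp_lower_Taylor_quadratic) auto
  then have "(1 + K * t)\<^sup>2 \<le> 2 * exp (K * t)"
    by (simp add: power2_eq_square algebra_simps)
  moreover have "(1 + K * t)\<^sup>2 > 0"
    using assms by (intro zero_less_power add_pos_nonneg mult_nonneg_nonneg) auto
  ultimately show ?thesis
    unfolding weight_def using pos_le_divide_eq[of "(1 + K * t)\<^sup>2" 1 "2 * exp (K * t)"] by (simp del: zero_less_power2)
qed

text \<open>The antiderivative \<open>u / (1 + \<tau> u)\<close> is used because, unlike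
  \<open>- 1 / (\<tau> (1 + \<tau> u))\<close>, it also covers \<open>\<tau> = 0\<close>.\<close>

lemma has_integral_inverse_square:
  fixes \<tau> :: real assumes "\<tau> \<ge> 0"
  shows "((\<lambda>u. 1 / (1 + \<tau> * u)\<^sup>2) has_integral 1 / (1 + \<tau>)) {0..1}"
    and "((\<lambda>u. 1 / (1 + \<tau> * (1 - u))\<^sup>2) has_integral 1 / (1 + \<tau>)) {0..1}"
proof -
  have pos: "1 + \<tau> * u > 0" if "u \<ge> 0" for u using assms that by (simp add: add_pos_nonneg)
  have "((\<lambda>u. 1 / (1 + \<tau> * u)\<^sup>2) has_integral 1 / (1 + \<tau> * 1) - 0 / (1 + \<tau> * 0)) {0..1}"
  proof (rule fundamental_theorem_of_calculus)
    fix u :: real assume "u \<in> {0..1}"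
    then show "((\<lambda>u. u / (1 + \<tau> * u)) has_vector_derivative 1 / (1 + \<tau> * u)\<^sup>2) (at u within {0..1})"
      using pos[of u] unfolding has_real_derivative_iff_has_vector_derivative[symmetric]
      by (auto intro!: derivative_eq_intros simp: power2_eq_square)
  qed simp
  then show "((\<lambda>u. 1 / (1 + \<tau> * u)\<^sup>2) has_integral 1 / (1 + \<tau>)) {0..1}" by simp
  have "((\<lambda>u. 1 / (1 + \<tau> * (1 - u))\<^sup>2) has_integral
      - ((1 - 1) / (1 + \<tau> * (1 - 1))) - - ((1 - 0) / (1 + \<tau> * (1 - 0)))) {0..1}"
  proof (rule fundamental_theorem_of_calculus)
    fix u :: real assume "u \<in> {0..1}"
    then have "1 + \<tau> * (1 - u) > 0" using pos[of "1 - u"] by simp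
    then show "((\<lambda>u. - ((1 - u) / (1 + \<tau> * (1 - u)))) has_vector_derivative 1 / (1 + \<tau> * (1 - u))\<^sup>2) (at u within {0..1})"
      unfolding has_real_derivative_iff_has_vector_derivative[symmetric]
      by (auto intro!: derivative_eq_intros simp: power2_eq_square)
  qed simp
  then show "((\<lambda>u. 1 / (1 + \<tau> * (1 - u))\<^sup>2) has_integral 1 / (1 + \<tau>)) {0..1}" by simp
qed

text \<open>The two factors \<open>a\<close>, \<open>b\<close> satisfy
  \<open>a + b = 2 + \<tau>\<close>, so \<open>(1 + \<tau>)^2 \<le> 2 (a^2 + b^2)\<close>; division
  by the product separates them. The decay \<open>(1 + \<tau>)^-2\<close> of the weight is thus
  recovered before integration over \<open>u\<close>.\<close>

lemma product_inverse_square_le: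
  fixes \<tau> u :: real
  assumes "\<tau> \<ge> 0" "0 \<le> u" "u \<le> 1"
  shows "1 / ((1 + \<tau> * u)\<^sup>2 * (1 + \<tau> * (1 - u))\<^sup>2)
     \<le> 2 / (1 + \<tau>)\<^sup>2 * (1 / (1 + \<tau> * u)\<^sup>2 + 1 / (1 + \<tau> * (1 - u))\<^sup>2)"
proof -
  define a b where "a = 1 + \<tau> * u" and "b = 1 + \<tau> * (1 - u)"
  have ab: "a \<ge> 1" "b \<ge> 1" "a + b = 2 + \<tau>"
    using assms by (auto simp: a_def b_def algebra_simps mult_left_le)
  have "(1 + \<tau>)\<^sup>2 \<le> (a + b)\<^sup>2"
    using ab assms by (intro power_mono) auto
  also have "\<dots> \<le> 2 * (a\<^sup>2 + b\<^sup>2)"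
    using sum_squares_bound[of a b] by (simp add: power2_eq_square algebra_simps)
  finally have *: "(1 + \<tau>)\<^sup>2 \<le> 2 * (a\<^sup>2 + b\<^sup>2)" .
  have "a\<^sup>2 > 0" "b\<^sup>2 > 0" "(1 + \<tau>)\<^sup>2 > 0" using ab assms by auto
  then have "1 / (a\<^sup>2 * b\<^sup>2) \<le> 2 / (1 + \<tau>)\<^sup>2 * (1 / a\<^sup>2 + 1 / b\<^sup>2)"
    using * by (simp add: field_simps)
  then show ?thesis by (simp add: a_def b_def)
qed

text \<open>An upper bound for a weighted sup norm. Since only upper bounds are ever propagated, no
  normed function space has to be built.\<close>

definition weighted_bound :: "real \<Rightarrow> real \<Rightarrow> (complex \<Rightarrow> complex) \<Rightarrow> bool" where
  "weighted_bound K c f \<longleftrightarrow> (\<forall>s\<in>strip. norm (f s) \<le> c * weight K (norm s))"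

lemma weighted_boundD: "weighted_bound K c f \<Longrightarrow> s \<in> strip \<Longrightarrow> norm (f s) \<le> c * weight K (norm s)"
  by (simp add: weighted_bound_def)

text \<open>The exponentials combine to \<open>exp \<tau>\<close> and the inverse squares integrate
  to at most \<open>4 / (1 + \<tau>)^3\<close>. The prefactor \<open>norm s = \<tau> / K\<close>
  then leaves the weight times \<open>4 / K * \<tau> / (1 + \<tau>)\<close>, which is below
  \<open>4 / K\<close> times the weight.\<close>

lemma weighted_bound_conv:
  assumes K: "K > 0" and f: "f holomorphic_on strip" and g: "g holomorphic_on strip"
    and fa: "weighted_bound K a f" and gb: "weighted_bound K b g"
  shows "weighted_bound K (4 / K * a * b) (conv f g)"
  unfolding weighted_bound_def
proof
  fix s assume s: "s \<in> strip"
  define \<tau> where "\<tau> = K * norm s"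
  have \<tau>: "\<tau> \<ge> 0" using K by (simp add: \<tau>_def)
  have a: "a \<ge> 0" and b: "b \<ge> 0"
    using weighted_boundD[OF fa, of 0] weighted_boundD[OF gb, of 0] norm_ge_zero
    by (auto simp: strip_def weight_def intro: order_trans[OF norm_ge_zero])
  let ?B = "\<lambda>u. a * b * exp \<tau> * (2 / (1 + \<tau>)\<^sup>2) * (1 / (1 + \<tau> * u)\<^sup>2 + 1 / (1 + \<tau> * (1 - u))\<^sup>2)"
  have B: "(?B has_integral a * b * exp \<tau> * (2 / (1 + \<tau>)\<^sup>2) * (1 / (1 + \<tau>) + 1 / (1 + \<tau>))) {0..1}"
    by (intro has_integral_mult_right has_integral_add has_integral_inverse_square \<tau>)
  have "norm (integral {0..1} (\<lambda>u. f (of_real u * s) * g (of_real (1 - u) * s))) \<le> integral {0..1} ?B"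
  proof (rule integral_norm_bound_integral)
    show "(\<lambda>u. f (of_real u * s) * g (of_real (1 - u) * s)) integrable_on {0..1}"
      by (rule integrable_conv[OF f g s])
    show "?B integrable_on {0..1}" using B by blast
    fix u :: real assume "u \<in> {0..1}"
    then have u: "0 \<le> u" "u \<le> 1" by auto
    have "norm (f (of_real u * s)) \<le> a * (exp (\<tau> * u) / (1 + \<tau> * u)\<^sup>2)"
      using weighted_boundD[OF fa strip_scale[OF s u]] u
      by (simp add: weight_def \<tau>_def norm_mult mult_ac)
    moreover have "norm (g (of_real (1 - u) * s)) \<le> b * (exp (\<tau> * (1 - u)) / (1 + \<tau> * (1 - u))\<^sup>2)"
      using weighted_boundD[OF gb strip_scale[OF s, of "1 - u"]] u
      by (simp add: weight_def \<tau>_def norm_mult mult_ac del: of_real_diff)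
    ultimately have "norm (f (of_real u * s) * g (of_real (1 - u) * s))
      \<le> (a * (exp (\<tau> * u) / (1 + \<tau> * u)\<^sup>2)) * (b * (exp (\<tau> * (1 - u)) / (1 + \<tau> * (1 - u))\<^sup>2))"
      unfolding norm_mult using a by (intro mult_mono) auto
    also have "\<dots> = a * b * (exp (\<tau> * u) * exp (\<tau> * (1 - u))) * (1 / ((1 + \<tau> * u)\<^sup>2 * (1 + \<tau> * (1 - u))\<^sup>2))"
      by simp
    also have "exp (\<tau> * u) * exp (\<tau> * (1 - u)) = exp \<tau>"
      by (simp add: exp_add[symmetric] algebra_simps)
    also have "a * b * exp \<tau> * (1 / ((1 + \<tau> * u)\<^sup>2 * (1 + \<tau> * (1 - u))\<^sup>2))
       \<le> a * b * exp \<tau> * (2 / (1 + \<tau>)\<^sup>2 * (1 / (1 + \<tau> * u)\<^sup>2 + 1 / (1 + \<tau> * (1 - u))\<^sup>2))"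
      using a b product_inverse_square_le[OF \<tau> u] by (intro mult_left_mono) auto
    finally show "norm (f (of_real u * s) * g (of_real (1 - u) * s)) \<le> ?B u"
      by (simp only: mult.assoc)
  qed
  also have "integral {0..1} ?B = a * b * exp \<tau> * (2 / (1 + \<tau>)\<^sup>2) * (2 / (1 + \<tau>))"
    using integral_unique[OF B] by simp
  finally have "norm (conv f g s) \<le> norm s * (a * b * exp \<tau> * (2 / (1 + \<tau>)\<^sup>2) * (2 / (1 + \<tau>)))"
    unfolding conv_def norm_mult by (intro mult_left_mono) auto
  also have "\<dots> = 4 / K * a * b * weight K (norm s) * (\<tau> / (1 + \<tau>))"
    using K by (simp add: weight_def \<tau>_def)
  also have "\<dots> \<le> 4 / K * a * b * weight K (norm s) * 1"
    using K a b \<tau> weight_pos[of K "norm s"] by (intro mult_left_mono) auto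
  finally show "norm (conv f g s) \<le> 4 / K * a * b * weight K (norm s)" by simp
qed

lemma weighted_bound_mono:
  assumes "weighted_bound K a f" "a \<le> b" "K \<ge> 0"
  shows "weighted_bound K b f"
  unfolding weighted_bound_def
proof
  fix s assume "s \<in> strip"
  then have "norm (f s) \<le> a * weight K (norm s)" using assms(1) by (rule weighted_boundD[rotated])
  also have "\<dots> \<le> b * weight K (norm s)"
    using assms weight_pos[of K "norm s"] by (intro mult_right_mono) auto
  finally show "norm (f s) \<le> b * weight K (norm s)" .
qed

lemma weighted_bound_le:
  assumes "weighted_bound K a f" "\<And>s. f s = g s" "a \<le> b" "K \<ge> 0"
  shows "weighted_bound K b g"
  using weighted_bound_mono[OF assms(1,3,4)] assms(2) by (simp add: weighted_bound_def)

lemma weighted_bound_add: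
  assumes "weighted_bound K a f" "weighted_bound K b g"
  shows "weighted_bound K (a + b) (\<lambda>s. f s + g s)"
  unfolding weighted_bound_def distrib_right
  using assms by (intro ballI norm_triangle_mono weighted_boundD)

lemma weighted_bound_diff:
  assumes "weighted_bound K a f" "weighted_bound K b g"
  shows "weighted_bound K (a + b) (\<lambda>s. f s - g s)"
  unfolding weighted_bound_def distrib_right
  using assms by (intro ballI order_trans[OF norm_triangle_ineq4] add_mono weighted_boundD)

lemma weighted_bound_mult:
  assumes "weighted_bound K a f" "\<And>s. s \<in> strip \<Longrightarrow> norm (h s) \<le> m" "m \<ge> 0"
  shows "weighted_bound K (m * a) (\<lambda>s. h s * f s)"
  using assms unfolding weighted_bound_def by (simp add: norm_mult mult.assoc mult_mono)

lemma weighted_bound_cmult: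
  "weighted_bound K a f \<Longrightarrow> weighted_bound K (norm c * a) (\<lambda>s. c * f s)"
  by (rule weighted_bound_mult) auto

lemma weighted_bound_one: "K \<ge> 0 \<Longrightarrow> weighted_bound K 2 (\<lambda>_. 1)"
  using one_le_weight by (simp add: weighted_bound_def)

text \<open>Splits the difference as \<open>(f - f') * g + f' * (g - g')\<close>, with
  \<open>*\<close> read as convolution.\<close>

lemma weighted_bound_conv_diff:
  assumes K: "K > 0"
    and hol: "f holomorphic_on strip" "f' holomorphic_on strip" "g holomorphic_on strip" "g' holomorphic_on strip"
    and "weighted_bound K a f'" "weighted_bound K b g"
    and "weighted_bound K d (\<lambda>s. f s - f' s)" "weighted_bound K e (\<lambda>s. g s - g' s)"
  shows "weighted_bound K (4 / K * d * b + 4 / K * a * e) (\<lambda>s. conv f g s - conv f' g' s)"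
proof -
  have "weighted_bound K (4 / K * d * b + 4 / K * a * e)
     (\<lambda>s. conv (\<lambda>s. f s - f' s) g s + conv f' (\<lambda>s. g s - g' s) s)"
    using assms by (intro weighted_bound_add weighted_bound_conv holomorphic_on_diff)
  moreover have "conv (\<lambda>s. f s - f' s) g s + conv f' (\<lambda>s. g s - g' s) s = conv f g s - conv f' g' s"
    if "s \<in> strip" for s
    using conv_diff_left[OF hol(1-3) that] conv_diff_right[OF hol(2-4) that]
    by (simp add: algebra_simps)
  ultimately show ?thesis
    by (simp add: weighted_bound_def)
qed

subsection \<open>The fixed point in the Borel plane\<close>

text \<open>
  The indices 0, 1, 2 stand for the transforms of \<open>y\<close>, \<open>v\<close> and \<open>\<eta> = 1 / (1 + y) - 1\<close>. The last one is an
  unknown of its own, with the equation \<open>\<eta> = - y - \<eta> y\<close>, because then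
  \<open>y / (1 + y)\<^sup>3 = y + \<eta> y - 2 \<eta>\<^sup>2 - \<eta>\<^sup>3\<close> is polynomial. The variable \<open>p\<close> itself has transform 1, and the
  system reads \<open>s Y + V = A\<close>, \<open>s V - Y = B\<close>.
\<close>

definition borel_A :: "(nat \<Rightarrow> complex \<Rightarrow> complex) \<Rightarrow> complex \<Rightarrow> complex" where
  "borel_A F s = - (2/3) * 1 - 2/3 * conv (\<lambda>_. 1) (F 0) s"

definition borel_B :: "(nat \<Rightarrow> complex \<Rightarrow> complex) \<Rightarrow> complex \<Rightarrow> complex" where
  "borel_B F s = conv (F 2) (F 0) s - 2 * conv (F 2) (F 2) s
     - conv (F 2) (conv (F 2) (F 2)) s + 2/3 * conv (\<lambda>_. 1) (F 1) s"

text \<open>\<open>borel_Y\<close> and \<open>borel_V\<close> are Cramer's rule for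
  \<open>s Y + V = A\<close>, \<open>s V - Y = B\<close>, whose determinant is
  \<open>1 + s^2\<close>.\<close>

definition borel_Y :: "(nat \<Rightarrow> complex \<Rightarrow> complex) \<Rightarrow> complex \<Rightarrow> complex" where
  "borel_Y F s = s / (1 + s\<^sup>2) * borel_A F s - 1 / (1 + s\<^sup>2) * borel_B F s"

definition borel_V :: "(nat \<Rightarrow> complex \<Rightarrow> complex) \<Rightarrow> complex \<Rightarrow> complex" where
  "borel_V F s = 1 / (1 + s\<^sup>2) * borel_A F s + s / (1 + s\<^sup>2) * borel_B F s"

text \<open>The third component uses the updated \<open>borel_Y F\<close> in its linear term instead
  of \<open>F 0\<close>. With \<open>F 0\<close> that term would have Lipschitz constant 1 and the
  step would not contract.\<close>

definition borel_step :: "(nat \<Rightarrow> complex \<Rightarrow> complex) \<Rightarrow> nat \<Rightarrow> complex \<Rightarrow> complex" where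
  "borel_step F i = (if i = 0 then borel_Y F else if i = 1 then borel_V F
     else (\<lambda>s. - 1 * borel_Y F s - conv (F 2) (F 0) s))"

text \<open>Both \<open>s - \<i>\<close> and \<open>s + \<i>\<close> have modulus at least 1/2. The
  first quotient is the product of their inverses, the second half the sum of their
  inverses.\<close>

lemma strip_resolvent:
  assumes "s \<in> strip"
  shows "1 + s\<^sup>2 \<noteq> 0" "norm (1 / (1 + s\<^sup>2)) \<le> 4" "norm (s / (1 + s\<^sup>2)) \<le> 2"
proof -
  have "norm (s - \<i>) \<ge> 1/2" "norm (s + \<i>) \<ge> 1/2"
    using assms abs_Im_le_cmod[of "s - \<i>"] abs_Im_le_cmod[of "s + \<i>"] by (auto simp: strip_def)
  moreover from this have "norm (inverse (s - \<i>)) \<le> inverse (1/2)" "norm (inverse (s + \<i>)) \<le> inverse (1/2)"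
    unfolding norm_inverse by (intro le_imp_inverse_le; simp)+
  moreover have eq: "1 + s\<^sup>2 = (s - \<i>) * (s + \<i>)"
    by (simp add: power2_eq_square algebra_simps)
  ultimately have i: "norm (inverse (s - \<i>)) \<le> 2" "norm (inverse (s + \<i>)) \<le> 2"
    and ne: "s - \<i> \<noteq> 0" "s + \<i> \<noteq> 0"
    by auto
  show "1 + s\<^sup>2 \<noteq> 0" using ne eq by simp
  have "norm (inverse (s - \<i>) * inverse (s + \<i>)) \<le> 2 * 2"
    unfolding norm_mult using i by (intro mult_mono) auto
  then show "norm (1 / (1 + s\<^sup>2)) \<le> 4"
    unfolding eq by (simp add: divide_inverse)
  have "s / (1 + s\<^sup>2) = (inverse (s - \<i>) + inverse (s + \<i>)) / 2"
    unfolding eq using ne by (simp add: divide_simps)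
  then have "norm (s / (1 + s\<^sup>2)) = norm (inverse (s - \<i>) + inverse (s + \<i>)) / 2"
    by (simp only: norm_divide) simp
  also have "\<dots> \<le> 2"
    using norm_triangle_ineq[of "inverse (s - \<i>)" "inverse (s + \<i>)"] i by linarith
  finally show "norm (s / (1 + s\<^sup>2)) \<le> 2" .
qed

lemma holomorphic_borel_step:
  assumes "\<And>i. F i holomorphic_on strip"
  shows "borel_step F i holomorphic_on strip"
proof -
  have A: "borel_A F holomorphic_on strip"
    unfolding borel_A_def[abs_def] by (intro holomorphic_intros holomorphic_conv assms)
  have B: "borel_B F holomorphic_on strip"
    unfolding borel_B_def[abs_def] by (intro holomorphic_intros holomorphic_conv assms)
  have Y: "borel_Y F holomorphic_on strip"
    unfolding borel_Y_def[abs_def] by (intro holomorphic_intros A B strip_resolvent(1))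
  have V: "borel_V F holomorphic_on strip"
    unfolding borel_V_def[abs_def] by (intro holomorphic_intros A B strip_resolvent(1))
  show ?thesis
    unfolding borel_step_def
    by (cases "i = 0"; cases "i = 1") (auto intro!: Y V holomorphic_intros holomorphic_conv assms)
qed

text \<open>With \<open>K = 4000\<close> each convolution costs \<open>4 / K = 1/1000\<close>, which
  makes the quadratic and cubic terms negligible on functions of size 8.\<close>

abbreviation small_bound :: "real \<Rightarrow> (complex \<Rightarrow> complex) \<Rightarrow> bool" where
  "small_bound \<equiv> weighted_bound 4000"

text \<open>The only term that is not small is the source \<open>- 2/3\<close> in
  \<open>borel_A\<close>, of weighted size 4/3. After the resolvent factors 2 and 4 it stays below
  8, with room for the convolutions.\<close>

lemma borel_step_bound:
  assumes hol: "\<And>i. F i holomorphic_on strip" and b: "\<And>i. small_bound 8 (F i)"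
  shows "small_bound 8 (borel_step F i)"
proof -
  note conv_bounds = weighted_bound_conv[OF _ hol hol b b] weighted_bound_conv[OF _ holomorphic_on_const hol weighted_bound_one b]
    weighted_bound_conv[OF _ hol holomorphic_conv[OF hol hol] b weighted_bound_conv[OF _ hol hol b b]]
  have A: "small_bound (3/2) (borel_A F)"
    unfolding borel_A_def[abs_def]
    by (rule weighted_bound_mono, rule weighted_bound_diff, rule weighted_bound_cmult,
        rule weighted_bound_one, simp, rule weighted_bound_cmult, rule conv_bounds(2)) simp_all
  have B: "small_bound (1/4) (borel_B F)"
    unfolding borel_B_def[abs_def]
    by (rule weighted_bound_mono, rule weighted_bound_add, rule weighted_bound_diff,
        rule weighted_bound_diff, rule conv_bounds(1), simp, rule weighted_bound_cmult,
        rule conv_bounds(1), simp, rule conv_bounds(3), simp, simp, rule weighted_bound_cmult,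
        rule conv_bounds(2)) simp_all
  have Y: "small_bound 5 (borel_Y F)"
    unfolding borel_Y_def[abs_def]
    by (rule weighted_bound_mono, rule weighted_bound_diff,
        rule weighted_bound_mult[OF A], erule strip_resolvent, simp,
        rule weighted_bound_mult[OF B], erule strip_resolvent) simp_all
  have V: "small_bound 8 (borel_V F)"
    unfolding borel_V_def[abs_def]
    by (rule weighted_bound_mono, rule weighted_bound_add,
        rule weighted_bound_mult[OF A], erule strip_resolvent, simp,
        rule weighted_bound_mult[OF B], erule strip_resolvent) simp_all
  have E: "small_bound 8 (\<lambda>s. - 1 * borel_Y F s - conv (F 2) (F 0) s)"
    by (rule weighted_bound_mono, rule weighted_bound_diff, rule weighted_bound_cmult, rule Y,
        rule conv_bounds(1)) simp_all
  show ?thesis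
    unfolding borel_step_def using weighted_bound_mono[OF Y] V E by auto
qed

text \<open>The source term cancels in the difference, so every remaining term carries a factor
  1/1000 from a convolution. The resolvent enlarges these by at most 4.\<close>

lemma borel_step_contraction:
  assumes hol: "\<And>i. F i holomorphic_on strip" "\<And>i. G i holomorphic_on strip"
    and b: "\<And>i. small_bound 8 (F i)" "\<And>i. small_bound 8 (G i)"
    and d: "\<And>i. small_bound d (\<lambda>s. F i s - G i s)"
  shows "small_bound (d / 2) (\<lambda>s. borel_step F i s - borel_step G i s)"
proof -
  have d0: "d \<ge> 0"
    using weighted_boundD[OF d, of 0] by (auto simp: strip_def weight_def intro: order_trans[OF norm_ge_zero])
  have one: "small_bound 0 (\<lambda>_. 1 - 1)"
    by (simp add: weighted_bound_def)
  have K: "(4000::real) > 0" by simp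
  have c1: "small_bound (4/4000 * 2 * d) (\<lambda>s. conv (\<lambda>_. 1) (F j) s - conv (\<lambda>_. 1) (G j) s)" for j
    using weighted_bound_conv_diff[OF K holomorphic_on_const holomorphic_on_const hol(1) hol(2)
      weighted_bound_one b(1) one d] by simp
  have c2: "small_bound (4/4000 * d * 8 + 4/4000 * 8 * d) (\<lambda>s. conv (F j) (F k) s - conv (G j) (G k) s)" for j k
    by (rule weighted_bound_conv_diff[OF K hol(1) hol(2) hol(1) hol(2) b(2) b(1) d d])
  have c3: "small_bound (4/4000 * d * (4/4000 * 8 * 8) + 4/4000 * 8 * (4/4000 * d * 8 + 4/4000 * 8 * d))
     (\<lambda>s. conv (F j) (conv (F k) (F l)) s - conv (G j) (conv (G k) (G l)) s)" for j k l
    by (rule weighted_bound_conv_diff[OF K hol(1) hol(2) holomorphic_conv[OF hol(1) hol(1)]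
         holomorphic_conv[OF hol(2) hol(2)] b(2) weighted_bound_conv[OF K hol(1) hol(1) b(1) b(1)] d c2])
  have A: "small_bound (d / 100) (\<lambda>s. borel_A F s - borel_A G s)"
  proof -
    have "small_bound (norm (- (2/3) :: complex) * (4/4000 * 2 * d))
       (\<lambda>s. - (2/3) * (conv (\<lambda>_. 1) (F 0) s - conv (\<lambda>_. 1) (G 0) s))"
      by (rule weighted_bound_cmult[OF c1])
    moreover have "- (2/3) * (conv (\<lambda>_. 1) (F 0) s - conv (\<lambda>_. 1) (G 0) s) = borel_A F s - borel_A G s" for s
      by (simp add: borel_A_def algebra_simps)
    ultimately show ?thesis
      by (rule weighted_bound_le) (use d0 in \<open>(simp; linarith)+\<close>)
  qed
  have B: "small_bound (d / 16) (\<lambda>s. borel_B F s - borel_B G s)"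
  proof -
    have "small_bound ((4/4000 * d * 8 + 4/4000 * 8 * d) + norm (2 :: complex) * (4/4000 * d * 8 + 4/4000 * 8 * d)
        + (4/4000 * d * (4/4000 * 8 * 8) + 4/4000 * 8 * (4/4000 * d * 8 + 4/4000 * 8 * d))
        + norm (2/3 :: complex) * (4/4000 * 2 * d))
       (\<lambda>s. (conv (F 2) (F 0) s - conv (G 2) (G 0) s) - 2 * (conv (F 2) (F 2) s - conv (G 2) (G 2) s)
         - (conv (F 2) (conv (F 2) (F 2)) s - conv (G 2) (conv (G 2) (G 2)) s)
         + 2/3 * (conv (\<lambda>_. 1) (F 1) s - conv (\<lambda>_. 1) (G 1) s))"
      by (rule weighted_bound_add[OF weighted_bound_diff[OF weighted_bound_diff[OF c2
         weighted_bound_cmult[OF c2]] c3] weighted_bound_cmult[OF c1]])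
    moreover have "(conv (F 2) (F 0) s - conv (G 2) (G 0) s) - 2 * (conv (F 2) (F 2) s - conv (G 2) (G 2) s)
         - (conv (F 2) (conv (F 2) (F 2)) s - conv (G 2) (conv (G 2) (G 2)) s)
         + 2/3 * (conv (\<lambda>_. 1) (F 1) s - conv (\<lambda>_. 1) (G 1) s) = borel_B F s - borel_B G s" for s
      by (simp add: borel_B_def algebra_simps)
    ultimately show ?thesis
      by (rule weighted_bound_le) (use d0 in \<open>(simp; linarith)+\<close>)
  qed
  have Y: "small_bound (d / 3) (\<lambda>s. borel_Y F s - borel_Y G s)"
  proof -
    have "small_bound (2 * (d / 100) + 4 * (d / 16)) (\<lambda>s. s / (1 + s\<^sup>2) * (borel_A F s - borel_A G s)
       - 1 / (1 + s\<^sup>2) * (borel_B F s - borel_B G s))"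
      by (rule weighted_bound_diff; rule weighted_bound_mult; (rule A B | erule strip_resolvent | simp))
    moreover have "s / (1 + s\<^sup>2) * (borel_A F s - borel_A G s) - 1 / (1 + s\<^sup>2) * (borel_B F s - borel_B G s)
       = borel_Y F s - borel_Y G s" for s
      by (simp only: borel_Y_def right_diff_distrib) simp
    ultimately show ?thesis
      by (rule weighted_bound_le) (use d0 in \<open>(simp; linarith)+\<close>)
  qed
  have V: "small_bound (d / 2) (\<lambda>s. borel_V F s - borel_V G s)"
  proof -
    have "small_bound (4 * (d / 100) + 2 * (d / 16)) (\<lambda>s. 1 / (1 + s\<^sup>2) * (borel_A F s - borel_A G s)
       + s / (1 + s\<^sup>2) * (borel_B F s - borel_B G s))"
      by (rule weighted_bound_add; rule weighted_bound_mult; (rule A B | erule strip_resolvent | simp))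
    moreover have "1 / (1 + s\<^sup>2) * (borel_A F s - borel_A G s) + s / (1 + s\<^sup>2) * (borel_B F s - borel_B G s)
       = borel_V F s - borel_V G s" for s
      by (simp only: borel_V_def right_diff_distrib) simp
    ultimately show ?thesis
      by (rule weighted_bound_le) (use d0 in \<open>(simp; linarith)+\<close>)
  qed
  have E: "small_bound (d / 2) (\<lambda>s. (- 1 * borel_Y F s - conv (F 2) (F 0) s) - (- 1 * borel_Y G s - conv (G 2) (G 0) s))"
  proof -
    have "small_bound (norm (- 1 :: complex) * (d / 3) + (4/4000 * d * 8 + 4/4000 * 8 * d))
      (\<lambda>s. - 1 * (borel_Y F s - borel_Y G s) - (conv (F 2) (F 0) s - conv (G 2) (G 0) s))"
      by (rule weighted_bound_diff[OF weighted_bound_cmult[OF Y] c2])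
    moreover have "- 1 * (borel_Y F s - borel_Y G s) - (conv (F 2) (F 0) s - conv (G 2) (G 0) s)
       = (- 1 * borel_Y F s - conv (F 2) (F 0) s) - (- 1 * borel_Y G s - conv (G 2) (G 0) s)" for s
      by simp
    ultimately show ?thesis
      by (rule weighted_bound_le) (use d0 in \<open>(simp; linarith)+\<close>)
  qed
  show ?thesis
    using weighted_bound_mono[OF Y, of "d / 2"] V E d0 by (simp add: borel_step_def)
qed

section \<open>Picard iteration and its limit\<close>

primrec borel_iter :: "nat \<Rightarrow> nat \<Rightarrow> complex \<Rightarrow> complex" where
  "borel_iter 0 = (\<lambda>i s. 0)"
| "borel_iter (Suc n) = borel_step (borel_iter n)"

declare borel_iter.simps(2) [simp del]

lemma borel_iter_bounds:
  shows holomorphic_borel_iter: "borel_iter n i holomorphic_on strip"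
    and small_bound_borel_iter: "small_bound 8 (borel_iter n i)"
proof (induction n arbitrary: i)
  case 0
  { case 1 show ?case by simp }
  { case 2 show ?case using weight_pos[of 4000] by (simp add: weighted_bound_def less_imp_le) }
next
  case (Suc n)
  { case 1 show ?case unfolding borel_iter.simps by (rule holomorphic_borel_step[OF Suc(1)]) }
  { case 2 show ?case unfolding borel_iter.simps by (rule borel_step_bound[OF Suc]) }
qed

lemma borel_iter_diff:
  "small_bound (8 / 2 ^ n) (\<lambda>s. borel_iter (Suc n) i s - borel_iter n i s)"
proof (induction n arbitrary: i)
  case 0
  then show ?case using small_bound_borel_iter[of 1 i] by simp
next
  case (Suc n)
  have "small_bound (8 / 2 ^ n / 2)
      (\<lambda>s. borel_step (borel_iter (Suc n)) i s - borel_step (borel_iter n) i s)"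
    by (rule borel_step_contraction[OF holomorphic_borel_iter holomorphic_borel_iter
        small_bound_borel_iter small_bound_borel_iter Suc])
  then show ?case unfolding borel_iter.simps(2)[of "Suc n"] borel_iter.simps(2)[of n]
    by (simp add: mult.commute)
qed

text \<open>A telescoping geometric sum. The induction needs the sharper bound
  \<open>16 / 2^n - 16 / 2^(n + k)\<close>, which is weakened only at the end.\<close>

lemma borel_iter_diff_le:
  assumes "s \<in> strip"
  shows "norm (borel_iter (n + k) i s - borel_iter n i s) \<le> 16 / 2 ^ n * weight 4000 (norm s)"
proof -
  have w: "weight 4000 (norm s) > 0" by (simp add: weight_pos)
  have "norm (borel_iter (n + k) i s - borel_iter n i s) \<le> (16 / 2 ^ n - 16 / 2 ^ (n + k)) * weight 4000 (norm s)"
  proof (induction k)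
    case (Suc k)
    have "norm (borel_iter (n + Suc k) i s - borel_iter n i s)
        \<le> norm (borel_iter (Suc (n + k)) i s - borel_iter (n + k) i s) + norm (borel_iter (n + k) i s - borel_iter n i s)"
      using norm_triangle_ineq[of "borel_iter (Suc (n + k)) i s - borel_iter (n + k) i s"
        "borel_iter (n + k) i s - borel_iter n i s"] by simp
    also have "\<dots> \<le> 8 / 2 ^ (n + k) * weight 4000 (norm s) + (16 / 2 ^ n - 16 / 2 ^ (n + k)) * weight 4000 (norm s)"
      by (rule add_mono[OF weighted_boundD[OF borel_iter_diff assms] Suc])
    also have "\<dots> = (16 / 2 ^ n - 16 / 2 ^ (n + Suc k)) * weight 4000 (norm s)"
      by (simp add: algebra_simps)
    finally show ?case .
  qed simp
  also have "\<dots> \<le> 16 / 2 ^ n * weight 4000 (norm s)"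
    using w by (intro mult_right_mono) auto
  finally show ?thesis .
qed

lemma tendsto_const_over_power2: "(\<lambda>n. c / 2 ^ n :: real) \<longlonglongrightarrow> 0"
  using tendsto_mult[OF tendsto_const[of c] LIMSEQ_power_zero[of "1/2 :: real"]]
  by (simp add: power_one_over)

definition borel_limit :: "nat \<Rightarrow> complex \<Rightarrow> complex" where
  "borel_limit i s = lim (\<lambda>n. borel_iter n i s)"

lemma borel_iter_tendsto:
  assumes "s \<in> strip"
  shows "(\<lambda>n. borel_iter n i s) \<longlonglongrightarrow> borel_limit i s"
proof -
  have "Cauchy (\<lambda>n. borel_iter n i s)"
  proof (rule CauchyI)
    fix e :: real assume "e > 0"
    then have "\<forall>\<^sub>F n in sequentially. 32 * weight 4000 (norm s) / 2 ^ n < e"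
      using order_tendstoD(2)[OF tendsto_const_over_power2] by blast
    then obtain M where M: "32 * weight 4000 (norm s) / 2 ^ M < e"
      by (auto simp: eventually_sequentially)
    have "norm (borel_iter m i s - borel_iter n i s) < e" if "m \<ge> M" "n \<ge> M" for m n
    proof -
      have "norm (borel_iter m i s - borel_iter M i s) \<le> 16 / 2 ^ M * weight 4000 (norm s)"
        using borel_iter_diff_le[OF assms, of M "m - M" i] that(1) by simp
      moreover have "norm (borel_iter n i s - borel_iter M i s) \<le> 16 / 2 ^ M * weight 4000 (norm s)"
        using borel_iter_diff_le[OF assms, of M "n - M" i] that(2) by simp
      moreover have "norm (borel_iter m i s - borel_iter n i s)
          \<le> norm (borel_iter m i s - borel_iter M i s) + norm (borel_iter n i s - borel_iter M i s)"
        using dist_triangle2[of "borel_iter m i s" "borel_iter n i s" "borel_iter M i s"] by (simp only: dist_norm)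
      ultimately have "norm (borel_iter m i s - borel_iter n i s) \<le> 32 * weight 4000 (norm s) / 2 ^ M"
        by simp
      then show ?thesis using M by simp
    qed
    then show "\<exists>M. \<forall>m\<ge>M. \<forall>n\<ge>M. norm (borel_iter m i s - borel_iter n i s) < e"
      by (intro exI[of _ M] allI impI)
  qed
  then show ?thesis
    unfolding borel_limit_def by (rule convergent_LIMSEQ_iff[THEN iffD1, OF Cauchy_convergent])
qed

lemma borel_limit_diff: "small_bound (16 / 2 ^ n) (\<lambda>s. borel_limit i s - borel_iter n i s)"
  unfolding weighted_bound_def
proof
  fix s assume s: "s \<in> strip"
  have "(\<lambda>k. borel_iter (k + n) i s) \<longlonglongrightarrow> borel_limit i s"
    by (rule LIMSEQ_ignore_initial_segment[OF borel_iter_tendsto[OF s]])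
  then have "(\<lambda>k. norm (borel_iter (n + k) i s - borel_iter n i s)) \<longlonglongrightarrow> norm (borel_limit i s - borel_iter n i s)"
    unfolding add.commute[of _ n] by (intro tendsto_intros)
  then show "norm (borel_limit i s - borel_iter n i s) \<le> 16 / 2 ^ n * weight 4000 (norm s)"
    by (rule Lim_bounded[where M = 0]) (rule allI, rule impI, rule borel_iter_diff_le[OF s])
qed

lemma borel_limit_bound: "small_bound 8 (borel_limit i)"
  unfolding weighted_bound_def
proof
  fix s assume s: "s \<in> strip"
  show "norm (borel_limit i s) \<le> 8 * weight 4000 (norm s)"
    by (rule Lim_bounded[OF tendsto_norm[OF borel_iter_tendsto[OF s]], where M = 0])
       (intro allI impI weighted_boundD[OF small_bound_borel_iter s])
qed

text \<open>The weight is bounded on every closed disc in the strip, so the convergence is locally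
  uniform and preserves holomorphy.\<close>

lemma holomorphic_borel_limit: "borel_limit i holomorphic_on strip"
proof (rule holomorphic_uniform_sequence[OF open_strip])
  show "borel_iter n i holomorphic_on strip" for n
    by (rule holomorphic_borel_iter)
  fix x assume "x \<in> strip"
  then obtain d where d: "d > 0" "cball x d \<subseteq> strip"
    using open_strip open_contains_cball by blast
  define M where "M = 16 * exp (4000 * (norm x + d))"
  have "uniform_limit (cball x d) (\<lambda>n. borel_iter n i) (borel_limit i) sequentially"
    unfolding uniform_limit_iff
  proof (intro allI impI)
    fix e :: real assume "e > 0"
    then have "\<forall>\<^sub>F n in sequentially. M / 2 ^ n < e"
      using order_tendstoD(2)[OF tendsto_const_over_power2] by blast
    then show "\<forall>\<^sub>F n in sequentially. \<forall>z\<in>cball x d. dist (borel_iter n i z) (borel_limit i z) < e"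
    proof (rule eventually_mono, intro ballI)
      fix n z assume n: "M / 2 ^ n < e" and z: "z \<in> cball x d"
      have "norm z \<le> norm x + d"
        using z norm_triangle_ineq2[of z x] by (simp add: dist_norm norm_minus_commute)
      then have "weight 4000 (norm z) \<le> exp (4000 * (norm x + d))"
        using weight_le_exp[of 4000 "norm z"] exp_le_cancel_iff[of "4000 * norm z" "4000 * (norm x + d)"]
        by (smt (verit) norm_ge_zero)
      then have "16 / 2 ^ n * weight 4000 (norm z) \<le> 16 / 2 ^ n * exp (4000 * (norm x + d))"
        by (intro mult_left_mono) auto
      then have "16 / 2 ^ n * weight 4000 (norm z) \<le> M / 2 ^ n"
        by (simp add: M_def)
      then show "dist (borel_iter n i z) (borel_limit i z) < e"
        using weighted_boundD[OF borel_limit_diff, of z i n] d z n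
        by (auto simp: dist_norm norm_minus_commute)
    qed
  qed
  then show "\<exists>d>0. cball x d \<subseteq> strip \<and> uniform_limit (cball x d) (\<lambda>n. borel_iter n i) (borel_limit i) sequentially"
    using d by blast
qed

text \<open>Both sides are compared with \<open>borel_iter (Suc n)\<close>: one by the convergence
  rate, the other by contraction applied to the limit and \<open>borel_iter n\<close>. Each distance
  is at most \<open>8 / 2^n\<close> times the weight.\<close>

lemma borel_limit_fixed_point:
  assumes s: "s \<in> strip"
  shows "borel_limit i s = borel_step borel_limit i s"
proof -
  let ?w = "weight 4000 (norm s)"
  have "norm (borel_limit i s - borel_step borel_limit i s) \<le> 16 * ?w / 2 ^ n" for n
  proof -
    have "small_bound (16 / 2 ^ n / 2) (\<lambda>s. borel_step borel_limit i s - borel_step (borel_iter n) i s)"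
      by (rule borel_step_contraction[OF holomorphic_borel_limit holomorphic_borel_iter
          borel_limit_bound small_bound_borel_iter borel_limit_diff])
    from weighted_boundD[OF this s]
    have "norm (borel_step borel_limit i s - borel_iter (Suc n) i s) \<le> 16 / 2 ^ n / 2 * ?w"
      by (simp add: borel_iter.simps)
    moreover have "norm (borel_limit i s - borel_iter (Suc n) i s) \<le> 16 / 2 ^ n / 2 * ?w"
      using weighted_boundD[OF borel_limit_diff[of "Suc n" i] s] by (simp add: mult.commute)
    moreover have "norm (borel_limit i s - borel_step borel_limit i s)
      \<le> norm (borel_limit i s - borel_iter (Suc n) i s) + norm (borel_step borel_limit i s - borel_iter (Suc n) i s)"
      using norm_triangle_ineq4[of "borel_limit i s - borel_iter (Suc n) i s" "borel_step borel_limit i s - borel_iter (Suc n) i s"]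
      by simp
    ultimately show ?thesis by simp
  qed
  then have "norm (borel_limit i s - borel_step borel_limit i s) \<le> 0"
    by (intro LIMSEQ_le_const[OF tendsto_const_over_power2] exI[of _ 0] allI impI)
  then show ?thesis by simp
qed

text \<open>The transform of \<open>v\<close> is even, those of \<open>y\<close> and \<eta> are odd,
  reflecting that \<open>v\<close> is odd and \<open>y\<close>, \<eta> are even in
  \<open>p\<close>.\<close>

definition parity :: "nat \<Rightarrow> complex" where
  "parity i = (if i = 1 then 1 else - 1)"

text \<open>Under the hypothesis \<open>borel_A\<close> is even and \<open>borel_B\<close> odd; the
  resolvent factors \<open>1 / (1 + s^2)\<close> and \<open>s / (1 + s^2)\<close> are even and odd.
  The zero start of the iteration has every parity, so all iterates inherit it.\<close>

lemma borel_step_parity: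
  assumes F: "\<And>i s. s \<in> strip \<Longrightarrow> F i (- s) = parity i * F i s" and s: "s \<in> strip"
  shows "borel_step F i (- s) = parity i * borel_step F i s"
proof -
  have one: "(\<lambda>_. 1 :: complex) (- s) = 1 * (\<lambda>_. 1) s" for s :: complex by simp
  have c1: "conv (\<lambda>_. 1) (F j) (- s) = - (1 * parity j) * conv (\<lambda>_. 1) (F j) s" for j
    by (rule conv_minus) (simp_all add: F s)
  have c2: "conv (F j) (F k) (- s) = - (parity j * parity k) * conv (F j) (F k) s" if "s \<in> strip" for j k s
    by (rule conv_minus) (simp_all add: F that)
  have c3: "conv (F j) (conv (F k) (F l)) (- s)
      = - (parity j * - (parity k * parity l)) * conv (F j) (conv (F k) (F l)) s" for j k l
    by (rule conv_minus) (simp_all add: F c2 s)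
  have A: "borel_A F (- s) = borel_A F s"
    by (simp add: borel_A_def c1 parity_def)
  have B: "borel_B F (- s) = - borel_B F s"
    by (simp add: borel_B_def c1 c2[OF s] c3 parity_def)
  have Y: "borel_Y F (- s) = - borel_Y F s" and V: "borel_V F (- s) = borel_V F s"
    by (simp_all add: borel_Y_def borel_V_def A B)
  show ?thesis
    by (simp add: borel_step_def Y V c2[OF s]) (simp add: parity_def)
qed

lemma borel_limit_parity:
  assumes "s \<in> strip"
  shows "borel_limit i (- s) = parity i * borel_limit i s"
proof -
  have "borel_iter n i (- s) = parity i * borel_iter n i s" if "s \<in> strip" for n i s
    using that
  proof (induction n arbitrary: i s)
    case (Suc n)
    show ?case unfolding borel_iter.simps by (rule borel_step_parity) (simp_all add: Suc)
  qed simp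
  then have "(\<lambda>n. borel_iter n i (- s)) \<longlonglongrightarrow> parity i * borel_limit i s"
    using tendsto_mult[OF tendsto_const borel_iter_tendsto[OF assms]] assms by simp
  moreover have "(\<lambda>n. borel_iter n i (- s)) \<longlonglongrightarrow> borel_limit i (- s)"
    using assms by (intro borel_iter_tendsto) simp
  ultimately show ?thesis by (rule LIMSEQ_unique[rotated])
qed

lemma conv_Reals:
  assumes "f holomorphic_on strip" "g holomorphic_on strip"
    and "\<And>t. f (of_real t) \<in> \<real>" "\<And>t. g (of_real t) \<in> \<real>"
  shows "conv f g (of_real t) \<in> \<real>"
  using conv_of_real[of f g "\<lambda>t. Re (f (of_real t))" "\<lambda>t. Re (g (of_real t))" t] assms
  by (simp add: of_real_Re)

lemma borel_limit_Reals: "borel_limit i (of_real t) \<in> \<real>"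
proof -
  have "borel_iter n i (of_real t) \<in> \<real>" for n t
  proof (induction n arbitrary: i t)
    case (Suc n)
    note hol = holomorphic_borel_iter
    have A: "borel_A (borel_iter n) (of_real t) \<in> \<real>" for t
      unfolding borel_A_def
      by (intro Reals_diff Reals_mult Reals_minus Reals_divide Reals_numeral Reals_1
          conv_Reals hol Suc holomorphic_on_const)
    have B: "borel_B (borel_iter n) (of_real t) \<in> \<real>" for t
      unfolding borel_B_def
      by (intro Reals_diff Reals_add Reals_mult Reals_minus Reals_divide Reals_numeral Reals_1
          conv_Reals holomorphic_conv hol Suc holomorphic_on_const)
    have Y: "borel_Y (borel_iter n) (of_real t) \<in> \<real>" for t
      unfolding borel_Y_def by (intro Reals_diff Reals_add Reals_mult Reals_divide A B Reals_power Reals_of_real Reals_1)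
    have V: "borel_V (borel_iter n) (of_real t) \<in> \<real>" for t
      unfolding borel_V_def by (intro Reals_diff Reals_add Reals_mult Reals_divide A B Reals_power Reals_of_real Reals_1)
    have "conv (borel_iter n 2) (borel_iter n 0) (of_real t) \<in> \<real>"
      by (intro conv_Reals hol Suc)
    then show ?case
      using Y V by (simp add: borel_step_def borel_iter.simps)
  qed simp
  then show ?thesis
    by (intro Lim_in_closed_set[OF closed_complex_Reals _ _ borel_iter_tendsto]) auto
qed

subsection \<open>Laplace integrals\<close>

lemma LINT_exp_quarter:
  "set_integrable lborel {0..} (\<lambda>u::real. exp (- (u / 4)))"
  "(LINT u:{0..}|lborel. exp (- (u / 4))) = (4::real)"
proof -
  have I: "((\<lambda>u::real. exp (- (u / 4))) has_integral 4) {0..}"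
    using has_integral_exp_minus_to_infinity[of "1/4" 0] by simp
  then have "(\<lambda>u::real. exp (- (u / 4))) absolutely_integrable_on {0..}"
    by (intro nonnegative_absolutely_integrable_1) auto
  then show *: "set_integrable lborel {0..} (\<lambda>u::real. exp (- (u / 4)))"
    by (simp add: set_integrable_def integrable_completion)
  show "(LINT u:{0..}|lborel. exp (- (u / 4))) = (4::real)"
    using set_borel_integral_eq_integral(2)[OF *] integral_unique[OF I] by simp
qed

lemma set_integrable_exp_bound:
  fixes \<phi> :: "real \<Rightarrow> real"
  assumes c: "continuous_on {0..} \<phi>" and b: "\<And>u. u \<ge> 0 \<Longrightarrow> \<bar>\<phi> u\<bar> \<le> M * exp (- (u / 4))"
  shows "set_integrable lborel {0..} \<phi>" "\<bar>LINT u:{0..}|lborel. \<phi> u\<bar> \<le> 4 * M"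
proof -
  have m: "set_integrable lborel {0..} (\<lambda>u::real. M * exp (- (u / 4)))"
    using LINT_exp_quarter(1) by simp
  show i: "set_integrable lborel {0..} \<phi>"
  proof (rule set_integrable_bound[OF m])
    show "set_borel_measurable lborel {0..} \<phi>"
      using borel_measurable_continuous_on_indicator[OF _ c] by (simp add: set_borel_measurable_def)
    show "AE x in lborel. x \<in> {0..} \<longrightarrow> norm (\<phi> x) \<le> norm (M * exp (- (x / 4)))"
      using b by (auto intro!: AE_I2 order_trans[OF _ abs_ge_self])
  qed
  have "\<bar>LINT u:{0..}|lborel. \<phi> u\<bar> \<le> (LINT u:{0..}|lborel. \<bar>\<phi> u\<bar>)"
    using set_integral_norm_bound[OF i] by simp
  also have "\<dots> \<le> (LINT u:{0..}|lborel. M * exp (- (u / 4)))"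
    using b set_integrable_norm[OF i] by (intro set_integral_mono m) auto
  also have "\<dots> = 4 * M"
    using LINT_exp_quarter(2) by simp
  finally show "\<bar>LINT u:{0..}|lborel. \<phi> u\<bar> \<le> 4 * M" .
qed

text \<open>One term of the exponential series gives
  \<open>(u / 4)^n / n! \<le> exp (u / 4)\<close>. Half of the available decay is spent on the
  power; this is the source of the factorial from the moments.\<close>

lemma power_exp_le:
  fixes u :: real
  assumes "u \<ge> 0"
  shows "u ^ n * exp (- (u / 2)) \<le> fact n * 4 ^ n * exp (- (u / 4))"
proof -
  have "(u / 4) ^ n / fact n \<le> exp (u / 4)"
  proof -
    have "(u / 4) ^ n / fact n = (\<Sum>k\<in>{n}. (u / 4) ^ k /\<^sub>R fact k)"
      by (simp add: field_simps)
    also have "\<dots> \<le> (\<Sum>k. (u / 4) ^ k /\<^sub>R fact k)"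
      using assms by (intro sum_le_suminf summable_exp_generic) auto
    finally show ?thesis by (simp add: exp_def)
  qed
  then have "u ^ n \<le> fact n * 4 ^ n * exp (u / 4)"
    by (simp add: field_simps power_divide)
  then have "u ^ n * exp (- (u / 2)) \<le> fact n * 4 ^ n * exp (u / 4) * exp (- (u / 2))"
    by (intro mult_right_mono) auto
  also have "\<dots> = fact n * 4 ^ n * exp (- (u / 4))"
    by (simp add: mult.assoc exp_add[symmetric])
  finally show ?thesis .
qed

text \<open>For \<open>x \<le> 1 / (2 K)\<close> the growth of \<open>g (x u)\<close> is at most
  \<open>exp (u / 2)\<close>, so half of the decay of \<open>exp (- u)\<close> survives, uniformly
  in \<open>x\<close> down to 0.\<close>

lemma laplace_integrand_bound:
  fixes g :: "real \<Rightarrow> real"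
  assumes "\<And>t. t \<ge> 0 \<Longrightarrow> \<bar>g t\<bar> \<le> C * exp (K * t)" "K > 0" "0 \<le> x" "x \<le> 1 / (2 * K)" "u \<ge> 0"
  shows "\<bar>exp (- u) * u ^ n * g (x * u)\<bar> \<le> C * fact n * 4 ^ n * exp (- (u / 4))"
proof -
  have C: "C \<ge> 0"
    using assms(1)[of 0] by simp
  have "K * (x * u) \<le> u / 2"
    using mult_right_mono[of "K * x" "1 / 2" u] assms by (simp add: field_simps)
  then have "\<bar>g (x * u)\<bar> \<le> C * exp (u / 2)"
    using assms(1)[of "x * u"] assms(3,5) C
    by (smt (verit) exp_le_cancel_iff mult_left_mono mult_nonneg_nonneg)
  then have "\<bar>exp (- u) * u ^ n * g (x * u)\<bar> \<le> exp (- u) * u ^ n * (C * exp (u / 2))"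
    using assms(5) by (simp add: abs_mult mult_left_mono)
  also have "\<dots> = C * (u ^ n * exp (- (u / 2)))"
    by (simp add: exp_minus field_simps exp_add[symmetric])
  also have "\<dots> \<le> C * (fact n * 4 ^ n * exp (- (u / 4)))"
    using power_exp_le[OF assms(5)] C by (intro mult_left_mono)
  finally show ?thesis by (simp add: mult.assoc)
qed

text \<open>For \<open>g = f\<^sup>(\<^sup>n\<^sup>)\<close> this is the \<open>n\<close>-th derivative of \<open>x \<mapsto> \<integral> e\<^sup>-\<^sup>u f(x u) du\<close>.\<close>

definition laplace_moment :: "nat \<Rightarrow> (real \<Rightarrow> real) \<Rightarrow> real \<Rightarrow> real" where
  "laplace_moment n g x = (LINT u:{0..}|lborel. exp (- u) * u ^ n * g (x * u))"

lemma laplace_moment_bound: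
  fixes g :: "real \<Rightarrow> real"
  assumes c: "continuous_on {0..} g" and b: "\<And>t. t \<ge> 0 \<Longrightarrow> \<bar>g t\<bar> \<le> C * exp (K * t)" "K > 0"
    and x: "0 \<le> x" "x \<le> 1 / (2 * K)"
  shows "set_integrable lborel {0..} (\<lambda>u. exp (- u) * u ^ n * g (x * u))"
    and "\<bar>laplace_moment n g x\<bar> \<le> 4 * (C * fact n * 4 ^ n)"
proof -
  have c': "continuous_on {0..} (\<lambda>u. exp (- u) * u ^ n * g (x * u))"
    using x by (intro continuous_intros continuous_on_compose2[OF c]) auto
  show "set_integrable lborel {0..} (\<lambda>u. exp (- u) * u ^ n * g (x * u))"
    "\<bar>laplace_moment n g x\<bar> \<le> 4 * (C * fact n * 4 ^ n)"
    unfolding laplace_moment_def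
    by (rule set_integrable_exp_bound[OF c' laplace_integrand_bound[OF b x]]; assumption)+
qed

text \<open>Two mean value estimates, first for \<open>f'\<close> and then for \<open>f\<close>
  minus its tangent. The factor 1/2 of Taylor's formula is lost, but \<open>s\<close> and
  \<open>t\<close> may come in either order.\<close>

lemma DERIV_remainder_bound:
  fixes f :: "real \<Rightarrow> real"
  assumes "\<And>t. t \<in> {a..b} \<Longrightarrow> (f has_real_derivative f' t) (at t)"
    and "\<And>t. t \<in> {a..b} \<Longrightarrow> (f' has_real_derivative f'' t) (at t)"
    and B: "\<And>t. t \<in> {a..b} \<Longrightarrow> \<bar>f'' t\<bar> \<le> B"
    and st: "s \<in> {a..b}" "t \<in> {a..b}"
  shows "\<bar>f t - f s - (t - s) * f' s\<bar> \<le> B * (t - s)\<^sup>2"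
proof -
  have f': "\<bar>f' \<xi> - f' s\<bar> \<le> B * \<bar>\<xi> - s\<bar>" if "\<xi> \<in> {a..b}" for \<xi>
    using field_differentiable_bound[of "{a..b}" f' f'' B s \<xi>] assms(2) B st that
    by (auto intro: DERIV_subset simp: convex_real_interval abs_minus_commute)
  let ?h = "\<lambda>\<xi>. f \<xi> - (\<xi> - s) * f' s"
  have "norm (?h t - ?h s) \<le> B * \<bar>t - s\<bar> * norm (t - s)"
  proof (rule field_differentiable_bound[of "closed_segment s t" ?h "\<lambda>\<xi>. f' \<xi> - f' s"])
    fix \<xi> assume \<xi>: "\<xi> \<in> closed_segment s t"
    then have \<xi>': "\<xi> \<in> {a..b}"
      using st by (auto simp: closed_segment_eq_real_ivl split: if_splits)
    show "(?h has_real_derivative f' \<xi> - f' s) (at \<xi> within closed_segment s t)"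
      by (rule DERIV_subset[OF _ subset_UNIV]) (auto intro!: derivative_eq_intros assms(1)[OF \<xi>'])
    have "\<bar>\<xi> - s\<bar> \<le> \<bar>t - s\<bar>"
      using \<xi> by (auto simp: closed_segment_eq_real_ivl split: if_splits)
    moreover have "B \<ge> 0" using B[OF st(1)] by linarith
    ultimately show "norm (f' \<xi> - f' s) \<le> B * \<bar>t - s\<bar>"
      using f'[OF \<xi>'] mult_left_mono[of "\<bar>\<xi> - s\<bar>" "\<bar>t - s\<bar>" B] by simp
  qed auto
  then show ?thesis by (simp add: power2_eq_square algebra_simps abs_mult)
qed

lemma DERIV_from_quadratic_remainder:
  fixes D :: "real \<Rightarrow> real"
  assumes "\<And>z. z \<in> S \<Longrightarrow> \<bar>D z - D x - (z - x) * D'\<bar> \<le> M * (z - x)\<^sup>2"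
  shows "(D has_real_derivative D') (at x within S)"
proof -
  have "((\<lambda>z. M * \<bar>z - x\<bar>) \<longlongrightarrow> M * \<bar>x - x\<bar>) (at x within S)"
    by (intro tendsto_intros)
  then have lim: "((\<lambda>z. M * \<bar>z - x\<bar>) \<longlongrightarrow> 0) (at x within S)" by simp
  have "((\<lambda>z. (D z - D x) / (z - x) - D') \<longlongrightarrow> 0) (at x within S)"
  proof (rule Lim_null_comparison[OF _ lim])
    show "\<forall>\<^sub>F z in at x within S. norm ((D z - D x) / (z - x) - D') \<le> M * \<bar>z - x\<bar>"
      unfolding eventually_at_filter
    proof (intro always_eventually allI impI)
      fix z assume z: "z \<noteq> x" "z \<in> S"
      have "(z - x) * ((D z - D x) / (z - x) - D') = D z - D x - (z - x) * D'"
        unfolding right_diff_distrib[of _ _ D'] using z by simp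
      then have "\<bar>z - x\<bar> * \<bar>(D z - D x) / (z - x) - D'\<bar> = \<bar>D z - D x - (z - x) * D'\<bar>"
        by (simp only: abs_mult[symmetric])
      also have "\<dots> \<le> \<bar>z - x\<bar> * (M * \<bar>z - x\<bar>)"
        using assms[OF z(2)] by (simp add: power2_eq_square mult_ac flip: abs_mult)
      finally show "norm ((D z - D x) / (z - x) - D') \<le> M * \<bar>z - x\<bar>"
        using z by simp
    qed
  qed
  then show ?thesis
    unfolding has_field_derivative_iff by (rule LIM_zero_cancel)
qed

text \<open>Instead of a limit theorem for integrals, the second order remainder of
  \<open>g n\<close> is integrated explicitly, at the price of a bound on \<open>g (n + 2)\<close>.
  The resulting quadratic remainder is uniform on the interval, so the endpoint 0 needs no special
  treatment.\<close>

lemma laplace_moment_deriv: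
  fixes g :: "nat \<Rightarrow> real \<Rightarrow> real"
  assumes g: "\<And>n t. (g n has_real_derivative g (Suc n) t) (at t)"
    and b: "\<And>n t. t \<ge> 0 \<Longrightarrow> \<bar>g n t\<bar> \<le> C n * exp (K * t)" "K > 0"
    and x: "x \<in> {0..1 / (2 * K)}"
  shows "(laplace_moment n (g n) has_real_derivative laplace_moment (Suc n) (g (Suc n)) x)
     (at x within {0..1 / (2 * K)})"
proof -
  have cont: "continuous_on {0..} (g n)" for n
    using g by (meson DERIV_continuous continuous_at_imp_continuous_on)
  have C0: "C k \<ge> 0" for k using b(1)[of 0 k] by simp
  note int = laplace_moment_bound(1)[OF cont b]
  let ?M = "4 * (C (n + 2) * fact (n + 2) * 4 ^ (n + 2))"
  have rem: "\<bar>laplace_moment n (g n) z - laplace_moment n (g n) x - (z - x) * laplace_moment (Suc n) (g (Suc n)) x\<bar>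
     \<le> ?M * (z - x)\<^sup>2" if z: "z \<in> {0..1 / (2 * K)}" for z
  proof -
    let ?\<phi> = "\<lambda>u. exp (- u) * u ^ n * g n (z * u) - exp (- u) * u ^ n * g n (x * u)
        - (z - x) * (exp (- u) * u ^ Suc n * g (Suc n) (x * u))"
    have "\<bar>LINT u:{0..}|lborel. ?\<phi> u\<bar> \<le> 4 * (C (n + 2) * fact (n + 2) * 4 ^ (n + 2) * (z - x)\<^sup>2)"
    proof (rule set_integrable_exp_bound(2))
      show "continuous_on {0..} ?\<phi>"
        using x z by (intro continuous_intros continuous_on_compose2[OF cont]) auto
      fix u :: real assume u: "u \<ge> 0"
      have xu: "x * u \<in> {0..1 / (2 * K) * u}" "z * u \<in> {0..1 / (2 * K) * u}"
        using mult_right_mono[of x "1 / (2 * K)" u] mult_right_mono[of z "1 / (2 * K)" u] x z u by auto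
      let ?B = "C (n + 2) * exp (u / 2)"
      have "\<bar>g n (z * u) - g n (x * u) - (z * u - x * u) * g (Suc n) (x * u)\<bar> \<le> ?B * (z * u - x * u)\<^sup>2"
      proof (rule DERIV_remainder_bound[OF g g _ xu])
        fix t assume t: "t \<in> {0..1 / (2 * K) * u}"
        then have "K * t \<le> u / 2" using b(2) by (simp add: field_simps)
        then have "C (n + 2) * exp (K * t) \<le> ?B" using C0 by (intro mult_left_mono) auto
        then show "\<bar>g (Suc (Suc n)) t\<bar> \<le> ?B" using b(1)[of t "n + 2"] t by simp
      qed
      then have "exp (- u) * u ^ n * \<bar>g n (z * u) - g n (x * u) - (z * u - x * u) * g (Suc n) (x * u)\<bar>
        \<le> exp (- u) * u ^ n * (?B * (z * u - x * u)\<^sup>2)"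
        using u by (intro mult_left_mono) auto
      also have "exp (- u) * u ^ n * (?B * (z * u - x * u)\<^sup>2)
         = C (n + 2) * (z - x)\<^sup>2 * (u ^ (n + 2) * exp (- (u / 2)))"
      proof -
        have "exp (u / 2) = exp u * exp (- (u / 2))"
          by (simp add: exp_add[symmetric])
        then have e: "exp (- u) * exp (u / 2) = exp (- (u / 2))"
          by (simp add: exp_minus field_simps)
        have "exp (- u) * u ^ n * (?B * (z * u - x * u)\<^sup>2)
          = C (n + 2) * (z - x)\<^sup>2 * (u ^ (n + 2) * (exp (- u) * exp (u / 2)))"
          by (simp add: power2_eq_square algebra_simps)
        then show ?thesis unfolding e .
      qed
      also have "\<dots> \<le> C (n + 2) * (z - x)\<^sup>2 * (fact (n + 2) * 4 ^ (n + 2) * exp (- (u / 4)))"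
        using C0 by (intro mult_left_mono[OF power_exp_le[OF u]]) simp
      finally have *: "exp (- u) * u ^ n * \<bar>g n (z * u) - g n (x * u) - (z * u - x * u) * g (Suc n) (x * u)\<bar>
         \<le> C (n + 2) * fact (n + 2) * 4 ^ (n + 2) * (z - x)\<^sup>2 * exp (- (u / 4))"
        by (simp only: mult_ac)
      have "?\<phi> u = exp (- u) * u ^ n * (g n (z * u) - g n (x * u) - (z * u - x * u) * g (Suc n) (x * u))"
        by (simp add: algebra_simps)
      then show "\<bar>?\<phi> u\<bar> \<le> C (n + 2) * fact (n + 2) * 4 ^ (n + 2) * (z - x)\<^sup>2 * exp (- (u / 4))"
        using * u by (simp only: abs_mult abs_exp_cancel power_abs abs_of_nonneg)
    qed
    moreover have "(LINT u:{0..}|lborel. ?\<phi> u) = laplace_moment n (g n) z - laplace_moment n (g n) x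
       - (z - x) * laplace_moment (Suc n) (g (Suc n)) x"
      unfolding laplace_moment_def using x z
      by (simp only: set_integral_diff set_integral_mult_right set_integrable_mult_right int atLeastAtMost_iff)
    ultimately show ?thesis by (simp only: mult.assoc)
  qed
  show ?thesis
  proof (rule DERIV_from_quadratic_remainder)
    show "\<bar>laplace_moment n (g n) z - laplace_moment n (g n) x - (z - x) * laplace_moment (Suc n) (g (Suc n)) x\<bar>
      \<le> ?M * (z - x)\<^sup>2" if "z \<in> {0..1 / (2 * K)}" for z using rem[OF that] .
  qed
qed

lemma LINT_derivative_eq_0:
  fixes h :: "real \<Rightarrow> real"
  assumes h: "\<And>u. u \<ge> 0 \<Longrightarrow> (h has_real_derivative h' u) (at u)"
    and c: "continuous_on {0..} h'" and i: "set_integrable lborel {0..} h'"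
    and lim: "(h \<longlongrightarrow> h 0) at_top"
  shows "(LINT u:{0..}|lborel. h' u) = 0"
proof -
  have "((\<lambda>y. \<integral>u. indicator {..y} u *\<^sub>R (indicator {0..} u *\<^sub>R h' u) \<partial>lborel)
      \<longlongrightarrow> (LINT u:{0..}|lborel. h' u)) at_top"
    using tendsto_integral_at_top[OF _ i[unfolded set_integrable_def]] by (simp add: set_lebesgue_integral_def)
  moreover have "\<forall>\<^sub>F y in at_top. (\<integral>u. indicator {..y} u *\<^sub>R (indicator {0..} u *\<^sub>R h' u) \<partial>lborel) = h y - h 0"
    using eventually_ge_at_top[of 0]
  proof eventually_elim
    case (elim y)
    have "(\<integral>u. indicator {..y} u *\<^sub>R (indicator {0..} u *\<^sub>R h' u) \<partial>lborel)
        = (\<integral>u. indicator {0..y} u *\<^sub>R h' u \<partial>lborel)"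
      by (intro Bochner_Integration.integral_cong) (auto split: split_indicator)
    also have "\<dots> = h y - h 0"
    proof (rule integral_FTC_atLeastAtMost[OF elim])
      show "continuous_on {0..y} h'" using c by (rule continuous_on_subset) auto
      show "(h has_vector_derivative h' u) (at u within {0..y})" if "0 \<le> u" "u \<le> y" for u
        using h[OF that(1)] by (simp add: has_real_derivative_iff_has_vector_derivative has_vector_derivative_at_within)
    qed
    finally show ?case .
  qed
  ultimately have "((\<lambda>y. h y - h 0) \<longlongrightarrow> (LINT u:{0..}|lborel. h' u)) at_top"
    by (simp add: filterlim_cong)
  moreover have "((\<lambda>y. h y - h 0) \<longlongrightarrow> 0) at_top"
    using tendsto_diff[OF lim tendsto_const[of "h 0"]] by simp
  ultimately show ?thesis
    by (intro tendsto_unique[OF trivial_limit_at_top_linorder])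
qed

text \<open>The function \<open>u * exp (- u) * g (x u)\<close> vanishes at 0 and at infinity, so
  its derivative has integral 0. This is what turns \<open>p^2 d/dp\<close> into multiplication by
  the Borel variable.\<close>

lemma laplace_moment_by_parts:
  fixes g g' :: "real \<Rightarrow> real"
  assumes g: "\<And>t. (g has_real_derivative g' t) (at t)" and c': "continuous_on {0..} g'"
    and b: "\<And>t. t \<ge> 0 \<Longrightarrow> \<bar>g t\<bar> \<le> C * exp (K * t)" "K > 0"
    and b': "\<And>t. t \<ge> 0 \<Longrightarrow> \<bar>g' t\<bar> \<le> C' * exp (K * t)"
    and x: "0 \<le> x" "x \<le> 1 / (2 * K)"
  shows "laplace_moment 0 g x + x * laplace_moment 1 g' x = laplace_moment 1 g x"
proof -
  have c: "continuous_on {0..} g"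
    using g by (meson DERIV_continuous continuous_at_imp_continuous_on)
  note I = laplace_moment_bound(1)[OF c b x] and I' = laplace_moment_bound(1)[OF c' b' b(2) x]
  let ?h = "\<lambda>u. u * (exp (- u) * g (x * u))"
  let ?h' = "\<lambda>u. exp (- u) * u ^ 0 * g (x * u) + x * (exp (- u) * u ^ 1 * g' (x * u)) - exp (- u) * u ^ 1 * g (x * u)"
  have "(LINT u:{0..}|lborel. ?h' u) = 0"
  proof (rule LINT_derivative_eq_0)
    fix u :: real assume "u \<ge> 0"
    have "((\<lambda>u. g (x * u)) has_real_derivative g' (x * u) * x) (at u)"
      by (rule DERIV_chain2[of g _ "\<lambda>u. x * u", OF g]) (auto intro!: derivative_eq_intros)
    then show "(?h has_real_derivative ?h' u) (at u)"
      by (auto intro!: derivative_eq_intros simp: algebra_simps)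
  next
    show "continuous_on {0..} ?h'"
      using x by (intro continuous_intros continuous_on_compose2[OF c] continuous_on_compose2[OF c']) auto
    show "set_integrable lborel {0..} ?h'"
      using I[of 0] I'[of 1] I[of 1] by (intro set_integral_add set_integral_diff set_integrable_mult_right)
    have "((\<lambda>u. C * fact 1 * 4 ^ 1 * exp (- (u / 4)) :: real) \<longlongrightarrow> 0) at_top"
      by real_asymp
    moreover have "\<forall>\<^sub>F u in at_top. norm (?h u) \<le> C * fact 1 * 4 ^ 1 * exp (- (u / 4))"
      using eventually_ge_at_top[of 0]
      by eventually_elim (use laplace_integrand_bound[OF b x, of _ 1] in \<open>simp add: mult_ac\<close>)
    ultimately have "(?h \<longlongrightarrow> 0) at_top" by (rule Lim_null_comparison[rotated])
    then show "(?h \<longlongrightarrow> ?h 0) at_top" by simp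
  qed
  then show ?thesis
    using I[of 0] I'[of 1] I[of 1] unfolding laplace_moment_def by simp
qed

text \<open>Fubini together with translation invariance. Working over the whole line leaves all
  domain restrictions to indicator functions.\<close>

lemma integral_convolution:
  fixes \<phi> \<gamma> :: "real \<Rightarrow> real"
  assumes \<phi>: "integrable lborel \<phi>" and \<gamma>: "integrable lborel \<gamma>"
  shows "(\<integral>u. (\<integral>a. \<phi> a * \<gamma> (u - a) \<partial>lborel) \<partial>lborel) = (\<integral>a. \<phi> a \<partial>lborel) * (\<integral>b. \<gamma> b \<partial>lborel)"
proof -
  have [measurable]: "\<phi> \<in> borel_measurable borel" "\<gamma> \<in> borel_measurable borel"
    using assms by auto
  have shift: "integrable lborel (\<lambda>u. \<gamma> (u - a))" "(\<integral>u. \<gamma> (u - a) \<partial>lborel) = (\<integral>b. \<gamma> b \<partial>lborel)"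
    "(\<integral>u. \<bar>\<gamma> (u - a)\<bar> \<partial>lborel) = (\<integral>b. \<bar>\<gamma> b\<bar> \<partial>lborel)" for a
    using lborel_integrable_real_affine[OF \<gamma>, of 1 "- a"] lborel_integral_real_affine[of 1 \<gamma> "- a"]
      lborel_integral_real_affine[of 1 "\<lambda>u. \<bar>\<gamma> u\<bar>" "- a"] by simp_all
  have int: "integrable (lborel \<Otimes>\<^sub>M lborel) (\<lambda>(a, u). \<phi> a * \<gamma> (u - a))"
  proof (rule lborel_pair.Fubini_integrable)
    show "integrable lborel (\<lambda>a. \<integral>u. norm (case (a, u) of (a, u) \<Rightarrow> \<phi> a * \<gamma> (u - a)) \<partial>lborel)"
      using \<phi> by (simp add: abs_mult shift)
    show "AE a in lborel. integrable lborel (\<lambda>u. case (a, u) of (a, u) \<Rightarrow> \<phi> a * \<gamma> (u - a))"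
      using shift by simp
  qed simp
  show "(\<integral>u. (\<integral>a. \<phi> a * \<gamma> (u - a) \<partial>lborel) \<partial>lborel) = (\<integral>a. \<phi> a \<partial>lborel) * (\<integral>b. \<gamma> b \<partial>lborel)"
    using lborel_pair.Fubini_integral[OF int] by (simp add: shift)
qed

definition real_conv :: "(real \<Rightarrow> real) \<Rightarrow> (real \<Rightarrow> real) \<Rightarrow> real \<Rightarrow> real" where
  "real_conv f g t = t * integral {0..1} (\<lambda>w. f (w * t) * g ((1 - w) * t))"

text \<open>The substitution \<open>a = u w\<close> degenerates at \<open>u = 0\<close>, where both
  sides are 0.\<close>

lemma real_conv_eq_LINT:
  assumes f: "continuous_on {0..} f" and g: "continuous_on {0..} g" and u: "u \<ge> 0"
  shows "real_conv f g u = (LINT a:{0..u}|lborel. f a * g (u - a))"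
proof (cases "u = 0")
  case True
  have "(LINT a:{0..0}|lborel. f a * g (0 - a)) = integral {0..0} (\<lambda>a. f a * g (0 - a))"
    by (intro set_borel_integral_eq_integral(2) borel_integrable_atLeastAtMost') auto
  then show ?thesis using True by (simp add: real_conv_def)
next
  case False
  have c: "continuous_on {0..u} (\<lambda>a. f a * g (u - a))"
    by (intro continuous_intros continuous_on_compose2[OF f] continuous_on_compose2[OF g]) auto
  have "((\<lambda>a. f a * g (u - a)) has_integral integral {0..u} (\<lambda>a. f a * g (u - a))) {0..u}"
    by (rule integrable_integral[OF integrable_continuous_real[OF c]])
  from has_integral_stretch_real[OF this False]
  have "((\<lambda>w. f (u * w) * g (u - u * w)) has_integral (1 / u) * integral {0..u} (\<lambda>a. f a * g (u - a))) {0..1}"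
    using u False by (simp add: image_divide_atLeastAtMost)
  then have "integral {0..1} (\<lambda>w. f (w * u) * g ((1 - w) * u)) = (1 / u) * integral {0..u} (\<lambda>a. f a * g (u - a))"
    by (intro integral_unique) (simp add: algebra_simps)
  then show ?thesis
    using False set_borel_integral_eq_integral(2)[OF borel_integrable_atLeastAtMost'[OF c]]
    by (simp add: real_conv_def)
qed

text \<open>Since \<open>exp (- u) = exp (- a) * exp (- (u - a))\<close>, the integrand is itself
  the convolution of the two weighted functions. The factor \<open>x\<close> is the Jacobian of
  rescaling the variable by \<open>x\<close>.\<close>

lemma laplace_real_conv:
  assumes f: "continuous_on {0..} f" and g: "continuous_on {0..} g"
    and If: "set_integrable lborel {0..} (\<lambda>u. exp (- u) * u ^ 0 * f (x * u))"
    and Ig: "set_integrable lborel {0..} (\<lambda>u. exp (- u) * u ^ 0 * g (x * u))" and x: "x \<ge> 0"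
  shows "laplace_moment 0 (real_conv f g) x = x * laplace_moment 0 f x * laplace_moment 0 g x"
proof -
  let ?\<phi> = "\<lambda>a. indicator {0..} a *\<^sub>R (exp (- a) * a ^ 0 * f (x * a))"
  let ?\<gamma> = "\<lambda>a. indicator {0..} a *\<^sub>R (exp (- a) * a ^ 0 * g (x * a))"
  have cf: "continuous_on {0..} (\<lambda>a. f (x * a))" and cg: "continuous_on {0..} (\<lambda>a. g (x * a))"
    using x by (auto intro!: continuous_intros continuous_on_compose2[OF f] continuous_on_compose2[OF g])
  have inner: "(\<integral>a. ?\<phi> a * ?\<gamma> (u - a) \<partial>lborel)
     = indicator {0..} u *\<^sub>R (exp (- u) * u ^ 0 * real_conv (\<lambda>a. f (x * a)) (\<lambda>a. g (x * a)) u)" for u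
  proof (cases "u \<ge> 0")
    case True
    \<comment> \<open>The two half-line indicators are both nonzero exactly for
      \<open>0 \<le> a \<le> u\<close>, which restores the finite range of
      \<open>real_conv\<close>.\<close>
    have *: "?\<phi> a * ?\<gamma> (u - a) = exp (- u) * (indicator {0..u} a *\<^sub>R (f (x * a) * g (x * (u - a))))" for a
      by (auto split: split_indicator simp: exp_diff exp_minus field_simps)
    show ?thesis
      unfolding * using True real_conv_eq_LINT[OF cf cg True] by (simp add: set_lebesgue_integral_def)
  next
    case False
    then have *: "?\<phi> a * ?\<gamma> (u - a) = 0" for a
      by (auto split: split_indicator)
    show ?thesis unfolding * using False by simp
  qed
  have scale: "real_conv f g (x * u) = x * real_conv (\<lambda>a. f (x * a)) (\<lambda>a. g (x * a)) u" for u
    by (simp add: real_conv_def mult_ac)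
  have "laplace_moment 0 (real_conv f g) x
      = x * (LINT u:{0..}|lborel. exp (- u) * u ^ 0 * real_conv (\<lambda>a. f (x * a)) (\<lambda>a. g (x * a)) u)"
    unfolding laplace_moment_def scale set_integral_mult_right[symmetric] by (simp only: mult_ac)
  also have "\<dots> = x * (laplace_moment 0 f x * laplace_moment 0 g x)"
    using integral_convolution[OF If[unfolded set_integrable_def] Ig[unfolded set_integrable_def]]
    unfolding inner by (simp only: laplace_moment_def set_lebesgue_integral_def)
  finally show ?thesis by simp
qed

subsection \<open>The slow curve\<close>

definition on_reals :: "(complex \<Rightarrow> complex) \<Rightarrow> real \<Rightarrow> real" where
  "on_reals F t = Re (F (of_real t))"

lemma on_reals_deriv:
  assumes "F holomorphic_on strip"
  shows "(on_reals ((deriv ^^ n) F) has_real_derivative on_reals ((deriv ^^ Suc n) F) t) (at t)"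
proof -
  have "(deriv ^^ n) F holomorphic_on strip"
    using assms open_strip by (rule holomorphic_higher_deriv)
  then have "((deriv ^^ n) F has_field_derivative (deriv ^^ Suc n) F (of_real t)) (at (of_real t))"
    using holomorphic_derivI[OF _ open_strip of_real_strip] by simp
  then have "((\<lambda>t. (deriv ^^ n) F (of_real t)) has_vector_derivative (deriv ^^ Suc n) F (of_real t)) (at t)"
    by (rule has_vector_derivative_real_field)
  then have "((\<lambda>t. Re ((deriv ^^ n) F (of_real t))) has_vector_derivative Re ((deriv ^^ Suc n) F (of_real t))) (at t)"
    by (rule bounded_linear.has_vector_derivative[OF bounded_linear_Re])
  then show ?thesis
    by (simp add: has_real_derivative_iff_has_vector_derivative on_reals_def[abs_def])
qed

text \<open>Cauchy's inequality on the disc of radius 1/4 about \<open>t\<close>, which lies in the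
  strip. The radius accounts for \<open>4 ^ n\<close>, and the growth over the disc for
  \<open>exp (4000 / 4)\<close>.\<close>

lemma on_reals_deriv_bound:
  assumes hol: "F holomorphic_on strip" and b: "small_bound c F" and t: "t \<ge> 0"
  shows "\<bar>on_reals ((deriv ^^ n) F) t\<bar> \<le> (c * exp 1000 * fact n * 4 ^ n) * exp (4000 * t)"
proof -
  have c: "c \<ge> 0"
    using weighted_boundD[OF b, of 0] by (auto simp: strip_def weight_def intro: order_trans[OF norm_ge_zero])
  have sub: "cball (of_real t) (1/4) \<subseteq> strip"
  proof
    fix z assume "z \<in> cball (complex_of_real t) (1/4)"
    then show "z \<in> strip"
      using abs_Im_le_cmod[of "of_real t - z"] by (simp add: strip_def dist_norm)
  qed
  have "norm ((deriv ^^ n) F (of_real t)) \<le> fact n * (c * exp (4000 * t + 1000)) / (1/4) ^ n"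
  proof (rule Cauchy_inequality)
    show "F holomorphic_on ball (of_real t) (1/4)"
      using hol sub ball_subset_cball by (metis holomorphic_on_subset order_trans)
    show "continuous_on (cball (of_real t) (1/4)) F"
      using hol sub by (metis holomorphic_on_imp_continuous_on holomorphic_on_subset)
    fix z :: complex assume z: "norm (of_real t - z) = 1/4"
    then have "z \<in> strip" using sub by (auto simp: dist_norm)
    moreover have nz: "norm z \<le> t + 1/4"
      using z t norm_triangle_ineq2[of z "of_real t"] by (simp add: norm_minus_commute)
    ultimately have "norm (F z) \<le> c * weight 4000 (norm z)"
      using weighted_boundD[OF b] by blast
    also have "\<dots> \<le> c * exp (4000 * norm z)"
      using c weight_le_exp[of 4000 "norm z"] by (intro mult_left_mono) auto
    also have "\<dots> \<le> c * exp (4000 * t + 1000)"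
      using c nz by (intro mult_left_mono) auto
    finally show "norm (F z) \<le> c * exp (4000 * t + 1000)" .
  qed simp
  also have "\<dots> = (c * exp 1000 * fact n * 4 ^ n) * exp (4000 * t)"
    by (simp add: exp_add power_divide)
  finally show ?thesis
    unfolding on_reals_def using abs_Re_le_cmod order_trans by blast
qed

text \<open>For \<open>x > 0\<close>, \<open>x * laplace F x\<close> is the classical Laplace
  transform of \<open>F\<close> at \<open>1 / x\<close>. This normalisation makes sense at
  \<open>x = 0\<close>.\<close>

definition laplace :: "(complex \<Rightarrow> complex) \<Rightarrow> real \<Rightarrow> real" where
  "laplace F = laplace_moment 0 (on_reals F)"

text \<open>A class closed under \<open>conv\<close> on which one interval
  \<open>{0..1/8000}\<close> serves all members. Real values are demanded because
  \<open>on_reals\<close> takes real parts, which is multiplicative only for real numbers.\<close>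

definition laplaceable :: "(complex \<Rightarrow> complex) \<Rightarrow> bool" where
  "laplaceable F \<longleftrightarrow> F holomorphic_on strip \<and> (\<exists>c. small_bound c F) \<and> (\<forall>t. F (of_real t) \<in> \<real>)"

lemma continuous_on_reals: "laplaceable F \<Longrightarrow> continuous_on S (on_reals F)"
  using DERIV_continuous[OF on_reals_deriv[of F 0]] unfolding laplaceable_def
  by (intro continuous_at_imp_continuous_on) simp

lemma laplaceable_integrable:
  assumes "laplaceable F" "x \<in> {0..1/8000}"
  shows "set_integrable lborel {0..} (\<lambda>u. exp (- u) * u ^ n * on_reals F (x * u))"
proof -
  obtain c where c: "small_bound c F" "F holomorphic_on strip"
    using assms by (auto simp: laplaceable_def)
  show ?thesis
    using assms(2) on_reals_deriv_bound[OF c(2,1), of _ 0]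
    by (intro laplace_moment_bound(1)[OF continuous_on_reals[OF assms(1)], of "c * exp 1000" 4000]) auto
qed

lemma laplaceable_conv:
  assumes "laplaceable F" "laplaceable G"
  shows "laplaceable (conv F G)"
  unfolding laplaceable_def
proof (intro conjI allI)
  show "conv F G holomorphic_on strip"
    using assms by (intro holomorphic_conv) (simp_all add: laplaceable_def)
  obtain a b where "small_bound a F" "small_bound b G"
    using assms by (auto simp: laplaceable_def)
  then show "\<exists>c. small_bound c (conv F G)"
    using weighted_bound_conv[of 4000 F G a b] assms by (auto simp: laplaceable_def)
  show "conv F G (of_real t) \<in> \<real>" for t
    using assms by (intro conv_Reals) (simp_all add: laplaceable_def)
qed

lemma laplaceable_one: "laplaceable (\<lambda>_. 1)"
  using weighted_bound_one[of 4000] holomorphic_on_const by (auto simp: laplaceable_def)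

lemma laplace_conv:
  assumes "laplaceable F" "laplaceable G" "x \<in> {0..1/8000}"
  shows "laplace (conv F G) x = x * laplace F x * laplace G x"
proof -
  have "conv F G (of_real t) = of_real (real_conv (on_reals F) (on_reals G) t)" for t
    unfolding real_conv_def
    by (rule conv_of_real) (use assms in \<open>auto simp: laplaceable_def on_reals_def\<close>)
  then have "on_reals (conv F G) = real_conv (on_reals F) (on_reals G)"
    by (simp add: on_reals_def[abs_def] fun_eq_iff)
  then show ?thesis
    unfolding laplace_def
    using laplace_real_conv[OF continuous_on_reals continuous_on_reals laplaceable_integrable laplaceable_integrable]
      assms by simp
qed

lemma laplace_one: "laplace (\<lambda>_. 1) x = 1"
proof -
  have I: "((\<lambda>u::real. exp (- u)) has_integral 1) {0..}"
    using has_integral_exp_minus_to_infinity[of 1 0] by simp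
  have "(\<lambda>u::real. exp (- u)) absolutely_integrable_on {0..}"
    using I by (intro nonnegative_absolutely_integrable_1) auto
  then have *: "set_integrable lborel {0..} (\<lambda>u::real. exp (- u))"
    by (simp add: set_integrable_def integrable_completion)
  then show ?thesis
    using set_borel_integral_eq_integral(2)[OF *] integral_unique[OF I]
    by (simp add: laplace_def laplace_moment_def on_reals_def)
qed

lemma laplace_moment_times_id: "laplace_moment 0 (\<lambda>t. t * g t) x = x * laplace_moment 1 g x"
  unfolding laplace_moment_def set_integral_mult_right[symmetric] by (simp add: mult_ac)

section \<open>The sums of the Borel transforms and their derivatives\<close>

lemma laplaceable_borel_limit: "laplaceable (borel_limit i)"
  using holomorphic_borel_limit borel_limit_bound borel_limit_Reals by (auto simp: laplaceable_def)

definition profile_deriv :: "nat \<Rightarrow> nat \<Rightarrow> real \<Rightarrow> real" where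
  "profile_deriv i n = laplace_moment n (on_reals ((deriv ^^ n) (borel_limit i)))"

lemma profile_deriv_0: "profile_deriv i 0 = laplace (borel_limit i)"
  by (simp add: profile_deriv_def laplace_def)

lemma profile_deriv_has_derivative:
  assumes "x \<in> {0..1/8000}"
  shows "(profile_deriv i n has_real_derivative profile_deriv i (Suc n) x) (at x within {0..1/8000})"
  unfolding profile_deriv_def
  using laplace_moment_deriv[where g = "\<lambda>n. on_reals ((deriv ^^ n) (borel_limit i))" and K = 4000,
      OF on_reals_deriv[OF holomorphic_borel_limit]
         on_reals_deriv_bound[OF holomorphic_borel_limit borel_limit_bound]] assms
  by simp

lemma profile_deriv_bound:
  assumes "x \<in> {0..1/8000}"
  shows "\<bar>profile_deriv i n x\<bar> \<le> (32 * exp 1000) * 16 ^ n * (fact n)\<^sup>2"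
proof -
  have c: "continuous_on {0..} (on_reals ((deriv ^^ n) (borel_limit i)))"
    using on_reals_deriv[OF holomorphic_borel_limit]
    by (meson DERIV_continuous continuous_at_imp_continuous_on)
  have "\<bar>profile_deriv i n x\<bar> \<le> 4 * (8 * exp 1000 * fact n * 4 ^ n * fact n * 4 ^ n)"
    unfolding profile_deriv_def using assms
    by (intro laplace_moment_bound(2)[OF c on_reals_deriv_bound[OF holomorphic_borel_limit borel_limit_bound]]) auto
  also have "\<dots> = (32 * exp 1000) * (4 ^ n * 4 ^ n) * (fact n)\<^sup>2"
    by (simp add: power2_eq_square)
  also have "4 ^ n * 4 ^ n = (16 :: real) ^ n"
    by (simp add: power_mult_distrib[symmetric])
  finally show ?thesis .
qed

text \<open>At \<open>x = 0\<close> the moment is a multiple of the n-th derivative of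
  \<open>borel_limit i\<close> at 0, and that derivative vanishes for one parity of
  \<open>n\<close>.\<close>

lemma profile_deriv_at_0:
  assumes "(i = 1 \<and> odd n) \<or> (i \<noteq> 1 \<and> even n)"
  shows "profile_deriv i n 0 = 0"
proof -
  have "(deriv ^^ n) (\<lambda>w. borel_limit i ((- 1) * w)) 0 = (- 1) ^ n * (deriv ^^ n) (borel_limit i) ((- 1) * 0)"
    by (rule higher_deriv_compose_linear[OF holomorphic_borel_limit open_strip open_strip])
       (auto simp: strip_def)
  moreover have "(deriv ^^ n) (\<lambda>w. borel_limit i ((- 1) * w)) 0 = (deriv ^^ n) (\<lambda>w. parity i * borel_limit i w) 0"
  proof (rule higher_deriv_cong_ev)
    have "\<forall>\<^sub>F w in nhds 0. w \<in> strip"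
      using open_strip by (rule eventually_nhds_in_open) (simp add: strip_def)
    then show "\<forall>\<^sub>F w in nhds 0. borel_limit i ((- 1) * w) = parity i * borel_limit i w"
      by eventually_elim (simp add: borel_limit_parity)
  qed simp
  moreover have "(deriv ^^ n) (\<lambda>w. parity i * borel_limit i w) 0 = parity i * (deriv ^^ n) (borel_limit i) 0"
    by (rule higher_deriv_cmult[OF holomorphic_borel_limit _ open_strip]) (simp add: strip_def)
  ultimately have "(deriv ^^ n) (borel_limit i) 0 = 0"
    using assms by (auto simp: parity_def)
  then show ?thesis
    by (simp add: profile_deriv_def laplace_moment_def on_reals_def)
qed

text \<open>The left side is \<open>x^2\<close> times the derivative of
  \<open>x * profile_deriv i 0 x\<close>. Integration by parts rewrites it with the transform
  multiplied by its variable, to which the convolution equations apply.\<close>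

lemma profile_ode_moment:
  assumes x: "x \<in> {0..1/8000}"
  shows "x\<^sup>2 * (profile_deriv i 0 x + x * profile_deriv i 1 x)
     = x * laplace_moment 0 (\<lambda>t. t * on_reals (borel_limit i) t) x"
proof -
  have "laplace_moment 0 (on_reals (borel_limit i)) x + x * laplace_moment 1 (on_reals (deriv (borel_limit i))) x
     = laplace_moment 1 (on_reals (borel_limit i)) x"
  proof (rule laplace_moment_by_parts)
    show "(on_reals (borel_limit i) has_real_derivative on_reals (deriv (borel_limit i)) t) (at t)" for t
      using on_reals_deriv[OF holomorphic_borel_limit[of i], of 0 t] by simp
    show "continuous_on {0..} (on_reals (deriv (borel_limit i)))"
      using DERIV_continuous[OF on_reals_deriv[OF holomorphic_borel_limit[of i], of 1]]
      by (intro continuous_at_imp_continuous_on) simp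
    show "\<bar>on_reals (borel_limit i) t\<bar> \<le> (8 * exp 1000) * exp (4000 * t)" if "t \<ge> 0" for t
      using on_reals_deriv_bound[OF holomorphic_borel_limit[of i] borel_limit_bound that, of 0] by simp
    show "\<bar>on_reals (deriv (borel_limit i)) t\<bar> \<le> (32 * exp 1000) * exp (4000 * t)" if "t \<ge> 0" for t
      using on_reals_deriv_bound[OF holomorphic_borel_limit[of i] borel_limit_bound that, of 1] by simp
  qed (use x in auto)
  then show ?thesis
    by (simp add: laplace_moment_times_id profile_deriv_def power2_eq_square)
qed

text \<open>Undoes the inversion of the linear part: multiplying out the fixed point formulas
  reproduces \<open>1 + s^2\<close>, which cancels its inverse \<open>q\<close>.\<close>

lemma borel_limit_equations:
  assumes s: "s \<in> strip"
  shows "s * borel_limit 0 s = borel_A borel_limit s - borel_limit 1 s"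
    and "s * borel_limit 1 s = borel_B borel_limit s + borel_limit 0 s"
    and "borel_limit 2 s = - borel_limit 0 s - conv (borel_limit 2) (borel_limit 0) s"
proof -
  have Y: "borel_limit 0 s = borel_Y borel_limit s" and V: "borel_limit 1 s = borel_V borel_limit s"
    and E: "borel_limit 2 s = - 1 * borel_Y borel_limit s - conv (borel_limit 2) (borel_limit 0) s"
    using borel_limit_fixed_point[OF s, of 0] borel_limit_fixed_point[OF s, of 1]
      borel_limit_fixed_point[OF s, of 2] by (simp_all add: borel_step_def)
  define A B q where "A = borel_A borel_limit s" and "B = borel_B borel_limit s" and "q = 1 / (1 + s\<^sup>2)"
  have q: "q * (1 + s\<^sup>2) = 1" using strip_resolvent(1)[OF s] by (simp add: q_def)
  have Y': "borel_limit 0 s = s * q * A - q * B" and V': "borel_limit 1 s = q * A + s * q * B"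
    unfolding Y V by (simp_all add: borel_Y_def borel_V_def A_def B_def q_def)
  have "s * borel_limit 0 s = q * (1 + s\<^sup>2) * A - borel_limit 1 s"
    unfolding Y' V' by (simp add: power2_eq_square algebra_simps)
  then show "s * borel_limit 0 s = borel_A borel_limit s - borel_limit 1 s"
    by (simp add: q A_def)
  have "s * borel_limit 1 s = q * (1 + s\<^sup>2) * B + borel_limit 0 s"
    unfolding Y' V' by (simp add: power2_eq_square algebra_simps)
  then show "s * borel_limit 1 s = borel_B borel_limit s + borel_limit 0 s"
    by (simp add: q B_def)
  show "borel_limit 2 s = - borel_limit 0 s - conv (borel_limit 2) (borel_limit 0) s"
    using E unfolding Y[symmetric] by simp
qed

lemma profile_equations:
  fixes x :: real
  defines "y \<equiv> x * profile_deriv 0 0 x" and "v \<equiv> x * profile_deriv 1 0 x"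
  assumes x: "x \<in> {0..1/8000}"
  shows "x\<^sup>2 * (profile_deriv 0 0 x + x * profile_deriv 0 1 x) = - v - 2/3 * x * (1 + y)"
    and "x\<^sup>2 * (profile_deriv 1 0 x + x * profile_deriv 1 1 x) = y / (1 + y) ^ 3 + 2/3 * x * v"
    and "1 + y \<noteq> 0"
proof -
  let ?Y = "borel_limit 0" and ?V = "borel_limit 1" and ?E = "borel_limit 2"
  let ?one = "\<lambda>_. 1 :: complex"
  define \<eta> where "\<eta> = x * laplace ?E x"
  note lap = laplaceable_borel_limit laplaceable_one laplaceable_conv
  have y: "y = x * laplace ?Y x" and v: "v = x * laplace ?V x"
    by (simp_all add: y_def v_def profile_deriv_0)
  have int: "set_integrable lborel {0..} (\<lambda>u. exp (- u) * on_reals F (x * u))" if "laplaceable F" for F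
    using laplaceable_integrable[OF that x, of 0] by simp
  have lm: "laplace F x = (LINT u:{0..}|lborel. exp (- u) * on_reals F (x * u))" for F
    by (simp add: laplace_def laplace_moment_def)
  have tY: "t * on_reals ?Y t = - (2/3) * on_reals ?one t - 2/3 * on_reals (conv ?one ?Y) t - on_reals ?V t" for t
    using arg_cong[OF borel_limit_equations(1)[OF of_real_strip[of t]], of Re]
    by (simp add: on_reals_def borel_A_def)
  have tV: "t * on_reals ?V t = on_reals (conv ?E ?Y) t - 2 * on_reals (conv ?E ?E) t
      - on_reals (conv ?E (conv ?E ?E)) t + 2/3 * on_reals (conv ?one ?V) t + on_reals ?Y t" for t
    using arg_cong[OF borel_limit_equations(2)[OF of_real_strip[of t]], of Re]
    by (simp add: on_reals_def borel_B_def)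
  have tE: "on_reals ?E t = - 1 * on_reals ?Y t - on_reals (conv ?E ?Y) t" for t
    using arg_cong[OF borel_limit_equations(3)[OF of_real_strip[of t]], of Re]
    by (simp add: on_reals_def)
  have "laplace_moment 0 (\<lambda>t. t * on_reals ?Y t) x
     = (LINT u:{0..}|lborel. - (2/3) * (exp (- u) * on_reals ?one (x * u))
         - 2/3 * (exp (- u) * on_reals (conv ?one ?Y) (x * u)) - exp (- u) * on_reals ?V (x * u))"
    unfolding tY laplace_moment_def by (simp add: algebra_simps)
  also have "\<dots> = - (2/3) * laplace ?one x - 2/3 * laplace (conv ?one ?Y) x - laplace ?V x"
    unfolding lm by (simp only: set_integral_diff set_integral_mult_right set_integrable_mult_right int lap)
  also have "\<dots> = - (2/3) - 2/3 * y - laplace ?V x"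
    using x by (simp add: laplace_conv lap laplace_one y)
  finally have L: "laplace_moment 0 (\<lambda>t. t * on_reals ?Y t) x = - (2/3) - 2/3 * y - laplace ?V x" .
  show "x\<^sup>2 * (profile_deriv 0 0 x + x * profile_deriv 0 1 x) = - v - 2/3 * x * (1 + y)"
    unfolding profile_ode_moment[OF x] L by (simp add: v algebra_simps)
  have "laplace ?E x = (LINT u:{0..}|lborel. - 1 * (exp (- u) * on_reals ?Y (x * u))
      - exp (- u) * on_reals (conv ?E ?Y) (x * u))"
    unfolding lm by (subst tE) (simp add: algebra_simps)
  also have "\<dots> = - 1 * laplace ?Y x - laplace (conv ?E ?Y) x"
    unfolding lm by (simp only: set_integral_diff set_integral_mult_right set_integrable_mult_right int lap)
  finally have "laplace ?E x = - laplace ?Y x - x * laplace ?E x * laplace ?Y x"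
    using x by (simp add: laplace_conv lap)
  then have "\<eta> = x * (- laplace ?Y x - x * laplace ?E x * laplace ?Y x)"
    unfolding \<eta>_def by (rule arg_cong)
  also have "\<dots> = - y - \<eta> * y"
    by (simp add: \<eta>_def y algebra_simps)
  finally have \<eta>: "\<eta> = - y - \<eta> * y" .
  \<comment> \<open>The auxiliary unknown is thus really \<open>1 / (1 + y) - 1\<close>, and
    \<open>1 + y \<noteq> 0\<close> comes for free.\<close>
  then have inv: "(1 + \<eta>) * (1 + y) = 1" by (simp add: algebra_simps)
  then show ne: "1 + y \<noteq> 0" by auto
  have "laplace_moment 0 (\<lambda>t. t * on_reals ?V t) x
     = (LINT u:{0..}|lborel. exp (- u) * on_reals (conv ?E ?Y) (x * u)
         - 2 * (exp (- u) * on_reals (conv ?E ?E) (x * u))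
         - exp (- u) * on_reals (conv ?E (conv ?E ?E)) (x * u)
         + 2/3 * (exp (- u) * on_reals (conv ?one ?V) (x * u)) + exp (- u) * on_reals ?Y (x * u))"
    unfolding tV laplace_moment_def by (simp add: algebra_simps)
  also have "\<dots> = laplace (conv ?E ?Y) x - 2 * laplace (conv ?E ?E) x - laplace (conv ?E (conv ?E ?E)) x
      + 2/3 * laplace (conv ?one ?V) x + laplace ?Y x"
    unfolding lm by (simp only: set_integral_diff set_integral_add set_integral_mult_right set_integrable_mult_right int lap)
  finally have LV: "laplace_moment 0 (\<lambda>t. t * on_reals ?V t) x = laplace (conv ?E ?Y) x
      - 2 * laplace (conv ?E ?E) x - laplace (conv ?E (conv ?E ?E)) x + 2/3 * laplace (conv ?one ?V) x + laplace ?Y x" .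
  have "x * laplace_moment 0 (\<lambda>t. t * on_reals ?V t) x
     = (y + \<eta> * y) - 2 * \<eta>\<^sup>2 - \<eta> ^ 3 + 2/3 * x * v"
    unfolding LV using x
    by (simp add: laplace_conv lap laplace_one y v \<eta>_def power2_eq_square power3_eq_cube algebra_simps)
  \<comment> \<open>This collapses the polynomial to \<open>- \<eta> (1 + \<eta>)^2\<close>, which
    equals \<open>y (1 + \<eta>)^3 = y / (1 + y)^3\<close>.\<close>
  also have "y + \<eta> * y = - \<eta>"
    using \<eta> by linarith
  also have "- \<eta> - 2 * \<eta>\<^sup>2 - \<eta> ^ 3 + 2/3 * x * v = - \<eta> * (1 + \<eta>)\<^sup>2 + 2/3 * x * v"
    by (simp add: power2_eq_square power3_eq_cube algebra_simps)
  also have "- \<eta> * (1 + \<eta>)\<^sup>2 = y * (1 + \<eta>) ^ 3"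
  proof -
    have "- \<eta> = y * (1 + \<eta>)" using \<eta> by (simp add: algebra_simps)
    then have "- \<eta> * (1 + \<eta>)\<^sup>2 = y * (1 + \<eta>) * (1 + \<eta>)\<^sup>2" by (simp only:)
    then show ?thesis by (simp add: power2_eq_square power3_eq_cube mult_ac)
  qed
  also have "1 + \<eta> = 1 / (1 + y)"
    using inv ne by (simp add: field_simps)
  finally show "x\<^sup>2 * (profile_deriv 1 0 x + x * profile_deriv 1 1 x) = y / (1 + y) ^ 3 + 2/3 * x * v"
    unfolding profile_ode_moment[OF x] by (simp add: power_divide)
qed

subsection \<open>Uniqueness of convergent orbits\<close>

text \<open>The effective Kepler potential; its derivative is \<open>force\<close>, and its minimum
  on the positive axis is at 1.\<close>

definition potential :: "real \<Rightarrow> real" where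
  "potential r = 1 / (2 * r\<^sup>2) - 1 / r"

definition force :: "real \<Rightarrow> real" where
  "force r = (r - 1) / r ^ 3"

definition force' :: "real \<Rightarrow> real" where
  "force' r = 3 / r ^ 4 - 2 / r ^ 3"

lemma force_eq: "r > 0 \<Longrightarrow> force r = 1 / r\<^sup>2 - 1 / r ^ 3"
  by (simp add: force_def divide_simps power2_eq_square power3_eq_cube)

lemma potential_deriv:
  assumes "(r has_real_derivative r') (at t within S)" "r t > 0"
  shows "((\<lambda>t. potential (r t)) has_real_derivative force (r t) * r') (at t within S)"
  unfolding potential_def force_eq[OF assms(2)] using assms(2)
  by (auto intro!: derivative_eq_intros assms(1))
     (simp add: divide_simps eval_nat_numeral, simp add: algebra_simps)

lemma force_deriv:
  assumes "(r has_real_derivative r') (at t within S)" "r t > 0"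
  shows "((\<lambda>t. force (r t)) has_real_derivative force' (r t) * r') (at t within S)"
  unfolding force_def force'_def using assms(2)
  by (auto intro!: derivative_eq_intros assms(1))
     (simp add: divide_simps eval_nat_numeral, simp add: algebra_simps)

text \<open>The remainder equals \<open>(r - s)^2 (s + 2 r (1 - s)) / (2 r^2 s^3)\<close> exactly.
  Near 1 the numerator factor is at least 17/20 and \<open>r^2 s^3\<close> at most 17/10, whence
  1/4.\<close>

lemma potential_remainder_lower:
  assumes r: "\<bar>r - 1\<bar> \<le> 1/10" and s: "\<bar>s - 1\<bar> \<le> 1/10"
  shows "(r - s)\<^sup>2 / 4 \<le> potential r - potential s - force s * (r - s)"
proof -
  have pos: "r > 0" "s > 0" using r s by linarith+
  have r2: "r\<^sup>2 \<le> (11/10)\<^sup>2" and s3: "s ^ 3 \<le> (11/10) ^ 3"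
    using r s by (intro power_mono; linarith)+
  have "r\<^sup>2 * s ^ 3 \<le> (11/10)\<^sup>2 * (11/10) ^ 3"
    using pos by (intro mult_mono r2 s3) auto
  then have a: "r\<^sup>2 * s ^ 3 \<le> 17/10" by (simp add: power2_eq_square power3_eq_cube)
  have b: "s + 2 * r * (1 - s) \<ge> 17/20"
  proof (cases "s \<le> 1")
    case True
    then have "2 * r * (1 - s) \<ge> 0" using pos by simp
    then show ?thesis using s by linarith
  next
    case False
    have "2 * r * (s - 1) \<le> 11/5 * (s - 1)"
      using r False by (intro mult_right_mono) linarith+
    moreover have "s + 2 * r * (1 - s) = s - 2 * r * (s - 1)" by (simp add: algebra_simps)
    ultimately have "s + 2 * r * (1 - s) \<ge> s - 11/5 * (s - 1)" by linarith
    moreover have "s \<le> 11/10" using s by linarith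
    then have "s - 11/5 * (s - 1) \<ge> 17/20" by argo
    ultimately show ?thesis by linarith
  qed
  have p: "0 < 2 * r\<^sup>2 * s ^ 3" using pos by simp
  have "1/4 \<le> (s + 2 * r * (1 - s)) / (2 * r\<^sup>2 * s ^ 3)"
    unfolding pos_le_divide_eq[OF p] using a b by linarith
  then have "(r - s)\<^sup>2 * (1/4) \<le> (r - s)\<^sup>2 * ((s + 2 * r * (1 - s)) / (2 * r\<^sup>2 * s ^ 3))"
    by (intro mult_left_mono) auto
  also have "\<dots> = potential r - potential s - force s * (r - s)"
    using pos by (simp add: potential_def force_def divide_simps power2_eq_square power3_eq_cube)
       (simp add: algebra_simps)
  finally show ?thesis by simp
qed

text \<open>With \<open>a = 1 / r\<close> and \<open>b = 1 / s\<close> the remainder is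
  \<open>(r - s)^2\<close> times a polynomial in \<open>a\<close>, \<open>b\<close>, and both lie in
  \<open>{0..10/9}\<close>. The bound 22 is 2 for \<open>a b^2\<close> times 11 for the other
  factor.\<close>

lemma force_remainder_bound:
  assumes r: "\<bar>r - 1\<bar> \<le> 1/10" and s: "\<bar>s - 1\<bar> \<le> 1/10"
  shows "\<bar>force r - force s - force' s * (r - s)\<bar> \<le> 22 * (r - s)\<^sup>2"
proof -
  have rs: "9/10 \<le> r" "9/10 \<le> s" and pos: "r > 0" "s > 0" using r s by linarith+
  define a b where "a = 1 / r" and "b = 1 / s"
  have a: "0 \<le> a" "a \<le> 10/9" and b: "0 \<le> b" "b \<le> 10/9"
    using pos rs by (auto simp: a_def b_def divide_simps)
  have "force r - force s - force' s * (r - s)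
     = (r - s)\<^sup>2 * (a * b\<^sup>2 * ((a + 2 * b) - (a\<^sup>2 + 2 * a * b + 3 * b\<^sup>2)))"
    using pos by (simp add: force_def force'_def a_def b_def divide_simps power2_eq_square power3_eq_cube power4_eq_xxxx)
       (simp add: algebra_simps)
  then have "\<bar>force r - force s - force' s * (r - s)\<bar>
     = (r - s)\<^sup>2 * \<bar>a * b\<^sup>2 * ((a + 2 * b) - (a\<^sup>2 + 2 * a * b + 3 * b\<^sup>2))\<bar>"
    by (simp only: abs_mult[of "(r - s)\<^sup>2"] abs_power2)
  also have "\<dots> \<le> (r - s)\<^sup>2 * (2 * 11)"
  proof (rule mult_left_mono)
    show "\<bar>a * b\<^sup>2 * ((a + 2 * b) - (a\<^sup>2 + 2 * a * b + 3 * b\<^sup>2))\<bar> \<le> 2 * 11"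
  proof -
    have sq: "a * a \<le> 10/9 * (10/9)" "a * b \<le> 10/9 * (10/9)" "b * b \<le> 10/9 * (10/9)"
      by (rule mult_mono; use a b in simp)+
    have "a * (b * b) \<le> 10/9 * (10/9 * (10/9))"
      using a b sq by (intro mult_mono) auto
    then have 1: "\<bar>a * b\<^sup>2\<bar> \<le> 2" using a b by (simp add: power2_eq_square)
    have "0 \<le> a * a" "0 \<le> a * b" "0 \<le> b * b" using a b by auto
    then have 2: "\<bar>(a + 2 * b) - (a\<^sup>2 + 2 * a * b + 3 * b\<^sup>2)\<bar> \<le> 11"
      using a b sq unfolding power2_eq_square by linarith
    show ?thesis unfolding abs_mult[of "a * b\<^sup>2"] by (rule mult_mono[OF 1 2]) auto
  qed
  qed simp
  finally show ?thesis by simp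
qed

text \<open>
  The difference of two solutions over the same \<open>p\<close> is governed by a Hamiltonian that depends on
  time only through \<open>p\<close> and \<open>s\<close>. Its logarithmic derivative is therefore \<open>O(p\<^sup>2)\<close>, which is
  integrable along \<open>p' = - p\<^sup>2\<close>, so the energy of the difference cannot decay to zero.
\<close>

lemma asymptotic_solutions_coincide:
  fixes r w p s u :: "real \<Rightarrow> real"
  assumes r: "\<And>t. t \<ge> 0 \<Longrightarrow> (r has_real_derivative w t + 2/3 * p t * r t) (at t within {0..})"
    and w: "\<And>t. t \<ge> 0 \<Longrightarrow> (w has_real_derivative - force (r t) - 2/3 * p t * w t) (at t within {0..})"
    and s: "\<And>t. t \<ge> 0 \<Longrightarrow> (s has_real_derivative u t + 2/3 * p t * s t) (at t within {0..})"
    and u: "\<And>t. t \<ge> 0 \<Longrightarrow> (u has_real_derivative - force (s t) - 2/3 * p t * u t) (at t within {0..})"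
    and p: "\<And>t. t \<ge> 0 \<Longrightarrow> (p has_real_derivative - (p t)\<^sup>2) (at t within {0..})"
    and box: "\<And>t. t \<ge> 0 \<Longrightarrow> \<bar>r t - 1\<bar> \<le> 1/10" "\<And>t. t \<ge> 0 \<Longrightarrow> \<bar>s t - 1\<bar> \<le> 1/10"
      "\<And>t. t \<ge> 0 \<Longrightarrow> 0 \<le> p t" "\<And>t. t \<ge> 0 \<Longrightarrow> p t \<le> 1/10"
    and slow: "\<And>t. t \<ge> 0 \<Longrightarrow> \<bar>u t + 2/3 * p t * s t\<bar> \<le> M * (p t)\<^sup>2" and M: "M \<ge> 0"
    and lim: "(r \<longlongrightarrow> 1) at_top" "(s \<longlongrightarrow> 1) at_top" "(w \<longlongrightarrow> 0) at_top" "(u \<longlongrightarrow> 0) at_top"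
      "(p \<longlongrightarrow> 0) at_top"
  shows "r 0 = s 0 \<and> w 0 = u 0"
proof -
  let ?N = "\<lambda>t. (r t - s t)\<^sup>2 + (w t - u t)\<^sup>2"
  \<comment> \<open>The Hamiltonian of the difference \<open>(r - s, w - u)\<close>. The cross term
    generates the \<open>2/3 p\<close> terms, so these cancel in the derivative. What remains is the
    explicit time dependence: through \<open>p' = - p^2\<close>, and through \<open>s\<close>, whose
    speed is \<open>O(p^2)\<close> by \<open>slow\<close>.\<close>
  define H where "H t = 1/2 * ((w t - u t) * (w t - u t)) + 2/3 * (p t * (r t - s t) * (w t - u t))
      + (potential (r t) - potential (s t) - force (s t) * (r t - s t))" for t
  define H' where "H' t = - 2/3 * (p t)\<^sup>2 * (r t - s t) * (w t - u t)
      + (force (r t) - force (s t) - force' (s t) * (r t - s t)) * (u t + 2/3 * p t * s t)" for t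
  \<comment> \<open>The 8 converts the squared distance \<open>?N\<close> into energy;
    \<open>1 + 22 * M\<close> bounds \<open>H'\<close> against \<open>p^2 * ?N\<close>.\<close>
  define L where "L = 8 * (1 + 22 * M)"
  have pos: "r t > 0" "s t > 0" if "t \<ge> 0" for t
    using box(1,2)[OF that] by linarith+
  have xy: "\<bar>2 * ((r t - s t) * (w t - u t))\<bar> \<le> ?N t" for t
  proof -
    have "2 * ((r t - s t) * (w t - u t)) \<le> ?N t" "- (2 * ((r t - s t) * (w t - u t))) \<le> ?N t"
      using sum_squares_bound[of "r t - s t" "w t - u t"] sum_squares_bound[of "r t - s t" "u t - w t"]
      by (simp_all add: algebra_simps power2_eq_square)
    then show ?thesis by linarith
  qed
  have H_deriv: "(H has_real_derivative H' t) (at t within {0..})" if t: "t \<ge> 0" for t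
  proof -
    note dr = DERIV_diff[OF r[OF t] s[OF t]] and dw = DERIV_diff[OF w[OF t] u[OF t]]
    note d1 = DERIV_cmult[OF DERIV_mult[OF dw dw], of "1/2"]
      and d2 = DERIV_cmult[OF DERIV_mult[OF DERIV_mult[OF p[OF t] dr] dw], of "2/3"]
      and d3 = DERIV_diff[OF DERIV_diff[OF potential_deriv[OF r[OF t] pos(1)[OF t]]
        potential_deriv[OF s[OF t] pos(2)[OF t]]] DERIV_mult[OF force_deriv[OF s[OF t] pos(2)[OF t]] dr]]
    show ?thesis
      unfolding H_def[abs_def] H'_def
      by (rule DERIV_cong[OF DERIV_add[OF DERIV_add[OF d1 d2] d3]])
         (simp add: field_simps power2_eq_square)
  qed
  have H_lower: "?N t \<le> 8 * H t" if t: "t \<ge> 0" for t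
  proof -
    have "\<bar>2/3 * p t * (r t - s t) * (w t - u t)\<bar> = 1/3 * p t * \<bar>2 * ((r t - s t) * (w t - u t))\<bar>"
      using box(3)[OF t] by (simp add: abs_mult)
    also have "\<dots> \<le> 1/3 * (1/10) * ?N t"
      using box(3,4)[OF t] xy by (intro mult_mono) auto
    finally have "2/3 * p t * (r t - s t) * (w t - u t) \<ge> - (1/30 * ?N t)" by linarith
    moreover have "(r t - s t)\<^sup>2 \<ge> 0" "(w t - u t)\<^sup>2 \<ge> 0" by auto
    ultimately show ?thesis
      using potential_remainder_lower[OF box(1)[OF t] box(2)[OF t]] unfolding H_def power2_eq_square by argo
  qed
  have H'_lower: "- (L * (p t)\<^sup>2 * H t) \<le> H' t" if t: "t \<ge> 0" for t
  proof -
    have "\<bar>- 2/3 * (p t)\<^sup>2 * (r t - s t) * (w t - u t)\<bar> = 1/3 * (p t)\<^sup>2 * \<bar>2 * ((r t - s t) * (w t - u t))\<bar>"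
      by (simp add: abs_mult)
    also have "\<dots> \<le> 1/3 * (p t)\<^sup>2 * ?N t"
      using xy by (intro mult_left_mono) auto
    also have "\<dots> \<le> 1 * (p t)\<^sup>2 * ?N t"
      by (intro mult_right_mono) auto
    finally have 1: "\<bar>- 2/3 * (p t)\<^sup>2 * (r t - s t) * (w t - u t)\<bar> \<le> (p t)\<^sup>2 * ?N t" by simp
    have "\<bar>(force (r t) - force (s t) - force' (s t) * (r t - s t)) * (u t + 2/3 * p t * s t)\<bar>
       \<le> (22 * (r t - s t)\<^sup>2) * (M * (p t)\<^sup>2)"
      unfolding abs_mult using force_remainder_bound[OF box(1)[OF t] box(2)[OF t]] slow[OF t] by (intro mult_mono) auto
    also have "\<dots> \<le> (22 * ?N t) * (M * (p t)\<^sup>2)"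
      using M by (intro mult_right_mono) auto
    finally have "\<bar>H' t\<bar> \<le> (p t)\<^sup>2 * ?N t + (22 * ?N t) * (M * (p t)\<^sup>2)"
      unfolding H'_def using 1 by linarith
    also have "\<dots> = (1 + 22 * M) * (p t)\<^sup>2 * ?N t" by (simp add: algebra_simps)
    also have "\<dots> \<le> (1 + 22 * M) * (p t)\<^sup>2 * (8 * H t)"
      using M H_lower[OF t] by (intro mult_left_mono) auto
    finally show ?thesis by (simp add: L_def algebra_simps)
  qed
  \<comment> \<open>Since \<open>p' = - p^2\<close>, the factor \<open>exp (- L p)\<close> has
    derivative \<open>L p^2 exp (- L p)\<close>. This compensates the worst possible loss of energy,
    so \<open>?G\<close> increases to its limit 0 and cannot start above it.\<close>
  let ?G = "\<lambda>t. H t * exp (- L * p t)"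
  have G_deriv: "(?G has_real_derivative (H' t + L * (p t)\<^sup>2 * H t) * exp (- L * p t)) (at t within {0..})"
    if t: "t \<ge> 0" for t
  proof -
    have "((\<lambda>t. exp (- L * p t)) has_real_derivative exp (- L * p t) * (- L * - (p t)\<^sup>2)) (at t within {0..})"
      by (rule DERIV_chain2[OF DERIV_exp DERIV_cmult[OF p[OF t]]])
    from DERIV_mult[OF H_deriv[OF t] this] show ?thesis
      by (rule DERIV_cong) (simp add: algebra_simps)
  qed
  have mono: "?G 0 \<le> ?G b" if b: "b > 0" for b
  proof (rule DERIV_nonneg_imp_increasing_open[OF less_imp_le[OF b]])
    fix t assume t: "0 < t" "t < b"
    have "(?G has_real_derivative (H' t + L * (p t)\<^sup>2 * H t) * exp (- L * p t)) (at t)"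
      using G_deriv[of t] t at_within_interior[of t "{0..}"] by (simp add: interior_real_atLeast)
    moreover have "(H' t + L * (p t)\<^sup>2 * H t) * exp (- L * p t) \<ge> 0"
      using H'_lower[of t] t by simp
    ultimately show "\<exists>y. (?G has_real_derivative y) (at t) \<and> 0 \<le> y" by blast
  next
    have "continuous_on {0..} ?G"
      using G_deriv by (intro DERIV_continuous_on) auto
    then show "continuous_on {0..b} ?G" by (rule continuous_on_subset) auto
  qed
  have "(?G \<longlongrightarrow> (1/2 * ((0 - 0) * (0 - 0)) + 2/3 * (0 * (1 - 1) * (0 - 0)) + (potential 1 - potential 1 - force 1 * (1 - 1))) * exp (- L * 0)) at_top"
    unfolding H_def potential_def force_def by (intro tendsto_intros lim) auto
  then have "(?G \<longlongrightarrow> 0) at_top" by simp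
  moreover have "\<forall>\<^sub>F b in at_top. ?G 0 \<le> ?G b"
    using eventually_gt_at_top[of 0] by eventually_elim (rule mono)
  ultimately have "?G 0 \<le> 0"
    by (intro tendsto_lowerbound) auto
  then have "H 0 \<le> 0" by (simp add: mult_le_0_iff)
  then have "?N 0 \<le> 0" using H_lower[of 0] by simp
  then show ?thesis using sum_power2_le_zero_iff[of "r 0 - s 0" "w 0 - u 0"] by simp
qed

text \<open>The profiles are at most \<open>32 * exp 1000\<close> times their argument; this radius
  forces them into the box of size 1/10 on which the energy estimates hold.\<close>

definition profile_radius :: real where
  "profile_radius = 1 / (8000 * (32 * exp 1000))"

text \<open>\<open>profile 0\<close> is \<open>y\<close> and \<open>profile 1\<close> is
  \<open>v\<close>, as functions of \<open>p\<close>.\<close>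

definition profile :: "nat \<Rightarrow> real \<Rightarrow> real" where
  "profile i x = x * profile_deriv i 0 x"

lemma profile_radius: "0 < profile_radius" "profile_radius \<le> 1/8000" "32 * exp 1000 * profile_radius \<le> 1/8000"
proof -
  have "1 \<le> 32 * exp (1000 :: real)" using exp_ge_add_one_self[of 1000] by linarith
  then show "profile_radius \<le> 1/8000" by (simp only: profile_radius_def divide_simps) simp
qed (simp_all add: profile_radius_def)

lemma profile_0 [simp]: "profile i 0 = 0"
  by (simp add: profile_def)

lemma profile_has_derivative:
  assumes "x \<in> {0..profile_radius}"
  shows "(profile i has_real_derivative profile_deriv i 0 x + x * profile_deriv i 1 x) (at x within {0..profile_radius})"
proof -
  have "(profile_deriv i 0 has_real_derivative profile_deriv i (Suc 0) x) (at x within {0..profile_radius})"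
    by (rule DERIV_subset[OF profile_deriv_has_derivative]) (use assms profile_radius(2) in auto)
  then show ?thesis
    unfolding profile_def[abs_def] by (auto intro!: derivative_eq_intros)
qed

lemma profile_abs_le:
  assumes x: "x \<in> {0..profile_radius}"
  shows "\<bar>profile i x\<bar> \<le> 1/10"
proof -
  have "\<bar>profile_deriv i 0 x\<bar> \<le> 32 * exp 1000"
    using profile_deriv_bound[of x i 0] x profile_radius(2) by simp
  then have "\<bar>profile i x\<bar> \<le> profile_radius * (32 * exp 1000)"
    unfolding profile_def abs_mult using x by (intro mult_mono) auto
  then show ?thesis using profile_radius(3) by (simp add: mult_ac)
qed

text \<open>Here \<open>544 = 32 + 32 * 16\<close>, the bounds for orders 0 and 1. A bounded slope
  makes the curve move at speed \<open>O(p^2)\<close> along the flow.\<close>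

lemma profile_slope_bound:
  assumes x: "x \<in> {0..profile_radius}"
  shows "\<bar>profile_deriv i 0 x + x * profile_deriv i 1 x\<bar> \<le> 544 * exp 1000"
proof -
  have x': "x \<in> {0..1/8000}" using x profile_radius(2) by auto
  have "\<bar>x * profile_deriv i 1 x\<bar> \<le> 1 * (32 * exp 1000 * 16)"
    unfolding abs_mult using profile_deriv_bound[OF x', of i 1] x' by (intro mult_mono) auto
  moreover have "\<bar>profile_deriv i 0 x\<bar> \<le> 32 * exp 1000"
    using profile_deriv_bound[OF x', of i 0] by simp
  ultimately show ?thesis by linarith
qed

lemma profile_ode:
  assumes x: "x \<in> {0..profile_radius}"
  shows "x\<^sup>2 * (profile_deriv 0 0 x + x * profile_deriv 0 1 x) = - profile 1 x - 2/3 * x * (1 + profile 0 x)"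
    and "x\<^sup>2 * (profile_deriv 1 0 x + x * profile_deriv 1 1 x) = force (1 + profile 0 x) + 2/3 * x * profile 1 x"
  using profile_equations[of x] x profile_radius(2) by (auto simp: profile_def force_def)

text \<open>Along \<open>p' = - p^2\<close> the chain rule produces \<open>- p^2\<close> times the
  slope, which the singular equations of \<open>profile_ode\<close> evaluate.\<close>

lemma profile_along_flow:
  assumes p: "(p has_real_derivative - (p t)\<^sup>2) (at t within {0..})"
    and range: "\<And>t. t \<ge> 0 \<Longrightarrow> p t \<in> {0..profile_radius}" and t: "t \<ge> 0"
  shows "((\<lambda>t. 1 + profile 0 (p t)) has_real_derivative
        profile 1 (p t) + 2/3 * p t * (1 + profile 0 (p t))) (at t within {0..})"
    and "((\<lambda>t. profile 1 (p t)) has_real_derivative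
        - force (1 + profile 0 (p t)) - 2/3 * p t * profile 1 (p t)) (at t within {0..})"
proof -
  have chain: "((\<lambda>t. profile i (p t)) has_real_derivative
     - ((p t)\<^sup>2 * (profile_deriv i 0 (p t) + p t * profile_deriv i 1 (p t)))) (at t within {0..})" for i
  proof -
    have "(profile i has_real_derivative profile_deriv i 0 (p t) + p t * profile_deriv i 1 (p t)) (at (p t) within p ` {0..})"
      by (rule DERIV_subset[OF profile_has_derivative[OF range[OF t]]]) (rule image_subsetI, simp only: range atLeast_iff)
    from DERIV_image_chain[OF this p] show ?thesis by (simp add: o_def mult.commute)
  qed
  show "((\<lambda>t. 1 + profile 0 (p t)) has_real_derivative
        profile 1 (p t) + 2/3 * p t * (1 + profile 0 (p t))) (at t within {0..})"
    by (rule DERIV_cong[OF DERIV_add[OF DERIV_const[of 1] chain[of 0]]])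
       (use profile_ode(1)[OF range[OF t]] in linarith)
  show "((\<lambda>t. profile 1 (p t)) has_real_derivative
        - force (1 + profile 0 (p t)) - 2/3 * p t * profile 1 (p t)) (at t within {0..})"
    by (rule DERIV_cong[OF chain[of 1]]) (use profile_ode(2)[OF range[OF t]] in linarith)
qed

subsection \<open>The local stable set\<close>

lemma forward_solution_components:
  fixes \<gamma> :: "real \<Rightarrow> real \<times> real \<times> real"
  defines "r \<equiv> \<lambda>t. fst (\<gamma> t)" and "w \<equiv> \<lambda>t. fst (snd (\<gamma> t))" and "l \<equiv> \<lambda>t. snd (snd (\<gamma> t))"
  assumes "forward_solution \<delta> \<gamma>" and t: "t \<ge> 0"
  shows "(r has_real_derivative w t + 2 * \<delta> * r t * l t ^ 3) (at t within {0..})"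
    and "(w has_real_derivative - force (r t) - 2 * \<delta> * w t * l t ^ 3) (at t within {0..})"
    and "(l has_real_derivative - \<delta> * l t ^ 4) (at t within {0..})"
    and "r t > 0" "l t \<ge> 0"
proof -
  have D: "(\<gamma> has_vector_derivative kepler_field \<delta> (\<gamma> t)) (at t within {0..})" and "\<gamma> t \<in> phase_space"
    using assms by (auto simp: forward_solution_def)
  then show "r t > 0" "l t \<ge> 0"
    by (auto simp: phase_space_def r_def l_def)
  have D2: "((\<lambda>t. snd (\<gamma> t)) has_vector_derivative snd (kepler_field \<delta> (\<gamma> t))) (at t within {0..})"
    by (rule bounded_linear.has_vector_derivative[OF bounded_linear_snd D])
  show "(r has_real_derivative w t + 2 * \<delta> * r t * l t ^ 3) (at t within {0..})"
    using bounded_linear.has_vector_derivative[OF bounded_linear_fst D]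
    by (simp add: has_real_derivative_iff_has_vector_derivative r_def w_def l_def kepler_field_def case_prod_unfold)
  show "(w has_real_derivative - force (r t) - 2 * \<delta> * w t * l t ^ 3) (at t within {0..})"
    using bounded_linear.has_vector_derivative[OF bounded_linear_fst D2]
    by (simp add: has_real_derivative_iff_has_vector_derivative r_def w_def l_def kepler_field_def case_prod_unfold force_def minus_divide_left)
  show "(l has_real_derivative - \<delta> * l t ^ 4) (at t within {0..})"
    using bounded_linear.has_vector_derivative[OF bounded_linear_snd D2]
    by (simp add: has_real_derivative_iff_has_vector_derivative r_def w_def l_def kepler_field_def case_prod_unfold)
qed

lemma forward_solutionI:
  assumes "\<And>t. t \<ge> 0 \<Longrightarrow> r t > 0" "\<And>t. t \<ge> 0 \<Longrightarrow> l t \<ge> 0"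
    and "\<And>t. t \<ge> 0 \<Longrightarrow> (r has_real_derivative w t + 2 * \<delta> * r t * l t ^ 3) (at t within {0..})"
    and "\<And>t. t \<ge> 0 \<Longrightarrow> (w has_real_derivative - force (r t) - 2 * \<delta> * w t * l t ^ 3) (at t within {0..})"
    and "\<And>t. t \<ge> 0 \<Longrightarrow> (l has_real_derivative - \<delta> * l t ^ 4) (at t within {0..})"
  shows "forward_solution \<delta> (\<lambda>t. (r t, w t, l t))"
  using assms unfolding forward_solution_def has_real_derivative_iff_has_vector_derivative
  by (auto simp: phase_space_def kepler_field_def force_def minus_divide_left intro!: has_vector_derivative_Pair)

lemma forward_solution_shift:
  assumes "forward_solution \<delta> \<gamma>" "a \<ge> 0"
  shows "forward_solution \<delta> (\<lambda>t. \<gamma> (a + t))"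
  unfolding forward_solution_def
proof (intro allI impI conjI)
  fix t :: real assume t: "t \<ge> 0"
  have "a + t \<ge> 0" using t assms(2) by simp
  then have "\<gamma> (a + t) \<in> phase_space" and D: "(\<gamma> has_vector_derivative kepler_field \<delta> (\<gamma> (a + t))) (at (a + t) within {0..})"
    using assms(1) by (simp_all add: forward_solution_def)
  then show "\<gamma> (a + t) \<in> phase_space" by simp
  have "(\<gamma> has_vector_derivative kepler_field \<delta> (\<gamma> (a + t))) (at (a + t) within (+) a ` {0..})"
    using assms(2) by (intro has_vector_derivative_within_subset[OF D]) auto
  moreover have "((+) a has_vector_derivative 1) (at t within {0..})"
    by (auto intro!: derivative_eq_intros)
  ultimately show "((\<lambda>t. \<gamma> (a + t)) has_vector_derivative kepler_field \<delta> (\<gamma> (a + t))) (at t within {0..})"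
    using vector_diff_chain_within[of "(+) a" 1 t "{0..}" \<gamma>] by (simp add: o_def)
qed

lemma tendsto_shift_at_top:
  fixes \<gamma> :: "real \<Rightarrow> 'a::topological_space"
  assumes "(\<gamma> \<longlongrightarrow> q) at_top"
  shows "((\<lambda>t. \<gamma> (a + t)) \<longlongrightarrow> q) at_top"
  by (rule filterlim_compose[OF assms filterlim_tendsto_add_at_top[OF tendsto_const filterlim_ident]])

lemma profile_tendsto_0:
  fixes p :: "real \<Rightarrow> real"
  assumes "(p \<longlongrightarrow> 0) at_top" "\<And>t. t \<ge> 0 \<Longrightarrow> p t \<in> {0..profile_radius}"
  shows "((\<lambda>t. profile i (p t)) \<longlongrightarrow> 0) at_top"
proof -
  have "continuous_on {0..profile_radius} (profile i)"
    by (rule DERIV_continuous_on[OF profile_has_derivative])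
  moreover have "\<forall>\<^sub>F t in at_top. p t \<in> {0..profile_radius}"
    unfolding eventually_at_top_linorder by (intro exI[of _ 0] allI impI assms(2))
  ultimately have "((\<lambda>t. profile i (p t)) \<longlongrightarrow> profile i 0) at_top"
    using less_imp_le[OF profile_radius(1)] by (intro continuous_on_tendsto_compose[OF _ assms(1)]) auto
  then show ?thesis by simp
qed

definition slow_point :: "real \<Rightarrow> real \<Rightarrow> real \<times> real \<times> real" where
  "slow_point \<delta> l = (1 + profile 0 (3 * \<delta> * l ^ 3), profile 1 (3 * \<delta> * l ^ 3), l)"

text \<open>The width 1/10 is the range of the energy estimates; the bound on \<open>w\<close> only
  makes the set a bounded neighbourhood.\<close>

definition slow_box :: "real \<Rightarrow> (real \<times> real \<times> real) set" where
  "slow_box l0 = {(r, w, k). \<bar>r - 1\<bar> \<le> 1/10 \<and> \<bar>w\<bar> \<le> 1 \<and> 0 \<le> k \<and> k \<le> l0}"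

lemma slow_time_in_range:
  assumes "\<delta> > 0" "3 * \<delta> * l0 \<le> profile_radius" "l0 \<le> 1" "0 \<le> k" "k \<le> l0"
  shows "3 * \<delta> * k ^ 3 \<in> {0..profile_radius}"
proof -
  have "k ^ 3 \<le> k ^ 1" using assms by (intro power_decreasing) auto
  then have "3 * \<delta> * k ^ 3 \<le> 3 * \<delta> * l0" using assms by (intro mult_left_mono) auto
  moreover have "0 \<le> 3 * \<delta> * k ^ 3" using assms by simp
  ultimately show ?thesis using assms(2) unfolding atLeastAtMost_iff by linarith
qed

text \<open>The given orbit is compared with the point of the curve over its own
  \<open>p(t) = 3 \<delta> l(t)^3\<close>. That point also moves along a solution, and both tend to
  \<open>q1\<close>.\<close>

lemma orbit_on_slow_curve:
  assumes d: "\<delta> > 0" and l0: "3 * \<delta> * l0 \<le> profile_radius" "l0 \<le> 1"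
    and sol: "forward_solution \<delta> \<gamma>" and box: "\<And>t. t \<ge> 0 \<Longrightarrow> \<gamma> t \<in> slow_box l0"
    and lim: "(\<gamma> \<longlongrightarrow> q1) at_top"
  shows "\<gamma> 0 = slow_point \<delta> (snd (snd (\<gamma> 0)))"
proof -
  define r w l where "r = (\<lambda>t. fst (\<gamma> t))" and "w = (\<lambda>t. fst (snd (\<gamma> t)))" and "l = (\<lambda>t. snd (snd (\<gamma> t)))"
  define p where "p t = 3 * \<delta> * l t ^ 3" for t
  have D: "(r has_real_derivative w t + 2 * \<delta> * r t * l t ^ 3) (at t within {0..})"
    "(w has_real_derivative - force (r t) - 2 * \<delta> * w t * l t ^ 3) (at t within {0..})"
    "(l has_real_derivative - \<delta> * l t ^ 4) (at t within {0..})" if "t \<ge> 0" for t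
    using forward_solution_components(1-3)[OF sol that] by (simp_all only: r_def w_def l_def)
  have B: "\<bar>r t - 1\<bar> \<le> 1/10" "0 \<le> l t" "l t \<le> l0" if "t \<ge> 0" for t
    using box[OF that] by (auto simp: slow_box_def r_def l_def case_prod_unfold)
  have pr: "p t \<in> {0..profile_radius}" if "t \<ge> 0" for t
    unfolding p_def using slow_time_in_range[OF d l0 B(2)[OF that] B(3)[OF that]] .
  have pD: "(p has_real_derivative - (p t)\<^sup>2) (at t within {0..})" if t: "t \<ge> 0" for t
    unfolding p_def[abs_def]
    by (rule DERIV_cong[OF DERIV_cmult[OF DERIV_power[OF D(3)[OF t]]]])
       (simp add: power2_eq_square eval_nat_numeral algebra_simps)
  have lims: "(r \<longlongrightarrow> 1) at_top" "(w \<longlongrightarrow> 0) at_top" "(l \<longlongrightarrow> 0) at_top"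
    using tendsto_fst[OF lim] tendsto_fst[OF tendsto_snd[OF lim]] tendsto_snd[OF tendsto_snd[OF lim]]
    by (simp_all add: q1_def r_def w_def l_def)
  have "(p \<longlongrightarrow> 3 * \<delta> * 0 ^ 3) at_top"
    unfolding p_def by (intro tendsto_intros lims)
  then have p0: "(p \<longlongrightarrow> 0) at_top" by simp
  have "((\<lambda>t. 1 + profile 0 (p t)) \<longlongrightarrow> 1 + 0) at_top"
    by (intro tendsto_intros profile_tendsto_0[OF p0 pr])
  then have s0: "((\<lambda>t. 1 + profile 0 (p t)) \<longlongrightarrow> 1) at_top" by simp
  have "r 0 = 1 + profile 0 (p 0) \<and> w 0 = profile 1 (p 0)"
  proof (rule asymptotic_solutions_coincide[where p = p and M = "544 * exp 1000"
        and u = "\<lambda>t. profile 1 (p t)" and s = "\<lambda>t. 1 + profile 0 (p t)"])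
    fix t :: real assume t: "t \<ge> 0"
    show "(r has_real_derivative w t + 2/3 * p t * r t) (at t within {0..})"
      by (rule DERIV_cong[OF D(1)[OF t]]) (simp add: p_def)
    show "(w has_real_derivative - force (r t) - 2/3 * p t * w t) (at t within {0..})"
      by (rule DERIV_cong[OF D(2)[OF t]]) (simp add: p_def)
    show "((\<lambda>t. 1 + profile 0 (p t)) has_real_derivative
        profile 1 (p t) + 2/3 * p t * (1 + profile 0 (p t))) (at t within {0..})"
      "((\<lambda>t. profile 1 (p t)) has_real_derivative
        - force (1 + profile 0 (p t)) - 2/3 * p t * profile 1 (p t)) (at t within {0..})"
      using profile_along_flow[of p t, OF pD[OF t] pr t] by auto
    show "(p has_real_derivative - (p t)\<^sup>2) (at t within {0..})" by (rule pD[OF t])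
    show "\<bar>r t - 1\<bar> \<le> 1/10" by (rule B(1)[OF t])
    show "\<bar>1 + profile 0 (p t) - 1\<bar> \<le> 1/10" using profile_abs_le[OF pr[OF t]] by simp
    show "0 \<le> p t" "p t \<le> 1/10" using pr[OF t] profile_radius(2) by auto
    \<comment> \<open>By the first profile equation this speed is exactly \<open>p^2\<close> times
      the slope of \<open>profile 0\<close>.\<close>
    have "\<bar>profile 1 (p t) + 2/3 * p t * (1 + profile 0 (p t))\<bar>
       = (p t)\<^sup>2 * \<bar>profile_deriv 0 0 (p t) + p t * profile_deriv 0 1 (p t)\<bar>"
      using arg_cong[OF profile_ode(1)[OF pr[OF t]], of abs] by (simp add: abs_mult)
    also have "\<dots> \<le> (p t)\<^sup>2 * (544 * exp 1000)"
      using profile_slope_bound[OF pr[OF t]] by (intro mult_left_mono) auto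
    finally show "\<bar>profile 1 (p t) + 2/3 * p t * (1 + profile 0 (p t))\<bar> \<le> 544 * exp 1000 * (p t)\<^sup>2"
      by (simp add: mult.commute)
  qed (use lims s0 p0 profile_tendsto_0[OF p0 pr] in auto)
  then show ?thesis
    unfolding slow_point_def r_def w_def p_def l_def by (simp add: prod_eq_iff)
qed

lemma slow_curve_orbit:
  assumes d: "\<delta> > 0" and l0: "3 * \<delta> * l0 \<le> profile_radius" "l0 \<le> 1" and k: "0 \<le> k" "k \<le> l0"
  obtains \<gamma> where "forward_solution \<delta> \<gamma>" "\<gamma> 0 = slow_point \<delta> k" "(\<gamma> \<longlongrightarrow> q1) at_top"
    "\<And>t. t \<ge> 0 \<Longrightarrow> \<exists>m\<in>{0..k}. \<gamma> t = slow_point \<delta> m"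
proof -
  \<comment> \<open>Explicit solution of \<open>l' = - \<delta> l^4\<close>: separation of variables
    gives \<open>l^-3 = k^-3 + 3 \<delta> t\<close>. Written with \<open>b\<close>, the formula also
    covers \<open>k = 0\<close>.\<close>
  define b where "b t = 1 + 3 * \<delta> * k ^ 3 * t" for t
  define l where "l t = k * b t powr (-1/3)" for t
  define p where "p t = 3 * \<delta> * l t ^ 3" for t
  have b: "b t \<ge> 1" if "t \<ge> 0" for t
    using that d k by (simp add: b_def)
  have l: "0 \<le> l t" "l t \<le> k" if "t \<ge> 0" for t
  proof -
    have "b t powr (-1/3) \<le> b t powr 0"
      using b[OF that] by (intro powr_mono) auto
    then have "b t powr (-1/3) \<le> 1" using b[OF that] by simp
    then show "l t \<le> k" using k by (simp add: l_def mult_left_le)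
    show "0 \<le> l t" using k by (simp add: l_def)
  qed
  have pr: "p t \<in> {0..profile_radius}" if "t \<ge> 0" for t
    unfolding p_def using l[OF that] k by (intro slow_time_in_range[OF d l0]) auto
  have lD: "(l has_real_derivative - \<delta> * l t ^ 4) (at t within {0..})" if t: "t \<ge> 0" for t
  proof -
    have "(l has_real_derivative k * ((-1/3) * b t powr (-1/3 - 1) * (3 * \<delta> * k ^ 3))) (at t)"
    proof -
      have "1 + 3 * \<delta> * k ^ 3 * t > 0" using b[OF t] unfolding b_def by linarith
      then show ?thesis
        unfolding l_def[abs_def] b_def by (auto intro!: derivative_eq_intros)
    qed
    moreover have "(b t powr (-1/3)) ^ 4 = b t powr (-1/3 - 1)"
      using b[OF t] by (simp add: powr_realpow[symmetric] powr_powr del: powr_minus)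
    ultimately have "(l has_real_derivative - \<delta> * l t ^ 4) (at t)"
      by (elim DERIV_cong) (simp add: l_def power_mult_distrib eval_nat_numeral)
    then show ?thesis by (rule DERIV_subset) simp
  qed
  have pD: "(p has_real_derivative - (p t)\<^sup>2) (at t within {0..})" if t: "t \<ge> 0" for t
    unfolding p_def[abs_def]
    by (rule DERIV_cong[OF DERIV_cmult[OF DERIV_power[OF lD[OF t]]]])
       (simp add: power2_eq_square eval_nat_numeral algebra_simps)
  have lim_l: "(l \<longlongrightarrow> 0) at_top"
  proof (cases "k = 0")
    case True
    then show ?thesis by (simp add: l_def[abs_def])
  next
    case False
    then have c: "3 * \<delta> * k ^ 3 > 0" using d k by simp
    have "((\<lambda>t. b t powr (-1/3)) \<longlongrightarrow> 0) at_top"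
    proof (rule tendsto_neg_powr)
      show "LIM t at_top. b t :> at_top"
        unfolding b_def
        by (intro filterlim_tendsto_add_at_top[OF tendsto_const]
            filterlim_tendsto_pos_mult_at_top[OF tendsto_const c filterlim_ident])
    qed simp
    from tendsto_mult[OF tendsto_const[of k] this] show ?thesis
      by (simp add: l_def[abs_def])
  qed
  have "(p \<longlongrightarrow> 3 * \<delta> * 0 ^ 3) at_top"
    unfolding p_def by (intro tendsto_intros lim_l)
  then have p0: "(p \<longlongrightarrow> 0) at_top" by simp
  let ?\<gamma> = "\<lambda>t. (1 + profile 0 (p t), profile 1 (p t), l t)"
  show thesis
  proof
    show "forward_solution \<delta> ?\<gamma>"
    proof (rule forward_solutionI)
      fix t :: real assume t: "t \<ge> 0"
      show "0 < 1 + profile 0 (p t)" using profile_abs_le[OF pr[OF t], of 0] by linarith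
      show "0 \<le> l t" by (rule l(1)[OF t])
      show "(l has_real_derivative - \<delta> * l t ^ 4) (at t within {0..})" by (rule lD[OF t])
      have e: "2/3 * p t * z = 2 * \<delta> * z * l t ^ 3" for z by (simp add: p_def)
      note flow = profile_along_flow[of p t, OF pD[OF t] pr t, unfolded e]
      show "((\<lambda>t. 1 + profile 0 (p t)) has_real_derivative
          profile 1 (p t) + 2 * \<delta> * (1 + profile 0 (p t)) * l t ^ 3) (at t within {0..})"
        by (rule flow(1))
      show "((\<lambda>t. profile 1 (p t)) has_real_derivative
          - force (1 + profile 0 (p t)) - 2 * \<delta> * profile 1 (p t) * l t ^ 3) (at t within {0..})"
        by (rule flow(2))
    qed
    show "?\<gamma> 0 = slow_point \<delta> k"
      by (simp add: slow_point_def p_def l_def b_def)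
    have "(?\<gamma> \<longlongrightarrow> (1 + 0, 0, 0)) at_top"
      by (intro tendsto_intros profile_tendsto_0[OF p0 pr] lim_l)
    then show "(?\<gamma> \<longlongrightarrow> q1) at_top" by (simp add: q1_def)
    show "\<exists>m\<in>{0..k}. ?\<gamma> t = slow_point \<delta> m" if "t \<ge> 0" for t
      using l[OF that] by (auto simp: slow_point_def p_def)
  qed
qed

text \<open>\<open>slow_coeff \<delta> 0\<close> and \<open>slow_coeff \<delta> 1\<close> are the
  functions F1 and G1: extracting \<open>x = l^3\<close> from
  \<open>profile i (3 \<delta> x)\<close> leaves the factor \<open>3 \<delta>\<close>.\<close>

definition slow_coeff :: "real \<Rightarrow> nat \<Rightarrow> real \<Rightarrow> real" where
  "slow_coeff \<delta> i x = 3 * \<delta> * profile_deriv i 0 (3 * \<delta> * x)"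

lemma slow_coeff_derivs:
  fixes i :: nat
  assumes d: "\<delta> > 0" and l0: "3 * \<delta> * l0 \<le> profile_radius"
  defines "D \<equiv> \<lambda>n x. (3 * \<delta>) ^ Suc n * profile_deriv i n (3 * \<delta> * x)"
  assumes x: "x \<in> {0..l0}"
  shows "(D n has_vector_derivative D (Suc n) x) (at x within {0..l0})"
    and "\<bar>D n x\<bar> \<le> (3 * \<delta> * (32 * exp 1000)) * (3 * \<delta> * 16) ^ n * (fact n)\<^sup>2"
proof -
  have range: "3 * \<delta> * z \<in> {0..1/8000}" if "z \<in> {0..l0}" for z
  proof -
    have "3 * \<delta> * z \<le> 3 * \<delta> * l0" using that d by (intro mult_left_mono) auto
    moreover have "0 \<le> 3 * \<delta> * z" using that d by simp
    ultimately show ?thesis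
      using l0 profile_radius(2) unfolding atLeastAtMost_iff by linarith
  qed
  have "(profile_deriv i n has_real_derivative profile_deriv i (Suc n) (3 * \<delta> * x))
      (at (3 * \<delta> * x) within (\<lambda>x. 3 * \<delta> * x) ` {0..l0})"
    using range by (intro DERIV_subset[OF profile_deriv_has_derivative[OF range[OF x]]]) auto
  moreover have "((\<lambda>x. 3 * \<delta> * x) has_real_derivative 3 * \<delta>) (at x within {0..l0})"
    by (auto intro!: derivative_eq_intros)
  ultimately have "((\<lambda>x. profile_deriv i n (3 * \<delta> * x)) has_real_derivative
      profile_deriv i (Suc n) (3 * \<delta> * x) * (3 * \<delta>)) (at x within {0..l0})"
    using DERIV_image_chain[of "profile_deriv i n" _ "\<lambda>x. 3 * \<delta> * x" x "{0..l0}"] by (simp add: o_def)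
  from DERIV_cmult[OF this, of "(3 * \<delta>) ^ Suc n"]
  show "(D n has_vector_derivative D (Suc n) x) (at x within {0..l0})"
    unfolding has_real_derivative_iff_has_vector_derivative[symmetric] D_def
    by (rule DERIV_cong) simp
  have "\<bar>D n x\<bar> = (3 * \<delta>) ^ Suc n * \<bar>profile_deriv i n (3 * \<delta> * x)\<bar>"
    using d by (simp add: D_def abs_mult)
  also have "\<dots> \<le> (3 * \<delta>) ^ Suc n * ((32 * exp 1000) * 16 ^ n * (fact n)\<^sup>2)"
    using d profile_deriv_bound[OF range[OF x]] by (intro mult_left_mono) auto
  also have "\<dots> = (3 * \<delta> * (32 * exp 1000)) * (3 * \<delta> * 16) ^ n * (fact n)\<^sup>2"
    unfolding power_mult_distrib[of "3 * \<delta>" 16] power_Suc by (simp only: mult_ac)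
  finally show "\<bar>D n x\<bar> \<le> (3 * \<delta> * (32 * exp 1000)) * (3 * \<delta> * 16) ^ n * (fact n)\<^sup>2" .
qed

lemma slow_coeff_smooth:
  assumes d: "\<delta> > 0" and l0: "3 * \<delta> * l0 \<le> profile_radius" "0 < l0"
  shows "gevrey1 l0 (slow_coeff \<delta> i)"
    and "nth_deriv_within {0..l0} n (slow_coeff \<delta> i) 0 = (3 * \<delta>) ^ Suc n * profile_deriv i n 0"
    and "times_diff n {0..l0} (slow_coeff \<delta> i)"
proof -
  let ?D = "\<lambda>n x. (3 * \<delta>) ^ Suc n * profile_deriv i n (3 * \<delta> * x)"
  note D = slow_coeff_derivs[OF d l0(1), where i = i]
  have D0: "slow_coeff \<delta> i = ?D 0" by (simp add: slow_coeff_def fun_eq_iff)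
  have bot: "at x within {0..l0} \<noteq> bot" if "x \<in> {0..l0}" for x
    using that l0(2) by (intro at_within_interval_neq_bot) (auto simp: is_interval_cc)
  have nth: "nth_deriv_within {0..l0} n (slow_coeff \<delta> i) x = ?D n x" if "x \<in> {0..l0}" for n x
    by (rule nth_deriv_within_eq[where D = ?D, OF bot _ D(1) that]) (simp_all add: D0)
  show T: "times_diff n {0..l0} (slow_coeff \<delta> i)" for n
    unfolding D0 by (rule times_diff_seq[where D = ?D]) (rule D(1))
  show "nth_deriv_within {0..l0} n (slow_coeff \<delta> i) 0 = (3 * \<delta>) ^ Suc n * profile_deriv i n 0"
    using nth[of 0 n] l0(2) by simp
  have "3 * \<delta> * (32 * exp 1000) > 0" "3 * \<delta> * 16 > 0" using d by simp_all
  moreover have "\<forall>n. \<forall>x\<in>{0..l0}. \<bar>nth_deriv_within {0..l0} n (slow_coeff \<delta> i) x\<bar>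
      \<le> (3 * \<delta> * (32 * exp 1000)) * (3 * \<delta> * 16) ^ n * (fact n)\<^sup>2"
    using D(2) nth by simp
  ultimately show "gevrey1 l0 (slow_coeff \<delta> i)"
    unfolding gevrey1_def using smooth_withinI[OF bot T] by blast
qed

lemma slow_point_eq:
  "slow_point \<delta> l = (1 + l ^ 3 * slow_coeff \<delta> 0 (l ^ 3), l ^ 3 * slow_coeff \<delta> 1 (l ^ 3), l)"
  by (simp add: slow_point_def profile_def slow_coeff_def)

lemma stable_graph_slow_coeff:
  "stable_graph l (slow_coeff \<delta> 0) (slow_coeff \<delta> 1) = slow_point \<delta> ` {0..l}"
  unfolding stable_graph_def slow_point_eq[abs_def] by blast

lemma slow_point_0 [simp]: "slow_point \<delta> 0 = q1"
  by (simp add: slow_point_def q1_def)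

lemma times_diff_slow_point:
  assumes d: "\<delta> > 0" and l0: "3 * \<delta> * l0 \<le> profile_radius" "0 < l0" "l0 \<le> 1"
  shows "times_diff n {0..l0} (slow_point \<delta>)"
proof -
  have "x ^ 3 \<le> l0" if "x \<in> {0..l0}" for x
    using power_decreasing[of 1 3 x] that l0 by simp
  then have cube: "(\<lambda>x. x ^ 3) ` {0..l0} \<subseteq> {0..l0}" by auto
  have t: "times_diff n {0..l0} (\<lambda>x. slow_coeff \<delta> i (x ^ 3))" for i
    by (rule times_diff_compose[OF cube slow_coeff_smooth(3)[OF d l0(1,2)] times_diff_power[OF times_diff_id]])
  show ?thesis
    unfolding slow_point_eq[abs_def]
    by (intro times_diff_Pair times_diff_add times_diff_mult times_diff_const times_diff_power[OF times_diff_id] t times_diff_id)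
qed

lemma slow_point_in_box:
  assumes "\<delta> > 0" "3 * \<delta> * l0 \<le> profile_radius" "l0 \<le> 1" "0 \<le> k" "k \<le> l0"
  shows "slow_point \<delta> k \<in> slow_box l0"
  using profile_abs_le[OF slow_time_in_range[OF assms], of 0] profile_abs_le[OF slow_time_in_range[OF assms], of 1] assms
  by (simp add: slow_point_def slow_box_def)

lemma slow_box_subset_phase_space: "slow_box l0 \<subseteq> phase_space"
proof
  fix x assume "x \<in> slow_box l0"
  moreover obtain r w k where "x = (r, w, k)" by (cases x)
  ultimately have "\<bar>r - 1\<bar> \<le> 1/10" "0 \<le> k" "x = (r, w, k)" by (simp_all add: slow_box_def)
  moreover from this(1) have "r > 0" by linarith
  ultimately show "x \<in> phase_space" by (simp add: phase_space_def)
qed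

lemma phase_nhd_slow_box:
  assumes "0 < l0"
  shows "phase_nhd q1 (slow_box l0)"
  unfolding phase_nhd_def
proof (intro conjI exI[of _ "phase_space \<inter> {x. \<bar>fst x - 1\<bar> < 1/10 \<and> \<bar>fst (snd x)\<bar> < 1 \<and> snd (snd x) < l0}"])
  show "openin (top_of_set phase_space)
     (phase_space \<inter> {x. \<bar>fst x - 1\<bar> < 1/10 \<and> \<bar>fst (snd x)\<bar> < 1 \<and> snd (snd x) < l0})"
    by (intro openin_open_Int open_Collect_conj open_Collect_less continuous_intros)
  show "slow_box l0 \<subseteq> phase_space" by (rule slow_box_subset_phase_space)
qed (use assms in \<open>auto simp: q1_def slow_box_def phase_space_def\<close>)

section \<open>Local stable sets as arcs of the slow curve\<close>

lemma local_stable_set_on_slow_curve: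
  assumes d: "\<delta> > 0" and l0: "3 * \<delta> * l0 \<le> profile_radius" "l0 \<le> 1"
    and U: "U \<subseteq> slow_box l0" and p: "p \<in> local_stable_set \<delta> q1 U"
  shows "p = slow_point \<delta> (snd (snd p))" "snd (snd p) \<in> {0..l0}"
proof -
  obtain \<gamma> where g: "forward_solution \<delta> \<gamma>" "\<gamma> 0 = p" "\<forall>t\<ge>0. \<gamma> t \<in> U" "(\<gamma> \<longlongrightarrow> q1) at_top"
    using p by (auto simp: local_stable_set_def)
  show "p = slow_point \<delta> (snd (snd p))"
    using orbit_on_slow_curve[OF d l0 g(1) _ g(4)] g(2,3) U by auto
  have "p \<in> slow_box l0" using g(2,3) U by auto
  then show "snd (snd p) \<in> {0..l0}" by (auto simp: slow_box_def)
qed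

lemma slow_point_in_local_stable_set:
  assumes d: "\<delta> > 0" and l0: "3 * \<delta> * l0 \<le> profile_radius" "l0 \<le> 1" and k: "0 \<le> k" "k \<le> l0"
    and U: "\<And>m. m \<in> {0..k} \<Longrightarrow> slow_point \<delta> m \<in> U"
  shows "slow_point \<delta> k \<in> local_stable_set \<delta> q1 U"
proof (rule slow_curve_orbit[OF d l0 k])
  fix \<gamma> assume g: "forward_solution \<delta> \<gamma>" "\<gamma> 0 = slow_point \<delta> k" "(\<gamma> \<longlongrightarrow> q1) at_top"
    and arc: "\<And>t. t \<ge> 0 \<Longrightarrow> \<exists>m\<in>{0..k}. \<gamma> t = slow_point \<delta> m"
  have "\<gamma> t \<in> U" if "t \<ge> 0" for t
    using arc[OF that] U by auto
  then show ?thesis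
    unfolding local_stable_set_def using g by blast
qed

text \<open>The orbit of a point of the curve sweeps out the whole arc between the point and \<open>q1\<close>.\<close>

lemma local_stable_set_downward:
  assumes d: "\<delta> > 0" and l0: "3 * \<delta> * l0 \<le> profile_radius" "l0 \<le> 1"
    and U: "U \<subseteq> slow_box l0" and k: "slow_point \<delta> k \<in> local_stable_set \<delta> q1 U" and m: "0 < m" "m \<le> k"
  shows "slow_point \<delta> m \<in> local_stable_set \<delta> q1 U"
proof -
  obtain \<gamma> where g: "forward_solution \<delta> \<gamma>" "\<gamma> 0 = slow_point \<delta> k" "\<forall>t\<ge>0. \<gamma> t \<in> U" "(\<gamma> \<longlongrightarrow> q1) at_top"
    using k by (auto simp: local_stable_set_def)
  let ?l = "\<lambda>t. snd (snd (\<gamma> t))"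
  \<comment> \<open>The height tends to 0, so by the intermediate value theorem it takes the value
    \<open>m > 0\<close> at a finite time. The orbit restarted there again converges inside the box,
    hence lies on the curve over \<open>m\<close>.\<close>
  have "(?l \<longlongrightarrow> 0) at_top"
    using tendsto_snd[OF tendsto_snd[OF g(4)]] by (simp add: q1_def)
  then have "\<forall>\<^sub>F t in at_top. ?l t < m"
    using m(1) by (rule order_tendstoD)
  then obtain T where T: "T \<ge> 0" "?l T < m"
    using eventually_conj[OF _ eventually_ge_at_top[of 0]] eventually_happens by fastforce
  have "continuous_on {0..} ?l"
    using forward_solution_components(3)[OF g(1)] by (intro DERIV_continuous_on) auto
  then have "continuous_on {0..T} ?l"
    by (rule continuous_on_subset) auto
  then obtain t where t: "0 \<le> t" "?l t = m"
    using IVT2'[of ?l T m 0] T m(2) g(2) by (auto simp: slow_point_def)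
  have shift: "forward_solution \<delta> (\<lambda>s. \<gamma> (t + s))" "((\<lambda>s. \<gamma> (t + s)) \<longlongrightarrow> q1) at_top"
    using forward_solution_shift[OF g(1) t(1)] tendsto_shift_at_top[OF g(4)] by auto
  have "\<gamma> (t + s) \<in> slow_box l0" if "s \<ge> 0" for s
    using g(3) U t(1) that by auto
  from orbit_on_slow_curve[OF d l0 shift(1) this shift(2)]
  have "\<gamma> t = slow_point \<delta> m" using t(2) by simp
  then show ?thesis
    unfolding local_stable_set_def using shift g(3) t(1) by force
qed

text \<open>One global chart suffices: the inverse is the projection to \<open>l\<close>, and the
  \<open>l\<close>-component of the velocity is 1.\<close>

lemma smooth_1_manifold_slow_curve:
  assumes d: "\<delta> > 0" and l0: "3 * \<delta> * l0 \<le> profile_radius" "0 < l0" "l0 \<le> 1"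
    and J: "J \<subseteq> {0..l0}" "is_interval J" "interior J \<noteq> {}"
  shows "smooth_1_manifold (slow_point \<delta> ` J)"
  unfolding smooth_1_manifold_def
proof
  fix p assume "p \<in> slow_point \<delta> ` J"
  have T: "times_diff n J (slow_point \<delta>)" for n
    by (rule times_diff_subset[OF times_diff_slow_point[OF d l0] J(1)])
  note bot = at_within_interval_neq_bot[OF J(2,3)]
  obtain c' where c': "\<And>s. s \<in> J \<Longrightarrow> (slow_point \<delta> has_vector_derivative c' s) (at s within J)"
    using T[of 1] by auto
  have third: "snd (snd (slow_point \<delta> s)) = s" for s by (simp add: slow_point_def)
  have nz: "vector_derivative (slow_point \<delta>) (at s within J) \<noteq> 0" if s: "s \<in> J" for s
  proof -
    have "((\<lambda>s. snd (snd (slow_point \<delta> s))) has_vector_derivative snd (snd (c' s))) (at s within J)"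
      by (intro bounded_linear.has_vector_derivative[OF bounded_linear_snd] c' s)
    moreover have "((\<lambda>s. snd (snd (slow_point \<delta> s))) has_vector_derivative 1) (at s within J)"
      unfolding third by (auto intro!: derivative_eq_intros)
    ultimately have "snd (snd (c' s)) = 1"
      by (rule vector_derivative_unique_within[OF bot[OF s]])
    then show ?thesis
      using vector_derivative_within[OF bot[OF s] c'[OF s]] by auto
  qed
  have "homeomorphism J (slow_point \<delta> ` J) (slow_point \<delta>) (\<lambda>x. snd (snd x))"
  proof (rule homeomorphismI)
    show "continuous_on J (slow_point \<delta>)"
      using c' by (rule continuous_on_vector_derivative)
  qed (auto simp: third intro!: continuous_intros)
  then show "\<exists>V J' c g. open V \<and> p \<in> V \<and> is_interval J' \<and> interior J' \<noteq> {} \<and>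
        homeomorphism J' (slow_point \<delta> ` J \<inter> V) c g \<and> smooth_within J' c \<and>
        (\<forall>s\<in>J'. vector_derivative c (at s within J') \<noteq> 0)"
    using J nz smooth_withinI[OF bot T]
    by (intro exI[of _ UNIV] exI[of _ J] exI[of _ "slow_point \<delta>"] exI[of _ "\<lambda>x. snd (snd x)"]) auto
qed

lemma phase_nhd_contains_slow_arc:
  assumes d: "\<delta> > 0" and l0: "3 * \<delta> * l0 \<le> profile_radius" "0 < l0" "l0 \<le> 1"
    and U: "phase_nhd q1 U"
  obtains l1 where "0 < l1" "l1 \<le> l0" "slow_point \<delta> ` {0..l1} \<subseteq> U"
proof -
  obtain W where W: "openin (top_of_set phase_space) W" "q1 \<in> W" "W \<subseteq> U"
    using U by (auto simp: phase_nhd_def)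
  then obtain T where T: "open T" "W = phase_space \<inter> T" by (auto simp: openin_open)
  have "continuous_on {0..l0} (slow_point \<delta>)"
    using times_diff_slow_point[OF d l0, of 1] by (auto intro: continuous_on_vector_derivative)
  then have "(slow_point \<delta> \<longlongrightarrow> slow_point \<delta> 0) (at 0 within {0..l0})"
    unfolding continuous_on_def by (rule bspec) (use l0(2) in simp)
  then have "\<forall>\<^sub>F k in at 0 within {0..l0}. slow_point \<delta> k \<in> T"
    by (rule topological_tendstoD) (use T W in auto)
  then obtain e where e: "e > 0" "\<And>k. k \<in> {0..l0} \<Longrightarrow> k \<noteq> 0 \<Longrightarrow> dist k 0 < e \<Longrightarrow> slow_point \<delta> k \<in> T"
    by (auto simp: eventually_at)
  show thesis
  proof
    show "0 < min l0 (e / 2)" "min l0 (e / 2) \<le> l0" using e l0 by auto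
    show "slow_point \<delta> ` {0..min l0 (e / 2)} \<subseteq> U"
    proof (rule image_subsetI)
      fix k assume k: "k \<in> {0..min l0 (e / 2)}"
      then have "slow_point \<delta> k \<in> phase_space"
        using slow_point_in_box[OF d l0(1,3), of k] slow_box_subset_phase_space by auto
      moreover have "slow_point \<delta> k \<in> T"
        using k e W T by (cases "k = 0") auto
      ultimately show "slow_point \<delta> k \<in> U" using T W by auto
    qed
  qed
qed

text \<open>A small neighbourhood \<open>U\<close> of arbitrary shape can cut the curve at any
  height, and the remaining arc need not contain its upper endpoint. The graph form over a closed
  interval is therefore stated after cutting \<open>U\<close> at a small height, while the manifold
  property holds for \<open>U\<close> itself.\<close>

theorem theorem2p6:
  fixes \<delta> :: real
  assumes "\<delta> > 0"
  shows "\<exists>l0 F1 G1 U0.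
    0 < l0 \<and> l0 < 1 \<and> gevrey1 l0 F1 \<and> gevrey1 l0 G1 \<and>
    (\<forall>n. nth_deriv_within {0..l0} (2 * n) F1 0 = 0) \<and>
    (\<forall>n. nth_deriv_within {0..l0} (2 * n + 1) G1 0 = 0) \<and>
    phase_nhd q1 U0 \<and>
    local_stable_set \<delta> q1 U0 = stable_graph l0 F1 G1 \<and>
    (\<forall>U. phase_nhd q1 U \<and> U \<subseteq> U0 \<longrightarrow>
       smooth_1_manifold (local_stable_set \<delta> q1 U) \<and>
       (\<exists>l1. 0 < l1 \<and> l1 \<le> l0 \<and>
          (\<forall>l. 0 < l \<and> l \<le> l1 \<longrightarrow>
             local_stable_set \<delta> q1 (U \<inter> {(r, v, k). k \<le> l}) = stable_graph l F1 G1)))"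
proof -
  \<comment> \<open>The value 1/2 secures \<open>l0 < 1\<close>, and hence
    \<open>l^3 \<le> l\<close>; the other bound keeps \<open>3 \<delta> l^3\<close> within the
    radius of the profiles.\<close>
  define l0 where "l0 = min (1/2) (profile_radius / (3 * \<delta>))"
  have l0: "3 * \<delta> * l0 \<le> profile_radius" "0 < l0" "l0 \<le> 1" "l0 < 1"
  proof -
    have "l0 \<le> profile_radius / (3 * \<delta>)" by (simp add: l0_def)
    then show "3 * \<delta> * l0 \<le> profile_radius" using assms by (simp add: field_simps)
  qed (use assms profile_radius(1) in \<open>auto simp: l0_def\<close>)
  note on_curve = local_stable_set_on_slow_curve[OF assms l0(1,3)]
    and in_set = slow_point_in_local_stable_set[OF assms l0(1,3)]
    and in_box = slow_point_in_box[OF assms l0(1,3)]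
  \<comment> \<open>Stated for a general height so that it serves both the full box and the
    truncated neighbourhoods.\<close>
  have graph: "local_stable_set \<delta> q1 U = slow_point \<delta> ` {0..l}"
    if "0 \<le> l" "l \<le> l0" "U \<subseteq> slow_box l0" "slow_point \<delta> ` {0..l} \<subseteq> U" "\<And>p. p \<in> U \<Longrightarrow> snd (snd p) \<le> l" for U l
  proof
    show "local_stable_set \<delta> q1 U \<subseteq> slow_point \<delta> ` {0..l}"
    proof
      fix p assume p: "p \<in> local_stable_set \<delta> q1 U"
      then have "p \<in> U" by (auto simp: local_stable_set_def)
      then have "snd (snd p) \<in> {0..l}" using that(5) on_curve(2)[OF that(3) p] by auto
      then show "p \<in> slow_point \<delta> ` {0..l}" using on_curve(1)[OF that(3) p] by (metis image_eqI)
    qed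
    show "slow_point \<delta> ` {0..l} \<subseteq> local_stable_set \<delta> q1 U"
    proof (rule image_subsetI, rule in_set)
      fix k m assume k: "k \<in> {0..l}"
      show "0 \<le> k" "k \<le> l0" using k that(2) by auto
      show "slow_point \<delta> m \<in> U" if "m \<in> {0..k}"
        using \<open>slow_point \<delta> ` {0..l} \<subseteq> U\<close> k that by auto
    qed
  qed
  have graph0: "local_stable_set \<delta> q1 (slow_box l0) = slow_point \<delta> ` {0..l0}"
    using l0 by (intro graph) (auto simp: in_box, auto simp: slow_box_def)
  have local: "smooth_1_manifold (local_stable_set \<delta> q1 U) \<and>
       (\<exists>l1. 0 < l1 \<and> l1 \<le> l0 \<and> (\<forall>l. 0 < l \<and> l \<le> l1 \<longrightarrow>
          local_stable_set \<delta> q1 (U \<inter> {(r, v, k). k \<le> l}) = slow_point \<delta> ` {0..l}))"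
    if nhd: "phase_nhd q1 U" and U: "U \<subseteq> slow_box l0" for U
  proof -
    obtain l1 where l1: "0 < l1" "l1 \<le> l0" "slow_point \<delta> ` {0..l1} \<subseteq> U"
      by (rule phase_nhd_contains_slow_arc[OF assms l0(1-3) nhd])
    \<comment> \<open>The heights of the stable points. Heights up to \<open>l1\<close> all belong
      to \<open>J\<close>; above \<open>l1 > 0\<close> it is downward closed along orbits. The split
      is needed because no orbit starting above 0 reaches height 0.\<close>
    define J where "J = {k \<in> {0..l0}. slow_point \<delta> k \<in> local_stable_set \<delta> q1 U}"
    have "local_stable_set \<delta> q1 U = slow_point \<delta> ` J"
    proof
      show "local_stable_set \<delta> q1 U \<subseteq> slow_point \<delta> ` J"
      proof
        fix p assume p: "p \<in> local_stable_set \<delta> q1 U"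
        then have "snd (snd p) \<in> J" using on_curve[OF U p] by (simp add: J_def)
        then show "p \<in> slow_point \<delta> ` J" using on_curve(1)[OF U p] by (metis image_eqI)
      qed
    qed (auto simp: J_def)
    moreover have sub: "{0..l1} \<subseteq> J"
      using l1 by (auto simp: J_def intro!: in_set)
    have "is_interval J"
      unfolding is_interval_1
    proof (intro ballI allI impI)
      fix a b x assume ab: "a \<in> J" "b \<in> J" "a \<le> x \<and> x \<le> b"
      show "x \<in> J"
      proof (cases "x \<le> l1")
        case True
        moreover have "0 \<le> x" using ab by (simp add: J_def)
        ultimately show ?thesis using sub by auto
      next
        case False
        then show ?thesis
          using local_stable_set_downward[OF assms l0(1,3) U, of b x] ab l1 by (auto simp: J_def)
      qed
    qed
    moreover have "interior J \<noteq> {}"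
      using interior_mono[OF sub] l1(1) by auto
    moreover have "J \<subseteq> {0..l0}" by (auto simp: J_def)
    ultimately have "smooth_1_manifold (local_stable_set \<delta> q1 U)"
      using smooth_1_manifold_slow_curve[OF assms l0(1-3)] by simp
    moreover have "local_stable_set \<delta> q1 (U \<inter> {(r, v, k). k \<le> l}) = slow_point \<delta> ` {0..l}"
      if "0 < l" "l \<le> l1" for l
      using that l1 U by (intro graph) (auto simp: slow_point_def)
    ultimately show ?thesis using l1 by blast
  qed
  show ?thesis
  proof (rule exI[of _ l0], rule exI[of _ "slow_coeff \<delta> 0"], rule exI[of _ "slow_coeff \<delta> 1"],
      rule exI[of _ "slow_box l0"], intro conjI)
    show "\<forall>n. nth_deriv_within {0..l0} (2 * n) (slow_coeff \<delta> 0) 0 = 0"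
      "\<forall>n. nth_deriv_within {0..l0} (2 * n + 1) (slow_coeff \<delta> 1) 0 = 0"
      by (simp_all add: slow_coeff_smooth(2)[OF assms l0(1,2)] profile_deriv_at_0)
    show "local_stable_set \<delta> q1 (slow_box l0) = stable_graph l0 (slow_coeff \<delta> 0) (slow_coeff \<delta> 1)"
      unfolding stable_graph_slow_coeff by (rule graph0)
    show "\<forall>U. phase_nhd q1 U \<and> U \<subseteq> slow_box l0 \<longrightarrow>
       smooth_1_manifold (local_stable_set \<delta> q1 U) \<and>
       (\<exists>l1. 0 < l1 \<and> l1 \<le> l0 \<and> (\<forall>l. 0 < l \<and> l \<le> l1 \<longrightarrow>
          local_stable_set \<delta> q1 (U \<inter> {(r, v, k). k \<le> l})
            = stable_graph l (slow_coeff \<delta> 0) (slow_coeff \<delta> 1)))"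
      unfolding stable_graph_slow_coeff using local by blast
  qed (rule l0 slow_coeff_smooth(1)[OF assms l0(1,2)] phase_nhd_slow_box[OF l0(2)])+
qed

end
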